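(* Let $I_1,I_2,\dots$ be an arbitrary (finite or infinite) number of mutually disjoint subsets of $\mathbb{N}$, let $\varphi_i$ be a state of $\mathcal{A}(I_i)$ for each $i$, and let $\varphi$ be the product state extension of the states $\varphi_i$ to $\mathcal{A}(\bigcup_i I_i)$. Assume that all $\varphi_i$ with $i\neq 1$ are even. (1) $\varphi_1$ is pure if $\varphi$ is pure. (2) Assume that the GNS representations $\pi_{\varphi_1}$ and $\pi_{\varphi_1\Theta}$ of $\mathcal{A}(I_1)$ are not disjoint. Then $\varphi$ is pure if and only if all $\varphi_i$ are pure. In particular, this is the case if $\varphi$ is even.
   Context: $\mathbb{N}=\{1,2,\dots\}$. $\mathcal{A}$ is the CAR (Fermion) algebra: the unital $C^*$-algebra generated by elements $a_i, a_i^*$, $i\in\mathbb{N}$, satisfying $\{a_i^*,a_j\}=\delta_{i,j}\mathbf{1}$ and $\{a_i^*,a_j^*\}=\{a_i,a_j\}=0$ for all $i,j$, where $\{A,B\}=AB+BA$. For $I\subset\mathbb{N}$, $\mathcal{A}(I)$ is the (unital) $C^*$-subalgebra generated by $a_i,a_i^*$, $i\in I$. $\Theta$ is the unique automorphism of $\mathcal{A}$ with $\Theta(a_i)=-a_i$, $\Theta(a_i^* )=-a_i^*$ for all $i$; it preserves each $\mathcal{A}(I)$. A state $\varphi$ of $\mathcal{A}(I)$ is called even if $\varphi(\Theta(A))=\varphi(A)$ for all $A\in\mathcal{A}(I)$. For a state $\varphi$, $\varphi\Theta$ denotes the state $A\mapsto\varphi(\Theta(A))$, and $\pi_\varphi$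 denotes the GNS representation of $\varphi$. For mutually disjoint $I_1,I_2,\dots$ and states $\varphi_i$ of $\mathcal{A}(I_i)$, a product state extension is a state $\varphi$ of $\mathcal{A}(\bigcup_i I_i)$ with $\varphi(A_1A_2\cdots A_k)=\prod_{i=1}^k\varphi_i(A_i)$ for all $A_i\in\mathcal{A}(I_i)$ and all $k$ (with $k$ at most the number of subsystems if that is finite). When all $\varphi_i$ except at most one are even, it exists and is unique. Two representations of a $C^*$-algebra are disjoint if they have no unitarily equivalent non-zero subrepresentations (equivalently, no non-zero intertwiner). *)

theory Defs
  imports "HOL-Analysis.Analysis" "HOL-Library.Extended_Nat"
begin

section \<open>Complex Hilbert spaces and unital C*-algebras\<close>

class complex_normed_vector = real_normed_vector +
  fixes scaleC :: "complex \<Rightarrow> 'a \<Rightarrow> 'a" (infixr "*\<^sub>C" 75)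
  assumes scaleC_add_right: "c *\<^sub>C (x + y) = c *\<^sub>C x + c *\<^sub>C y"
    and scaleC_add_left: "(c + d) *\<^sub>C x = c *\<^sub>C x + d *\<^sub>C x"
    and scaleC_scaleC: "c *\<^sub>C d *\<^sub>C x = (c * d) *\<^sub>C x"
    and scaleR_scaleC: "r *\<^sub>R x = complex_of_real r *\<^sub>C x"
    and norm_scaleC: "norm (c *\<^sub>C x) = cmod c * norm x"

instantiation complex :: complex_normed_vector
begin

definition scaleC_complex :: "complex \<Rightarrow> complex \<Rightarrow> complex"
  where "scaleC_complex c z = c * z"

instance
  by standard (simp_all add: scaleC_complex_def algebra_simps scaleR_conv_of_real norm_mult)

end

text \<open>Inner products are linear in the second argument.\<close>

class chilbert_space = complex_normed_vector + banach +
  fixes cinner :: "'a \<Rightarrow> 'a \<Rightarrow> complex"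
  assumes cinner_commute: "cinner x y = cnj (cinner y x)"
    and cinner_add_right: "cinner x (y + z) = cinner x y + cinner x z"
    and cinner_scaleC_right: "cinner x (c *\<^sub>C y) = c * cinner x y"
    and cinner_self: "cinner x x = complex_of_real ((norm x)\<^sup>2)"

class cstar_algebra = complex_normed_vector + real_normed_algebra_1 + banach +
  fixes star :: "'a \<Rightarrow> 'a"
  assumes mult_scaleC_left: "(c *\<^sub>C x) * y = c *\<^sub>C (x * y)"
    and mult_scaleC_right: "x * (c *\<^sub>C y) = c *\<^sub>C (x * y)"
    and star_star: "star (star x) = x"
    and star_add: "star (x + y) = star x + star y"
    and star_scaleC: "star (c *\<^sub>C x) = cnj c *\<^sub>C star x"
    and star_mult: "star (x * y) = star y * star x"
    and cstar_identity: "norm (star x * x) = (norm x)\<^sup>2"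

definition clinear_on ::
  "'a::complex_normed_vector set \<Rightarrow> ('a \<Rightarrow> 'b::complex_normed_vector) \<Rightarrow> bool"
  where "clinear_on S f \<longleftrightarrow>
    (\<forall>x\<in>S. \<forall>y\<in>S. f (x + y) = f x + f y) \<and> (\<forall>c. \<forall>x\<in>S. f (c *\<^sub>C x) = c *\<^sub>C f x)"

definition closed_csubspace :: "'a::complex_normed_vector set \<Rightarrow> bool"
  where "closed_csubspace K \<longleftrightarrow>
    0 \<in> K \<and> (\<forall>x\<in>K. \<forall>y\<in>K. x + y \<in> K) \<and> (\<forall>c. \<forall>x\<in>K. c *\<^sub>C x \<in> K) \<and> closed K"

definition cstar_subalgebra :: "'a::cstar_algebra set \<Rightarrow> bool"
  where "cstar_subalgebra S \<longleftrightarrow>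
    closed_csubspace S \<and> 1 \<in> S \<and> (\<forall>x\<in>S. \<forall>y\<in>S. x * y \<in> S) \<and> (\<forall>x\<in>S. star x \<in> S)"

text \<open>Preservation of the norm is automatic for *-automorphisms of C*-algebras; it is listed here
  as part of preserving the C*-algebra structure.\<close>

definition cstar_automorphism :: "('a::cstar_algebra \<Rightarrow> 'a) \<Rightarrow> bool"
  where "cstar_automorphism \<theta> \<longleftrightarrow>
    bij \<theta> \<and> clinear_on UNIV \<theta> \<and> (\<forall>x y. \<theta> (x * y) = \<theta> x * \<theta> y) \<and>
    (\<forall>x. \<theta> (star x) = star (\<theta> x)) \<and> (\<forall>x. norm (\<theta> x) = norm x)"


section \<open>States\<close>

text \<open>A functional on a subalgebra \<open>S\<close> is given by a function on the whole type, of which only the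
  values on \<open>S\<close> are relevant; functionals are compared on \<open>S\<close> only.\<close>

definition state_on :: "'a::cstar_algebra set \<Rightarrow> ('a \<Rightarrow> complex) \<Rightarrow> bool"
  where "state_on S \<phi> \<longleftrightarrow>
    clinear_on S \<phi> \<and> (\<forall>x\<in>S. \<phi> (star x * x) \<in> \<real>\<^sub>\<ge>\<^sub>0) \<and> \<phi> 1 = 1"

definition pure_state_on :: "'a::cstar_algebra set \<Rightarrow> ('a \<Rightarrow> complex) \<Rightarrow> bool"
  where "pure_state_on S \<phi> \<longleftrightarrow> state_on S \<phi> \<and>
    (\<forall>\<psi> \<psi>' t. state_on S \<psi> \<longrightarrow> state_on S \<psi>' \<longrightarrow> 0 < t \<longrightarrow> t < 1 \<longrightarrow>
      (\<forall>x\<in>S. \<phi> x = complex_of_real t * \<psi> x + complex_of_real (1 - t) * \<psi>' x) \<longrightarrow>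
      (\<forall>x\<in>S. \<psi> x = \<phi> x \<and> \<psi>' x = \<phi> x))"


section \<open>Representations\<close>

text \<open>A Hilbert space is a closed subspace \<open>H\<close> of a type of class \<^class>\<open>chilbert_space\<close>, so that one
  type accommodates Hilbert spaces of different dimensions; operators on \<open>H\<close> are relevant on \<open>H\<close>
  only.\<close>

definition representation_on ::
  "'a::cstar_algebra set \<Rightarrow> 'h::chilbert_space set \<Rightarrow> ('a \<Rightarrow> 'h \<Rightarrow> 'h) \<Rightarrow> bool"
  where "representation_on S H \<pi> \<longleftrightarrow>
    closed_csubspace H \<and>
    (\<forall>x\<in>S. \<pi> x ` H \<subseteq> H \<and> clinear_on H (\<pi> x) \<and> (\<exists>C. \<forall>\<xi>\<in>H. norm (\<pi> x \<xi>) \<le> C * norm \<xi>)) \<and>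
    (\<forall>\<xi>\<in>H. clinear_on S (\<lambda>x. \<pi> x \<xi>)) \<and>
    (\<forall>\<xi>\<in>H. \<pi> 1 \<xi> = \<xi>) \<and>
    (\<forall>x\<in>S. \<forall>y\<in>S. \<forall>\<xi>\<in>H. \<pi> (x * y) \<xi> = \<pi> x (\<pi> y \<xi>)) \<and>
    (\<forall>x\<in>S. \<forall>\<xi>\<in>H. \<forall>\<eta>\<in>H. cinner (\<pi> (star x) \<xi>) \<eta> = cinner \<xi> (\<pi> x \<eta>))"

text \<open>The GNS triple of a state, determined up to unitary equivalence.\<close>

definition gns_triple ::
  "'a::cstar_algebra set \<Rightarrow> ('a \<Rightarrow> complex) \<Rightarrow>
    'h::chilbert_space set \<Rightarrow> ('a \<Rightarrow> 'h \<Rightarrow> 'h) \<Rightarrow> 'h \<Rightarrow> bool"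
  where "gns_triple S \<phi> H \<pi> \<Omega> \<longleftrightarrow>
    representation_on S H \<pi> \<and> \<Omega> \<in> H \<and> closure ((\<lambda>x. \<pi> x \<Omega>) ` S) = H \<and>
    (\<forall>x\<in>S. \<phi> x = cinner \<Omega> (\<pi> x \<Omega>))"

definition subrepresentation ::
  "'a::cstar_algebra set \<Rightarrow> 'h::chilbert_space set \<Rightarrow> ('a \<Rightarrow> 'h \<Rightarrow> 'h) \<Rightarrow> 'h set \<Rightarrow> bool"
  where "subrepresentation S H \<pi> K \<longleftrightarrow>
    closed_csubspace K \<and> K \<subseteq> H \<and> (\<forall>x\<in>S. \<pi> x ` K \<subseteq> K)"

definition unitarily_equivalent ::
  "'a::cstar_algebra set \<Rightarrow> 'h::chilbert_space set \<Rightarrow> ('a \<Rightarrow> 'h \<Rightarrow> 'h) \<Rightarrow>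
    'k::chilbert_space set \<Rightarrow> ('a \<Rightarrow> 'k \<Rightarrow> 'k) \<Rightarrow> bool"
  where "unitarily_equivalent S H \<pi> K \<rho> \<longleftrightarrow>
    (\<exists>U. clinear_on H U \<and> bij_betw U H K \<and>
      (\<forall>\<xi>\<in>H. \<forall>\<eta>\<in>H. cinner (U \<xi>) (U \<eta>) = cinner \<xi> \<eta>) \<and>
      (\<forall>x\<in>S. \<forall>\<xi>\<in>H. U (\<pi> x \<xi>) = \<rho> x (U \<xi>)))"

definition disjoint_representations ::
  "'a::cstar_algebra set \<Rightarrow> 'h::chilbert_space set \<Rightarrow> ('a \<Rightarrow> 'h \<Rightarrow> 'h) \<Rightarrow>
    'k::chilbert_space set \<Rightarrow> ('a \<Rightarrow> 'k \<Rightarrow> 'k) \<Rightarrow> bool"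
  where "disjoint_representations S H \<pi> K \<rho> \<longleftrightarrow>
    \<not> (\<exists>H' K'. subrepresentation S H \<pi> H' \<and> H' \<noteq> {0} \<and>
         subrepresentation S K \<rho> K' \<and> K' \<noteq> {0} \<and> unitarily_equivalent S H' \<pi> K' \<rho>)"


section \<open>The CAR algebra\<close>

definition anticommutator :: "'a::cstar_algebra \<Rightarrow> 'a \<Rightarrow> 'a"
  where "anticommutator x y = x * y + y * x"

text \<open>The relations determine the C*-algebra up to isomorphism, so the CAR algebra is any type of
  class \<^class>\<open>cstar_algebra\<close> generated by such a family. The modes are numbered from 0.\<close>

definition car_generators :: "(nat \<Rightarrow> 'a::cstar_algebra) \<Rightarrow> bool"
  where "car_generators a \<longleftrightarrow>
    (\<forall>i j. anticommutator (star (a i)) (a j) = (if i = j then 1 else 0)) \<and>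
    (\<forall>i j. anticommutator (star (a i)) (star (a j)) = 0) \<and>
    (\<forall>i j. anticommutator (a i) (a j) = 0) \<and>
    cstar_subalgebra hull (range a) = UNIV"

definition car_subalgebra :: "(nat \<Rightarrow> 'a::cstar_algebra) \<Rightarrow> nat set \<Rightarrow> 'a set"
  where "car_subalgebra a I = cstar_subalgebra hull (a ` I)"

definition car_parity :: "(nat \<Rightarrow> 'a::cstar_algebra) \<Rightarrow> 'a \<Rightarrow> 'a"
  where "car_parity a = (THE \<theta>. cstar_automorphism \<theta> \<and>
    (\<forall>i. \<theta> (a i) = - a i \<and> \<theta> (star (a i)) = - star (a i)))"

definition even_on :: "(nat \<Rightarrow> 'a::cstar_algebra) \<Rightarrow> nat set \<Rightarrow> ('a \<Rightarrow> complex) \<Rightarrow> bool"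
  where "even_on a I \<phi> \<longleftrightarrow> (\<forall>x\<in>car_subalgebra a I. \<phi> (car_parity a x) = \<phi> x)"

text \<open>The labels \<open>1, \<dots>, N\<close>, or all of \<open>1, 2, \<dots>\<close> if \<open>N = \<infinity>\<close>.\<close>

definition labels :: "enat \<Rightarrow> nat set"
  where "labels N = {i. 1 \<le> i \<and> enat i \<le> N}"

definition product_state_extension ::
  "(nat \<Rightarrow> 'a::cstar_algebra) \<Rightarrow> enat \<Rightarrow> (nat \<Rightarrow> nat set) \<Rightarrow> (nat \<Rightarrow> 'a \<Rightarrow> complex) \<Rightarrow>
    ('a \<Rightarrow> complex) \<Rightarrow> bool"
  where "product_state_extension a N I \<phi>s \<phi> \<longleftrightarrow>
    state_on (car_subalgebra a (\<Union>i\<in>labels N. I i)) \<phi> \<and>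
    (\<forall>k\<in>labels N. \<forall>A. (\<forall>i\<in>{1..k}. A i \<in> car_subalgebra a (I i)) \<longrightarrow>
      \<phi> (prod_list (map A [1..<Suc k])) = (\<Prod>i=1..k. \<phi>s i (A i)))"

end

theory Submission
  imports Defs
begin

text \<open>Write \<open>\<Theta>\<close> for the parity and let \<open>\<phi>\<close> factorize over \<open>\<A> I\<close> and \<open>\<A> J\<close>, with \<open>I\<close> and \<open>J\<close>
  disjoint and \<open>\<phi>\<close> even on \<open>\<A> J\<close>. A state is pure iff every positive functional below it is a
  multiple of it.

  If \<open>\<phi>\<close> is pure, a functional \<open>\<omega> \<le> \<phi>\<close> on \<open>\<A> I\<close> is a limit of \<open>\<phi> (star (C n) * x)\<close> with
  \<open>C n \<in> \<A> I\<close> (Riesz); the same limit on the whole algebra is \<open>\<omega> x * \<phi> y\<close> on products \<open>x * y\<close>, and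
  evenness on \<open>\<A> J\<close> together with the Schur product theorem makes it positive. Hence the marginal on
  \<open>\<A> I\<close> is pure.

  If \<open>\<phi>\<close> is even on both algebras and its marginals are pure, then \<open>\<omega> \<le> \<phi>\<close> gives
  \<open>\<omega> (star b * x * b) = \<omega> (star b * b) * \<phi> x\<close> for \<open>b \<in> \<A> J\<close>, and by polarization \<open>\<omega>\<close> is a
  multiple of \<open>\<phi>\<close>.

  If the pure marginal on \<open>\<A> I\<close> is not even but its GNS representation is not disjoint from that of its
  composition with \<open>\<Theta>\<close>, then \<open>\<Theta>\<close> is implemented by a self-adjoint unitary on the GNS space, which has
  an eigenvector; that vector is even. Replacing the marginal by this vector state changes neither
  purity of the marginal nor purity of \<open>\<phi>\<close>, which reduces the claim to the even case.\<close>

section \<open>Complex vector spaces and C*-algebras\<close>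

text \<open>Algebras on disjoint index sets commute only up to the grading: moving \<open>y\<close>
  past \<open>x\<close> splits \<open>y\<close> into even and odd parts, and the odd part turns
  \<open>x\<close> into \<open>\<Theta> x\<close>. Evenness enters in two ways: on the side of
  \<open>y\<close> it removes the odd terms, on the side of \<open>x\<close> it removes the
  \<open>\<Theta>\<close>. A vector of the GNS space of a marginal also has to act on the joint
  algebra, for which no Hilbert space is given. Such vectors are therefore represented by sequences
  in the algebra that are Cauchy for the seminorm \<open>sqrt (Re (\<omega> (star x * x)))\<close>;
  a sequence in \<open>\<A> I\<close> can be read unchanged in \<open>\<A> (I \<union> J)\<close>,
  and limits of functionals are limits of complex numbers. Actual GNS spaces occur only where the
  hypotheses provide them, for the first marginal and its composition with \<open>\<Theta>\<close>.
  If the first marginal is not pure, both sides of the equivalence in (2) fail, so non-disjointness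
  is exploited only for a pure first marginal.\<close>

interpretation cvec: vector_space "scaleC :: complex \<Rightarrow> 'b \<Rightarrow> 'b::complex_normed_vector"
proof
  fix x :: 'b
  have "1 *\<^sub>C x = (1::real) *\<^sub>R x"
    by (simp only: scaleR_scaleC of_real_1)
  then show "1 *\<^sub>C x = x" by simp
qed (simp_all add: scaleC_add_right scaleC_add_left scaleC_scaleC)

lemma scaleC_minus1_left [simp]: "(- 1) *\<^sub>C x = - (x::'b::complex_normed_vector)"
  using cvec.scale_minus_left[of 1 x] by simp

lemma scaleC_eq_mult [simp]: "c *\<^sub>C (z::complex) = c * z"
  by (simp add: scaleC_complex_def)

lemma bounded_linear_scaleC: "bounded_linear (\<lambda>x::'b::complex_normed_vector. c *\<^sub>C x)"
  by (rule bounded_linear_intro[where K = "cmod c"])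
    (simp_all add: scaleC_add_right scaleR_scaleC scaleC_scaleC norm_scaleC mult.commute)

lemmas tendsto_scaleC [tendsto_intros] = bounded_linear.tendsto[OF bounded_linear_scaleC]
lemmas continuous_on_scaleC [continuous_intros] = bounded_linear.continuous_on[OF bounded_linear_scaleC]

text \<open>\<open>closed_csubspace\<close> without closedness: linear spans and unions of chains of
  subalgebras are of this kind before the closure is taken.\<close>

definition csubspace :: "'b::complex_normed_vector set \<Rightarrow> bool"
  where "csubspace V \<longleftrightarrow> 0 \<in> V \<and> (\<forall>x\<in>V. \<forall>y\<in>V. x + y \<in> V) \<and> (\<forall>c. \<forall>x\<in>V. c *\<^sub>C x \<in> V)"

lemma csubspaceD:
  assumes "csubspace V"
  shows csubspace_zero: "0 \<in> V"
    and csubspace_add: "x \<in> V \<Longrightarrow> y \<in> V \<Longrightarrow> x + y \<in> V"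
    and csubspace_scale: "x \<in> V \<Longrightarrow> c *\<^sub>C x \<in> V"
    and csubspace_minus: "x \<in> V \<Longrightarrow> - x \<in> V"
    and csubspace_diff: "x \<in> V \<Longrightarrow> y \<in> V \<Longrightarrow> x - y \<in> V"
    and csubspace_scaleR: "x \<in> V \<Longrightarrow> r *\<^sub>R x \<in> V"
proof -
  show *: "0 \<in> V" "\<And>x y. x \<in> V \<Longrightarrow> y \<in> V \<Longrightarrow> x + y \<in> V" "\<And>c x. x \<in> V \<Longrightarrow> c *\<^sub>C x \<in> V"
    using assms by (auto simp: csubspace_def)
  show **: "- x \<in> V" if "x \<in> V" for x using *(3)[of x "-1"] that by simp
  show "x - y \<in> V" if "x \<in> V" "y \<in> V" for x y
    using *(2)[of x "- y"] **[of y] that by simp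
  show "r *\<^sub>R x \<in> V" if "x \<in> V" for x
    using *(3)[of x "of_real r"] that by (simp add: scaleR_scaleC)
qed

lemma csubspace_sum: "csubspace V \<Longrightarrow> (\<And>i. i \<in> F \<Longrightarrow> f i \<in> V) \<Longrightarrow> sum f F \<in> V"
  by (induction F rule: infinite_finite_induct) (auto simp: csubspaceD)

lemma closed_csubspace_iff: "closed_csubspace V \<longleftrightarrow> csubspace V \<and> closed V"
  by (auto simp: closed_csubspace_def csubspace_def)

lemma csubspace_closure:
  fixes V :: "'b::complex_normed_vector set"
  assumes "csubspace V" shows "closed_csubspace (closure V)"
  unfolding closed_csubspace_iff csubspace_def
proof (intro conjI ballI allI)
  show "0 \<in> closure V" using csubspace_zero[OF assms] closure_subset by blast
  fix x assume "x \<in> closure V"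
  then obtain f where f: "\<And>n. f n \<in> V" "f \<longlonglongrightarrow> x" by (auto simp: closure_sequential)
  have "\<And>n. c *\<^sub>C f n \<in> V" for c using f assms by (auto simp: csubspaceD)
  then show "c *\<^sub>C x \<in> closure V" for c
    using tendsto_scaleC[OF f(2), of c]
    by (auto simp: closure_sequential intro!: exI[of _ "\<lambda>n. c *\<^sub>C f n"])
  fix y assume "y \<in> closure V"
  then obtain g where g: "\<And>n. g n \<in> V" "g \<longlonglongrightarrow> y" by (auto simp: closure_sequential)
  have "\<And>n. f n + g n \<in> V" using f g assms by (auto simp: csubspaceD)
  then show "x + y \<in> closure V"
    using tendsto_add[OF f(2) g(2)]
    by (auto simp: closure_sequential intro!: exI[of _ "\<lambda>n. f n + g n"])
qed simp

lemma clinear_onD: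
  assumes "clinear_on S f" "csubspace S"
  shows clinear_on_add: "x \<in> S \<Longrightarrow> y \<in> S \<Longrightarrow> f (x + y) = f x + f y"
    and clinear_on_scale: "x \<in> S \<Longrightarrow> f (c *\<^sub>C x) = c *\<^sub>C f x"
    and clinear_on_zero: "f 0 = 0"
    and clinear_on_minus: "x \<in> S \<Longrightarrow> f (- x) = - f x"
    and clinear_on_diff: "x \<in> S \<Longrightarrow> y \<in> S \<Longrightarrow> f (x - y) = f x - f y"
proof -
  show *: "\<And>x y. x \<in> S \<Longrightarrow> y \<in> S \<Longrightarrow> f (x + y) = f x + f y" "\<And>c x. x \<in> S \<Longrightarrow> f (c *\<^sub>C x) = c *\<^sub>C f x"
    using assms by (auto simp: clinear_on_def)
  show "f 0 = 0" using *(2)[of 0 0] assms(2) by (simp add: csubspaceD)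
  show **: "f (- x) = - f x" if "x \<in> S" for x using *(2)[of x "-1"] that by simp
  show "f (x - y) = f x - f y" if "x \<in> S" "y \<in> S" for x y
    using *(1)[of x "- y"] **[of y] that assms(2) by (simp add: csubspaceD)
qed

lemma clinear_on_sum:
  assumes "clinear_on S f" "csubspace S" "\<And>i. i \<in> F \<Longrightarrow> g i \<in> S"
  shows "f (sum g F) = (\<Sum>i\<in>F. f (g i))"
  using assms(3)
proof (induction F rule: infinite_finite_induct)
  case (insert i F)
  then have "sum g F \<in> S" by (intro csubspace_sum[OF assms(2)]) auto
  with insert show ?case using clinear_on_add[OF assms(1,2), of "g i" "sum g F"] by simp
qed (simp_all add: clinear_on_zero[OF assms(1,2)])

lemma clinear_on_subset: "clinear_on S f \<Longrightarrow> T \<subseteq> S \<Longrightarrow> clinear_on T f"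
  unfolding clinear_on_def by blast

section \<open>Elementary consequences of the C*-axioms\<close>

lemma star_one [simp]: "star (1::'a::cstar_algebra) = 1"
  by (metis mult_1 mult_1_right star_mult star_star)

lemma star_zero [simp]: "star (0::'a::cstar_algebra) = 0"
  using star_add[of 0 "0::'a"] by simp

lemma star_minus [simp]: "star (- x) = - star (x::'a::cstar_algebra)"
  using star_add[of x "-x"] by (simp add: eq_neg_iff_add_eq_0 add.commute)

lemma star_diff: "star (x - y) = star x - star (y::'a::cstar_algebra)"
  using star_add[of x "-y"] by simp

lemma star_scaleR: "star (r *\<^sub>R x) = r *\<^sub>R star (x::'a::cstar_algebra)"
  by (simp add: scaleR_scaleC star_scaleC)

lemma star_sum: "star (sum f F) = (\<Sum>i\<in>F. star (f i :: 'a::cstar_algebra))"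
  by (induction F rule: infinite_finite_induct) (simp_all add: star_add)

text \<open>The C*-identity and submultiplicativity give \<open>norm y \<le> norm (star y)\<close>;
  using this for \<open>x\<close> and for \<open>star x\<close> yields both inequalities.\<close>

lemma norm_star [simp]: "norm (star x) = norm (x::'a::cstar_algebra)"
proof -
  have le: "norm y \<le> norm (star y)" for y :: 'a
  proof (cases "y = 0")
    case False
    have "(norm y)\<^sup>2 \<le> norm (star y) * norm y"
      using norm_mult_ineq[of "star y" y] by (simp add: cstar_identity)
    then show ?thesis using False by (simp add: power2_eq_square)
  qed simp
  show ?thesis using le[of x] le[of "star x"] by (simp add: star_star)
qed

lemma bounded_linear_star: "bounded_linear (star :: 'a::cstar_algebra \<Rightarrow> 'a)"
  by (rule bounded_linear_intro[where K = 1]) (simp_all add: star_add star_scaleR)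

lemmas tendsto_star [tendsto_intros] = bounded_linear.tendsto[OF bounded_linear_star]
lemmas continuous_on_star [continuous_intros] = bounded_linear.continuous_on[OF bounded_linear_star]

lemma cstar_subalgebraD:
  assumes "cstar_subalgebra S"
  shows cstar_subalgebra_csubspace: "csubspace S"
    and cstar_subalgebra_closed: "closed S"
    and cstar_subalgebra_one: "1 \<in> S"
    and cstar_subalgebra_mult: "x \<in> S \<Longrightarrow> y \<in> S \<Longrightarrow> x * y \<in> S"
    and cstar_subalgebra_star: "x \<in> S \<Longrightarrow> star x \<in> S"
  using assms by (auto simp: cstar_subalgebra_def closed_csubspace_iff)

lemma cstar_subalgebra_closure:
  fixes V :: "'a::cstar_algebra set"
  assumes "csubspace V" "1 \<in> V" "\<And>x y. x \<in> V \<Longrightarrow> y \<in> V \<Longrightarrow> x * y \<in> V" "\<And>x. x \<in> V \<Longrightarrow> star x \<in> V"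
  shows "cstar_subalgebra (closure V)"
  unfolding cstar_subalgebra_def
proof (intro conjI ballI)
  show "closed_csubspace (closure V)" by (rule csubspace_closure[OF assms(1)])
  show "1 \<in> closure V" using assms(2) closure_subset by auto
  fix x assume "x \<in> closure V"
  then obtain f where f: "\<And>n. f n \<in> V" "f \<longlonglongrightarrow> x" by (auto simp: closure_sequential)
  show "star x \<in> closure V"
    using tendsto_star[OF f(2)] f(1) assms(4) by (auto simp: closure_sequential intro!: exI[of _ "\<lambda>n. star (f n)"])
  fix y assume "y \<in> closure V"
  then obtain g where g: "\<And>n. g n \<in> V" "g \<longlonglongrightarrow> y" by (auto simp: closure_sequential)
  show "x * y \<in> closure V"
    using tendsto_mult[OF f(2) g(2)] f(1) g(1) assms(3)
    by (auto simp: closure_sequential intro!: exI[of _ "\<lambda>n. f n * g n"])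
qed

lemma cstar_subalgebra_Inter: "(\<And>S. S \<in> T \<Longrightarrow> cstar_subalgebra S) \<Longrightarrow> cstar_subalgebra (\<Inter>T)"
  by (auto simp: cstar_subalgebra_def closed_csubspace_def)

lemma cstar_subalgebra_hull: "cstar_subalgebra (cstar_subalgebra hull G)"
  by (rule hull_in) (auto intro: cstar_subalgebra_Inter)

section \<open>Semi-inner products\<close>

text \<open>Degenerate forms are allowed, so that null vectors are never divided out. The form is
  \<open>\<omega> (star x * y)\<close> on a C*-algebra in one use and the inner product of a Hilbert
  space in the other.\<close>

locale semi_inner =
  fixes V :: "'b::complex_normed_vector set" and s :: "'b \<Rightarrow> 'b \<Rightarrow> complex"
  assumes subsp: "csubspace V"
    and comm: "x \<in> V \<Longrightarrow> y \<in> V \<Longrightarrow> s x y = cnj (s y x)"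
    and add_right: "x \<in> V \<Longrightarrow> y \<in> V \<Longrightarrow> z \<in> V \<Longrightarrow> s x (y + z) = s x y + s x z"
    and scale_right: "x \<in> V \<Longrightarrow> y \<in> V \<Longrightarrow> s x (c *\<^sub>C y) = c * s x y"
    and pos: "x \<in> V \<Longrightarrow> 0 \<le> Re (s x x)"
begin

lemmas sub = csubspaceD[OF subsp]

lemma add_left: "x \<in> V \<Longrightarrow> y \<in> V \<Longrightarrow> z \<in> V \<Longrightarrow> s (x + y) z = s x z + s y z"
  by (metis add_right comm complex_cnj_add csubspace_add subsp)

lemma scale_left: "x \<in> V \<Longrightarrow> y \<in> V \<Longrightarrow> s (c *\<^sub>C x) y = cnj c * s x y"
  by (metis comm complex_cnj_mult csubspace_scale scale_right subsp)

lemma self_real: "x \<in> V \<Longrightarrow> s x x = of_real (Re (s x x))"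
  using comm[of x x] by (auto simp: complex_eq_iff)

lemma expand:
  assumes "x \<in> V" "y \<in> V"
  shows "Re (s (x + c *\<^sub>C y) (x + c *\<^sub>C y)) =
    Re (s x x) + (cmod c)\<^sup>2 * Re (s y y) + 2 * Re (c * s x y)"
proof -
  have "s (x + c *\<^sub>C y) (x + c *\<^sub>C y) = s x x + c * s x y + cnj (c * s x y) + cnj c * c * s y y"
    using assms comm[of y x]
    by (simp add: add_left add_right scale_left scale_right sub algebra_simps)
  moreover have "cnj c * c * s y y = of_real ((cmod c)\<^sup>2 * Re (s y y))"
    using self_real[OF assms(2)] by (metis complex_norm_square mult.commute of_real_mult)
  ultimately show ?thesis by simp
qed

definition sn :: "'b \<Rightarrow> real" where "sn x = sqrt (Re (s x x))"

lemma sn_nonneg: "x \<in> V \<Longrightarrow> 0 \<le> sn x"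
  by (simp add: sn_def pos)

lemma sn_sq: "x \<in> V \<Longrightarrow> (sn x)\<^sup>2 = Re (s x x)"
  by (simp add: sn_def pos)

lemma cauchy_schwarz:
  assumes x: "x \<in> V" and y: "y \<in> V"
  shows "cmod (s x y) \<le> sn x * sn y"
proof -
  have ineq: "2 * r * (cmod (s x y))\<^sup>2 \<le> Re (s x x) + r\<^sup>2 * (cmod (s x y))\<^sup>2 * Re (s y y)" for r :: real
  proof -
    \<comment> \<open>With this \<open>c\<close> the cross term \<open>c * s x y\<close> is the real
      number \<open>- r * (cmod (s x y))\<^sup>2\<close>, and one real parameter remains.\<close>
    define c where "c = - of_real r * cnj (s x y)"
    have "0 \<le> Re (s (x + c *\<^sub>C y) (x + c *\<^sub>C y))"
      by (rule pos) (use x y in \<open>simp add: sub\<close>)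
    moreover have "c * s x y = of_real (- r * (cmod (s x y))\<^sup>2)"
      by (simp add: c_def complex_norm_square mult.commute del: of_real_power)
    moreover have "(cmod c)\<^sup>2 = r\<^sup>2 * (cmod (s x y))\<^sup>2"
      by (simp add: c_def norm_mult power_mult_distrib)
    ultimately show ?thesis using expand[OF x y, of c] by simp
  qed
  let ?m = "(cmod (s x y))\<^sup>2" and ?X = "Re (s x x)" and ?Y = "Re (s y y)"
  have "?m \<le> ?X * ?Y"
  proof (cases "?Y = 0")
    \<comment> \<open>For a null vector \<open>y\<close> the inequality is linear in
      \<open>r\<close>, and a large \<open>r\<close> forces \<open>s x y = 0\<close>.\<close>
    case True
    have "?m = 0"
    proof (rule ccontr)
      assume "?m \<noteq> 0"
      then show False using ineq[of "(?X + 1) / ?m"] True pos[OF x] by simp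
    qed
    then show ?thesis using True by simp
  next
    case False
    then have "?Y > 0" using pos[OF y] by simp
    then show ?thesis using ineq[of "1 / ?Y"] by (simp add: field_simps power2_eq_square)
  qed
  then have "cmod (s x y) \<le> sqrt (?X * ?Y)" by (intro real_le_rsqrt)
  then show ?thesis by (simp add: sn_def real_sqrt_mult)
qed

lemma sn_triangle:
  assumes "x \<in> V" "y \<in> V" shows "sn (x + y) \<le> sn x + sn y"
proof (rule power2_le_imp_le)
  have "(sn (x + y))\<^sup>2 = Re (s x x) + Re (s y y) + 2 * Re (s x y)"
    using expand[OF assms, of 1] assms by (simp add: sn_sq sub)
  also have "\<dots> \<le> (sn x)\<^sup>2 + (sn y)\<^sup>2 + 2 * (sn x * sn y)"
    using cauchy_schwarz[OF assms] complex_Re_le_cmod[of "s x y"] assms by (simp add: sn_sq)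
  finally show "(sn (x + y))\<^sup>2 \<le> (sn x + sn y)\<^sup>2" by (simp add: power2_sum)
  show "0 \<le> sn x + sn y" using sn_nonneg assms by simp
qed

text \<open>Such a sequence stands for a vector of the completion of \<open>V\<close> modulo null
  vectors, a space that is never formed.\<close>

definition scauchy :: "(nat \<Rightarrow> 'b) \<Rightarrow> bool"
  where "scauchy C \<longleftrightarrow> (\<forall>n. C n \<in> V) \<and> (\<forall>e>0. \<exists>M. \<forall>m\<ge>M. \<forall>n\<ge>M. sn (C m - C n) < e)"

lemma scauchy_bounded:
  assumes "scauchy C" obtains K where "0 < K" "\<And>n. sn (C n) \<le> K"
proof -
  have V: "\<And>n. C n \<in> V" using assms by (simp add: scauchy_def)
  obtain M where M: "\<And>m n. m \<ge> M \<Longrightarrow> n \<ge> M \<Longrightarrow> sn (C m - C n) < 1"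
    using assms unfolding scauchy_def by (meson zero_less_one)
  define K where "K = (\<Sum>i\<le>M. sn (C i)) + 1"
  have le: "sn (C i) \<le> (\<Sum>i\<le>M. sn (C i))" if "i \<le> M" for i
    by (rule member_le_sum) (use that V sn_nonneg in auto)
  have "sn (C n) \<le> K" for n
  proof (cases "n \<le> M")
    case True then show ?thesis using le[of n] by (simp add: K_def)
  next
    case False
    have "sn (C n) \<le> sn (C n - C M) + sn (C M)"
      using sn_triangle[of "C n - C M" "C M"] V by (simp add: sub)
    then show ?thesis using M[of n M] False le[of M] by (simp add: K_def)
  qed
  moreover have "0 < K"
    unfolding K_def by (intro add_nonneg_pos sum_nonneg) (use V sn_nonneg in auto)
  ultimately show ?thesis using that by blast
qed

text \<open>A minimising sequence of \<open>Re (s x x) - 2 * Re (f x)\<close> does the work: the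
  parallelogram identity makes it Cauchy, and the first variation near the infimum identifies
  \<open>f\<close> as the limit of the pairings. The representing vector exists only as this
  sequence.\<close>

lemma riesz:
  assumes lin: "clinear_on V f" and bd: "\<And>x. x \<in> V \<Longrightarrow> cmod (f x) \<le> K * sn x"
  obtains C where "scauchy C" "\<And>x. x \<in> V \<Longrightarrow> (\<lambda>n. s (C n) x) \<longlonglongrightarrow> f x"
proof -
  \<comment> \<open>If \<open>f\<close> were the pairing with a vector \<open>v\<close>, this would
    be the squared distance of \<open>x\<close> from \<open>v\<close> minus the squared norm of
    \<open>v\<close>.\<close>
  define J where "J x = Re (s x x) - 2 * Re (f x)" for x
  have low: "- K\<^sup>2 \<le> J x" if "x \<in> V" for x
  proof -
    have "Re (f x) \<le> K * sn x" using bd[OF that] complex_Re_le_cmod[of "f x"] by linarith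
    moreover have "0 \<le> (sn x - K)\<^sup>2" by simp
    ultimately show ?thesis using that by (simp add: J_def sn_sq[symmetric] power2_diff algebra_simps)
  qed
  define j where "j = Inf (J ` V)"
  have bdd: "bdd_below (J ` V)" using low by (auto intro!: bdd_belowI[of _ "- K\<^sup>2"])
  have ne: "J ` V \<noteq> {}" using sub(1) by auto
  have j_le: "j \<le> J x" if "x \<in> V" for x
    unfolding j_def by (rule cInf_lower) (use that bdd in auto)
  have "\<exists>x\<in>V. J x < j + 1 / Suc n" for n
    using cInf_lessD[OF ne, of "j + 1 / Suc n"] by (auto simp: j_def)
  then obtain C where C: "\<And>n. C n \<in> V" "\<And>n. J (C n) < j + 1 / Suc n" by metis
  \<comment> \<open>\<open>J\<close> at the midpoint is at least \<open>j\<close>; the parallelogram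
    identity turns this into a bound on the distance of two near-minimisers.\<close>
  have par: "(sn (x - y))\<^sup>2 \<le> 2 * J x + 2 * J y - 4 * j" if "x \<in> V" "y \<in> V" for x y
  proof -
    define z where "z = (1/2) *\<^sub>C (x + y)"
    have z: "z \<in> V" using that by (simp add: z_def sub)
    have "Re (s (x - y) (x - y)) = Re (s x x) + Re (s y y) - 2 * Re (s x y)"
      using expand[OF that, of "-1"] by simp
    moreover have "Re (s z z) = (1/4) * (Re (s x x) + Re (s y y) + 2 * Re (s x y))"
    proof -
      have "s z z = (1/4) * s (x + y) (x + y)"
        using that by (simp add: z_def scale_left scale_right sub)
      then have "Re (s z z) = (1/4) * Re (s (x + y) (x + y))" by (simp only:) simp
      then show ?thesis using expand[OF that, of 1] by simp
    qed
    moreover have "Re (f z) = (1/2) * (Re (f x) + Re (f y))"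
      using that by (simp add: z_def clinear_onD[OF lin subsp] sub)
    ultimately have "Re (s (x - y) (x - y)) = 2 * J x + 2 * J y - 4 * J z"
      by (simp add: J_def)
    then show ?thesis using j_le[OF z] that by (simp add: sn_sq sub)
  qed
  have cau: "(sn (C m - C n))\<^sup>2 < 4 / Suc M" if "m \<ge> M" "n \<ge> M" for m n M
  proof -
    have "(sn (C m - C n))\<^sup>2 < 2 / Suc m + 2 / Suc n"
      using par[of "C m" "C n"] C(1)[of m] C(1)[of n] C(2)[of m] C(2)[of n] by simp
    also have "\<dots> \<le> 2 / Suc M + 2 / Suc M"
      using that by (intro add_mono divide_left_mono) auto
    finally show ?thesis by simp
  qed
  have "scauchy C"
    unfolding scauchy_def
  proof (intro conjI allI impI)
    fix e :: real assume e: "0 < e"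
    obtain M where "4 / e\<^sup>2 < real M" using reals_Archimedean2 by blast
    then have "4 / Suc M < e\<^sup>2" using e by (simp add: field_simps add_strict_increasing)
    then have "sn (C m - C n) < e" if "m \<ge> M" "n \<ge> M" for m n
      using cau[OF that] e by (intro power2_less_imp_less[of _ e]) auto
    then show "\<exists>M. \<forall>m\<ge>M. \<forall>n\<ge>M. sn (C m - C n) < e" by blast
  qed (rule C)
  moreover have "(\<lambda>n. s (C n) x) \<longlonglongrightarrow> f x" if x: "x \<in> V" for x
  proof -
    \<comment> \<open>What matters is \<open>0 < r\<close> and
      \<open>r * Re (s x x) \<le> 1\<close>; the \<open>+ 1\<close> covers a null vector
      \<open>x\<close>.\<close>
    define r where "r = 1 / (Re (s x x) + 1)"
    have r: "0 < r" "r * Re (s x x) \<le> 1" using pos[OF x] by (auto simp: r_def)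
    have bnd: "(cmod (s (C n) x - f x))\<^sup>2 \<le> (1 / r) * (1 / Suc n)" for n
    proof -
      define d where "d = s (C n) x - f x"
      \<comment> \<open>A descent step from \<open>C n\<close> along \<open>x\<close>: since
        \<open>J\<close> cannot fall below \<open>j\<close>, the guaranteed decrease
        \<open>r * (cmod d)\<^sup>2\<close> is at most the gap \<open>1 / Suc n\<close>.\<close>
      define c where "c = - of_real r * cnj d"
      have cd: "c * d = of_real (- r * (cmod d)\<^sup>2)"
        by (simp add: c_def complex_norm_square mult.commute del: of_real_power)
      have cc: "(cmod c)\<^sup>2 = r\<^sup>2 * (cmod d)\<^sup>2"
        by (simp add: c_def norm_mult power_mult_distrib)
      have "j \<le> J (C n + c *\<^sub>C x)" using C x by (intro j_le) (simp add: sub)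
      also have "\<dots> = J (C n) + (cmod c)\<^sup>2 * Re (s x x) + 2 * Re (c * d)"
        using expand[OF C(1) x, of n c] C(1) x
        by (simp add: J_def d_def clinear_onD[OF lin subsp] sub algebra_simps)
      also have "\<dots> \<le> J (C n) + r * (cmod d)\<^sup>2 - 2 * r * (cmod d)\<^sup>2"
      proof -
        have "r\<^sup>2 * (cmod d)\<^sup>2 * Re (s x x) = (r * (cmod d)\<^sup>2) * (r * Re (s x x))"
          by (simp add: power2_eq_square)
        also have "\<dots> \<le> (r * (cmod d)\<^sup>2) * 1" using r by (intro mult_left_mono) auto
        finally show ?thesis by (simp add: cc cd)
      qed
      finally have "r * (cmod d)\<^sup>2 \<le> 1 / Suc n" using C(2)[of n] by simp
      then have "(1 / r) * (r * (cmod d)\<^sup>2) \<le> (1 / r) * (1 / Suc n)"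
        using r by (intro mult_left_mono) auto
      then show ?thesis using r by (simp add: d_def)
    qed
    have "(\<lambda>n. (1 / r) * (1 / Suc n)) \<longlonglongrightarrow> (1 / r) * 0"
      by (intro tendsto_mult tendsto_const LIMSEQ_Suc[OF lim_1_over_n])
    then have up: "(\<lambda>n. (1 / r) * (1 / Suc n)) \<longlonglongrightarrow> 0" by (simp only: mult_zero_right)
    have "(\<lambda>n. (cmod (s (C n) x - f x))\<^sup>2) \<longlonglongrightarrow> 0"
      by (rule tendsto_sandwich[OF always_eventually always_eventually tendsto_const up])
        (use bnd in \<open>simp_all only: zero_le_power2 simp_thms\<close>)
    then have "(\<lambda>n. sqrt ((cmod (s (C n) x - f x))\<^sup>2)) \<longlonglongrightarrow> sqrt 0" by (rule tendsto_real_sqrt)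
    then show ?thesis by (simp add: LIM_zero_cancel tendsto_norm_zero_iff)
  qed
  ultimately show ?thesis using that by blast
qed

end

section \<open>Positive functionals\<close>

lemma nonneg_Reals_iff: "z \<in> \<real>\<^sub>\<ge>\<^sub>0 \<longleftrightarrow> 0 \<le> Re z \<and> Im z = 0"
  by (auto simp: complex_nonneg_Reals_iff)

definition positive_on :: "'a::cstar_algebra set \<Rightarrow> ('a \<Rightarrow> complex) \<Rightarrow> bool"
  where "positive_on S \<omega> \<longleftrightarrow> clinear_on S \<omega> \<and> (\<forall>x\<in>S. \<omega> (star x * x) \<in> \<real>\<^sub>\<ge>\<^sub>0)"

definition dominated_on :: "'a::cstar_algebra set \<Rightarrow> ('a \<Rightarrow> complex) \<Rightarrow> ('a \<Rightarrow> complex) \<Rightarrow> bool"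
  where "dominated_on S \<omega> \<phi> \<longleftrightarrow> (\<forall>x\<in>S. Re (\<omega> (star x * x)) \<le> Re (\<phi> (star x * x)))"

text \<open>The norm of the vector \<open>x \<Omega>\<close> in the GNS space of
  \<open>\<omega>\<close>; on the algebra it is only a seminorm.\<close>

definition gns_norm :: "('a::cstar_algebra \<Rightarrow> complex) \<Rightarrow> 'a \<Rightarrow> real"
  where "gns_norm \<omega> x = sqrt (Re (\<omega> (star x * x)))"

lemma state_on_iff: "state_on S \<phi> \<longleftrightarrow> positive_on S \<phi> \<and> \<phi> 1 = 1"
  by (auto simp: state_on_def positive_on_def)

lemma positive_onI:
  assumes "\<And>x y. x \<in> S \<Longrightarrow> y \<in> S \<Longrightarrow> f (x + y) = f x + f y"
    and "\<And>c x. x \<in> S \<Longrightarrow> f (c *\<^sub>C x) = c * f x"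
    and "\<And>x. x \<in> S \<Longrightarrow> 0 \<le> Re (f (star x * x)) \<and> Im (f (star x * x)) = 0"
  shows "positive_on S f"
  using assms by (auto simp: positive_on_def clinear_on_def nonneg_Reals_iff)

text \<open>The power series of \<open>sqrt (1 - t)\<close> converges absolutely for \<open>\<bar>t\<bar> < 1\<close>, so \<open>1 - h\<close> has a
  square root whenever \<open>norm h < 1\<close>; it stays in every closed subalgebra containing \<open>h\<close>.\<close>

lemma exists_sqrt_one_minus:
  fixes h :: "'a::cstar_algebra"
  assumes S: "cstar_subalgebra S" and h: "h \<in> S" "star h = h" "norm h < 1"
  shows "\<exists>y\<in>S. star y = y \<and> y * y = 1 - h"
proof -
  define c where "c n = ((1/2::real) gchoose n) * (-1) ^ n" for n
  define f where "f n = c n *\<^sub>R h ^ n" for n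
  have sub: "csubspace S" by (rule cstar_subalgebra_csubspace[OF S])
  have hn: "h ^ n \<in> S \<and> star (h ^ n) = h ^ n" for n
  proof (induction n)
    case (Suc n)
    then show ?case
      using cstar_subalgebra_mult[OF S h(1), of "h ^ n"] h by (simp add: star_mult power_commutes)
  qed (simp add: cstar_subalgebra_one[OF S])
  have f: "f n \<in> S" "star (f n) = f n" for n
    using hn[of n] by (auto simp: f_def csubspace_scaleR[OF sub] star_scaleR)
  have "summable (\<lambda>n. norm (((1/2::real) gchoose n) * (norm h) ^ n))"
  proof (rule abs_summable_in_conv_radius)
    show "ereal (norm (norm h)) < conv_radius (\<lambda>n. (1/2::real) gchoose n)"
      using h(3) by (simp add: conv_radius_gchoose one_ereal_def)
  qed
  then have sn: "summable (\<lambda>n. norm (f n))"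
  proof (rule summable_comparison_test'[where N = 0])
    fix n
    have "norm (f n) \<le> \<bar>c n\<bar> * norm h ^ n"
      unfolding f_def by (simp add: mult_left_mono norm_power_ineq)
    also have "\<dots> = norm (((1/2::real) gchoose n) * (norm h) ^ n)"
      by (simp add: c_def abs_mult power_abs)
    finally show "norm (norm (f n)) \<le> norm (((1/2::real) gchoose n) * (norm h) ^ n)" by simp
  qed
  define y where "y = (\<Sum>n. f n)"
  have lim: "(\<lambda>n. \<Sum>k<n. f k) \<longlonglongrightarrow> y"
    using summable_norm_cancel[OF sn] unfolding y_def by (rule summable_LIMSEQ)
  have "(\<Sum>k<n. f k) \<in> S" for n by (rule csubspace_sum[OF sub]) (rule f)
  then have "y \<in> S"
    by (intro closed_sequentially[OF cstar_subalgebra_closed[OF S] _ lim])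
  moreover have "star y = y"
  proof (rule LIMSEQ_unique[OF _ lim])
    show "(\<lambda>n. \<Sum>k<n. f k) \<longlonglongrightarrow> star y"
      using tendsto_star[OF lim] by (simp add: star_sum f)
  qed
  moreover have "y * y = 1 - h"
  proof -
    \<comment> \<open>By Vandermonde the Cauchy product has the coefficients
      \<open>(-1) ^ k * (1 gchoose k)\<close>, which vanish from \<open>k = 2\<close> on.\<close>
    have conv: "(\<Sum>i\<le>k. f i * f (k - i)) = (if k = 0 then 1 else if k = 1 then - h else 0)" for k
    proof -
      have "(\<Sum>i\<le>k. f i * f (k - i)) = (\<Sum>i\<le>k. (c i * c (k - i)) *\<^sub>R h ^ k)"
        by (rule sum.cong) (auto simp: f_def power_add[symmetric] mult.commute)
      also have "\<dots> = (\<Sum>i\<le>k. c i * c (k - i)) *\<^sub>R h ^ k" by (simp add: scaleR_sum_left)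
      also have "(\<Sum>i\<le>k. c i * c (k - i)) = (-1) ^ k * (\<Sum>i\<le>k. ((1/2) gchoose i) * ((1/2) gchoose (k - i)))"
        unfolding sum_distrib_left
        by (rule sum.cong) (auto simp: c_def power_add[symmetric] algebra_simps)
      also have "(\<Sum>i\<le>k. ((1/2::real) gchoose i) * ((1/2) gchoose (k - i))) = (1 gchoose k)"
        using gbinomial_Vandermonde[where a = "1/2::real" and b = "1/2" and n = k] by (simp add: atMost_atLeast0)
      also have "(1::real) gchoose k = of_nat (1 choose k)"
        by (simp add: binomial_gbinomial)
      finally show ?thesis
        by (cases k rule: nat.exhaust; cases "k = 1") auto
    qed
    have "(\<lambda>k. \<Sum>i\<le>k. f i * f (k - i)) sums (y * y)"
      unfolding y_def by (rule Cauchy_product_sums[OF sn sn])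
    moreover have "(\<lambda>k. \<Sum>i\<le>k. f i * f (k - i)) sums (\<Sum>k\<in>{0,1::nat}. if k = 0 then 1 else if k = 1 then - h else 0)"
      unfolding conv by (rule sums_finite) auto
    ultimately show ?thesis using sums_unique2 by fastforce
  qed
  ultimately show ?thesis by blast
qed

locale positive_functional =
  fixes S :: "'a::cstar_algebra set" and \<omega> :: "'a \<Rightarrow> complex"
  assumes alg: "cstar_subalgebra S" and positive: "positive_on S \<omega>"
begin

lemma subspace: "csubspace S" by (rule cstar_subalgebra_csubspace[OF alg])

lemmas mem = cstar_subalgebraD(3-5)[OF alg] csubspaceD[OF subspace]

lemma lin: "clinear_on S \<omega>" using positive by (simp add: positive_on_def)

lemmas linD = clinear_onD[OF lin subspace, simplified]

lemma self_nonneg: "x \<in> S \<Longrightarrow> 0 \<le> Re (\<omega> (star x * x)) \<and> Im (\<omega> (star x * x)) = 0"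
  using positive by (auto simp: positive_on_def nonneg_Reals_iff)

text \<open>Positivity makes the form real at \<open>x + c *\<^sub>C y\<close>; the choices
  \<open>c = 1\<close> and \<open>c = \<i>\<close> give the two real equations that make up the
  symmetry.\<close>

lemma hermitian_form:
  assumes "x \<in> S" "y \<in> S"
  shows "\<omega> (star x * y) = cnj (\<omega> (star y * x))"
proof -
  have *: "Im (c * \<omega> (star x * y) + cnj c * \<omega> (star y * x)) = 0" for c
  proof -
    have "\<omega> (star (x + c *\<^sub>C y) * (x + c *\<^sub>C y)) = \<omega> (star x * x) + c * \<omega> (star x * y)
        + cnj c * \<omega> (star y * x) + cnj c * c * \<omega> (star y * y)"
      using assms by (simp add: star_add star_scaleC mult_scaleC_left mult_scaleC_right
          distrib_left distrib_right linD mem scaleC_scaleC)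
    moreover have "Im (cnj c * c * \<omega> (star y * y)) = 0"
      using self_nonneg[OF assms(2)] by simp
    moreover have "Im (\<omega> (star (x + c *\<^sub>C y) * (x + c *\<^sub>C y))) = 0" "Im (\<omega> (star x * x)) = 0"
      using self_nonneg[of "x + c *\<^sub>C y"] self_nonneg[OF assms(1)] assms by (simp_all add: mem)
    ultimately show ?thesis by (simp only: plus_complex.sel add_0 add_0_right)
  qed
  show ?thesis using *[of 1] *[of \<i>] by (simp add: complex_eq_iff)
qed

sublocale sp: semi_inner S "\<lambda>x y. \<omega> (star x * y)"
proof
  show "csubspace S" by (rule subspace)
  show "\<omega> (star x * y) = cnj (\<omega> (star y * x))" if "x \<in> S" "y \<in> S" for x y
    by (rule hermitian_form[OF that])
  show "\<omega> (star x * (y + z)) = \<omega> (star x * y) + \<omega> (star x * z)"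
    if "x \<in> S" "y \<in> S" "z \<in> S" for x y z using that by (simp add: distrib_left linD mem)
  show "\<omega> (star x * (c *\<^sub>C y)) = c * \<omega> (star x * y)" if "x \<in> S" "y \<in> S" for x y c
    using that by (simp add: mult_scaleC_right linD mem)
  show "0 \<le> Re (\<omega> (star x * x))" if "x \<in> S" for x using self_nonneg[OF that] by simp
qed

lemma sn_eq: "sp.sn = gns_norm \<omega>"
  by (simp add: sp.sn_def gns_norm_def fun_eq_iff)

lemmas gns_cs = sp.cauchy_schwarz[unfolded sn_eq]
lemmas gns_nonneg = sp.sn_nonneg[unfolded sn_eq]
lemmas gns_triangle = sp.sn_triangle[unfolded sn_eq]
lemmas scauchy_def' = sp.scauchy_def[unfolded sn_eq]
lemmas scauchy_bounded' = sp.scauchy_bounded[unfolded sn_eq]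

lemma one_nonneg: "0 \<le> Re (\<omega> 1)" and one_real: "\<omega> 1 = of_real (Re (\<omega> 1))"
  using self_nonneg[of 1] by (auto simp: mem complex_eq_iff)

text \<open>For \<open>r > (norm x)\<^sup>2\<close> the element
  \<open>1 - (1 / r) *\<^sub>R (star x * x)\<close> is the square of a self-adjoint element, so
  \<open>\<omega>\<close> is nonnegative on it; then \<open>r\<close> decreases to
  \<open>(norm x)\<^sup>2\<close>. Strictness of the first inequality is what gives
  \<open>norm h < 1\<close> for the square root.\<close>

lemma self_le:
  assumes "x \<in> S" shows "Re (\<omega> (star x * x)) \<le> (norm x)\<^sup>2 * Re (\<omega> 1)"
proof -
  have "Re (\<omega> (star x * x)) \<le> r * Re (\<omega> 1)" if r: "r > (norm x)\<^sup>2" for r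
  proof -
    have r0: "0 < r" using r by (meson le_less_trans zero_le_power2)
    define h where "h = (1 / r) *\<^sub>R (star x * x)"
    have "h \<in> S" "star h = h" "norm h < 1"
      using assms r r0 by (auto simp: h_def mem star_scaleR star_mult star_star cstar_identity)
    then obtain y where y: "y \<in> S" "star y = y" "y * y = 1 - h"
      using exists_sqrt_one_minus[OF alg] by blast
    then have "0 \<le> Re (\<omega> (1 - h))" using self_nonneg[OF y(1)] by simp
    moreover have "\<omega> h = of_real (1 / r) * \<omega> (star x * x)"
      using assms unfolding h_def scaleR_scaleC by (simp add: linD mem)
    moreover have "\<omega> (1 - h) = \<omega> 1 - \<omega> h" using \<open>h \<in> S\<close> by (simp add: linD mem)
    ultimately show ?thesis using r0 by (simp add: field_simps)
  qed
  then have "Re (\<omega> (star x * x)) \<le> ((norm x)\<^sup>2 + e) * Re (\<omega> 1)" if "e > 0" for e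
    using that by simp
  then have *: "Re (\<omega> (star x * x)) \<le> (norm x)\<^sup>2 * Re (\<omega> 1) + e * Re (\<omega> 1)" if "e > 0" for e
    using that by (simp add: distrib_right)
  show ?thesis
  proof (rule field_le_epsilon)
    fix e :: real assume e: "0 < e"
    have "e / (Re (\<omega> 1) + 1) * Re (\<omega> 1) \<le> e"
      using e one_nonneg by (simp add: field_simps)
    then show "Re (\<omega> (star x * x)) \<le> (norm x)\<^sup>2 * Re (\<omega> 1) + e"
      using *[of "e / (Re (\<omega> 1) + 1)"] e one_nonneg by simp
  qed
qed

lemma gns_le_norm: "x \<in> S \<Longrightarrow> gns_norm \<omega> x \<le> norm x * sqrt (Re (\<omega> 1))"
  using self_le[of x] one_nonneg
  by (simp add: gns_norm_def real_sqrt_mult real_le_lsqrt power_mult_distrib)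

text \<open>Cauchy-Schwarz against \<open>1\<close>: positive functionals are automatically
  continuous.\<close>

lemma bounded:
  assumes "x \<in> S" shows "cmod (\<omega> x) \<le> Re (\<omega> 1) * norm x"
proof -
  have "cmod (\<omega> x) \<le> gns_norm \<omega> 1 * gns_norm \<omega> x" using gns_cs[of 1 x] assms by (simp add: mem)
  also have "\<dots> \<le> sqrt (Re (\<omega> 1)) * (norm x * sqrt (Re (\<omega> 1)))"
    using gns_le_norm[OF assms] gns_le_norm[of 1] gns_nonneg[OF assms] one_nonneg
    by (intro mult_mono) (auto simp: mem)
  also have "\<dots> = Re (\<omega> 1) * norm x" using one_nonneg by simp
  finally show ?thesis .
qed

text \<open>In GNS terms this is the functional of the vector \<open>x \<Omega>\<close>.\<close>

lemma conjugate: 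
  assumes x: "x \<in> S" shows "positive_functional S (\<lambda>y. \<omega> (star x * y * x))"
proof
  show "cstar_subalgebra S" by (rule alg)
  show "positive_on S (\<lambda>y. \<omega> (star x * y * x))"
  proof (rule positive_onI)
    show "\<omega> (star x * (y + z) * x) = \<omega> (star x * y * x) + \<omega> (star x * z * x)"
      if "y \<in> S" "z \<in> S" for y z using that x by (simp add: distrib_left distrib_right linD mem)
    show "\<omega> (star x * (c *\<^sub>C y) * x) = c * \<omega> (star x * y * x)"
      if "y \<in> S" for y c using that x by (simp add: mult_scaleC_left mult_scaleC_right linD mem)
    show "0 \<le> Re (\<omega> (star x * (star y * y) * x)) \<and> Im (\<omega> (star x * (star y * y) * x)) = 0"
      if "y \<in> S" for y using self_nonneg[of "y * x"] that x by (simp add: mem star_mult mult.assoc)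
  qed
qed

text \<open>\<open>self_le\<close> for the conjugated functional: left multiplication by
  \<open>y\<close> acts on the GNS space with norm at most \<open>norm y\<close>.\<close>

lemma gns_mult:
  assumes "x \<in> S" "y \<in> S" shows "gns_norm \<omega> (y * x) \<le> norm y * gns_norm \<omega> x"
proof -
  interpret c: positive_functional S "\<lambda>y. \<omega> (star x * y * x)" by (rule conjugate[OF assms(1)])
  have "Re (\<omega> (star (y * x) * (y * x))) \<le> (norm y)\<^sup>2 * Re (\<omega> (star x * x))"
    using c.self_le[OF assms(2)] by (simp add: star_mult mult.assoc)
  then have "sqrt (Re (\<omega> (star (y * x) * (y * x)))) \<le> sqrt ((norm y)\<^sup>2 * Re (\<omega> (star x * x)))"
    by (rule real_sqrt_le_mono)
  then show ?thesis by (simp add: gns_norm_def real_sqrt_mult)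
qed

lemma form_bound:
  assumes "x \<in> S" "y \<in> S" "z \<in> S"
  shows "cmod (\<omega> (star x * y * z)) \<le> norm y * gns_norm \<omega> x * gns_norm \<omega> z"
proof -
  have "cmod (\<omega> (star x * (y * z))) \<le> gns_norm \<omega> x * gns_norm \<omega> (y * z)"
    using assms by (intro gns_cs) (auto simp: mem)
  also have "\<dots> \<le> gns_norm \<omega> x * (norm y * gns_norm \<omega> z)"
    using gns_mult[of z y] assms gns_nonneg[of x] by (intro mult_left_mono) auto
  finally show ?thesis by (simp add: mult_ac)
qed

end

lemma continuous_on_bounded_functional:
  fixes f :: "'a::complex_normed_vector \<Rightarrow> complex"
  assumes "csubspace S" "clinear_on S f" "\<And>x. x \<in> S \<Longrightarrow> cmod (f x) \<le> K * norm x"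
  shows "continuous_on S f"
proof (rule continuous_onI)
  fix x e assume x: "x \<in> S" and e: "(0::real) < e"
  have K: "0 < \<bar>K\<bar> + 1" by simp
  have "dist (f y) (f x) \<le> e" if y: "y \<in> S" "dist y x < e / (\<bar>K\<bar> + 1)" for y
  proof -
    have "dist (f y) (f x) = cmod (f (y - x))"
      using x y clinear_on_diff[OF assms(2,1)] by (simp add: dist_norm)
    also have "\<dots> \<le> K * norm (y - x)" using assms(3) csubspace_diff[OF assms(1)] x y by simp
    also have "\<dots> \<le> (\<bar>K\<bar> + 1) * norm (y - x)" by (intro mult_right_mono) auto
    also have "\<dots> \<le> e" using y(2) K by (simp add: dist_norm field_simps)
    finally show ?thesis .
  qed
  then show "\<exists>d>0. \<forall>y\<in>S. dist y x < d \<longrightarrow> dist (f y) (f x) \<le> e"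
    using e K by (intro exI[of _ "e / (\<bar>K\<bar> + 1)"]) auto
qed

lemma (in positive_functional) continuous: "continuous_on S \<omega>"
  by (rule continuous_on_bounded_functional[OF subspace lin bounded])

section \<open>Pure states\<close>

lemma positive_on_vanish:
  assumes "cstar_subalgebra S" "positive_on S \<omega>" "\<omega> 1 = 0" "x \<in> S" shows "\<omega> x = 0"
proof -
  interpret positive_functional S \<omega> using assms by unfold_locales
  show ?thesis using bounded[OF assms(4)] assms(3) by simp
qed

lemma positive_on_scale:
  assumes "positive_on S \<omega>" "0 \<le> r" shows "positive_on S (\<lambda>x. of_real r * \<omega> x)"
  using assms by (auto simp: positive_on_def clinear_on_def nonneg_Reals_iff algebra_simps)

lemma positive_on_diff:
  assumes "positive_on S \<omega>" "positive_on S \<phi>" "dominated_on S \<omega> \<phi>"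
  shows "positive_on S (\<lambda>x. \<phi> x - \<omega> x)"
  using assms by (auto simp: positive_on_def dominated_on_def clinear_on_def nonneg_Reals_iff algebra_simps)

lemma pure_dominated:
  assumes S: "cstar_subalgebra S" and pure: "pure_state_on S \<phi>"
    and \<omega>: "positive_on S \<omega>" and K: "\<And>x. x \<in> S \<Longrightarrow> Re (\<omega> (star x * x)) \<le> K * Re (\<phi> (star x * x))"
    and x: "x \<in> S"
  shows "\<omega> x = \<omega> 1 * \<phi> x"
proof -
  have st: "state_on S \<phi>" and p\<phi>: "positive_on S \<phi>" and \<phi>1: "\<phi> 1 = 1"
    using pure by (auto simp: pure_state_on_def state_on_iff)
  interpret w: positive_functional S \<omega> using S \<omega> by unfold_locales
  interpret p: positive_functional S \<phi> using S p\<phi> by unfold_locales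
  show ?thesis
  proof (cases "\<omega> 1 = 0")
    case True
    then show ?thesis using positive_on_vanish[OF S \<omega>] x by simp
  next
    case False
    define t1 where "t1 = Re (\<omega> 1)"
    have w1: "\<omega> 1 = of_real t1" and t1: "0 < t1"
      using w.one_real w.one_nonneg False by (auto simp: t1_def complex_eq_iff)
    have Kt: "t1 \<le> K" using K[of 1] w.mem(1) \<phi>1 by (simp add: t1_def)
    \<comment> \<open>The factor 2 leaves room: \<open>t1 \<le> K\<close> then gives
      \<open>t < 1\<close> strictly, so both weights are positive.\<close>
    define L where "L = 2 * K"
    have L: "0 < L" "t1 < L" using t1 Kt by (auto simp: L_def)
    define \<omega>' where "\<omega>' x = of_real (1 / L) * \<omega> x" for x
    define t where "t = t1 / L"
    have t: "0 < t" "t < 1" using t1 L by (auto simp: t_def)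
    have p': "positive_on S \<omega>'" unfolding \<omega>'_def by (rule positive_on_scale[OF \<omega>]) (use L in simp)
    have dom: "dominated_on S \<omega>' \<phi>"
      unfolding dominated_on_def
    proof
      fix x assume x: "x \<in> S"
      have "K * Re (\<phi> (star x * x)) \<le> L * Re (\<phi> (star x * x))"
        using p.self_nonneg[OF x] L t1 Kt by (intro mult_right_mono) (auto simp: L_def)
      then have "Re (\<omega> (star x * x)) \<le> L * Re (\<phi> (star x * x))" using K[OF x] by simp
      then show "Re (\<omega>' (star x * x)) \<le> Re (\<phi> (star x * x))"
        using L by (simp add: \<omega>'_def field_simps)
    qed
    define \<psi> where "\<psi> x = of_real (1 / t1) * \<omega> x" for x
    define \<psi>' where "\<psi>' x = of_real (1 / (1 - t)) * (\<phi> x - \<omega>' x)" for x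
    have "positive_on S \<psi>" unfolding \<psi>_def by (rule positive_on_scale[OF \<omega>]) (use t1 in simp)
    moreover have "\<psi> 1 = 1" using t1 by (simp add: \<psi>_def w1)
    moreover have "positive_on S \<psi>'"
      unfolding \<psi>'_def by (rule positive_on_scale[OF positive_on_diff[OF p' p\<phi> dom]]) (use t in simp)
    moreover have "\<psi>' 1 = 1"
    proof -
      have "\<omega>' 1 = of_real t" by (simp add: \<omega>'_def w1 t_def)
      then have "\<psi>' 1 = of_real (1 / (1 - t) * (1 - t))" by (simp only: \<psi>'_def \<phi>1) simp
      then show ?thesis using t by simp
    qed
    moreover have "\<phi> x = of_real t * \<psi> x + of_real (1 - t) * \<psi>' x" for x
    proof -
      have "of_real t * \<psi> x = \<omega>' x" using t1 by (simp add: \<psi>_def \<omega>'_def t_def)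
      moreover have "of_real (1 - t) * \<psi>' x = of_real ((1 - t) * (1 / (1 - t))) * (\<phi> x - \<omega>' x)"
        by (simp only: \<psi>'_def of_real_mult mult.assoc)
      ultimately show ?thesis using t by simp
    qed
    ultimately have "\<psi> x = \<phi> x"
      using pure t x unfolding pure_state_on_def state_on_iff by blast
    then show ?thesis using t1 by (simp add: \<psi>_def w1 field_simps)
  qed
qed

text \<open>In a convex decomposition of \<open>\<phi>\<close> the summand \<open>t * \<psi>\<close>
  is dominated by \<open>\<phi>\<close>, hence a multiple of it, and the value at \<open>1\<close>
  fixes the factor. The other summand is treated with the roles exchanged.\<close>

lemma pureI:
  assumes S: "cstar_subalgebra S" and st: "state_on S \<phi>"
    and dom: "\<And>\<omega> x. positive_on S \<omega> \<Longrightarrow> dominated_on S \<omega> \<phi> \<Longrightarrow> x \<in> S \<Longrightarrow> \<omega> x = \<omega> 1 * \<phi> x"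
  shows "pure_state_on S \<phi>"
  unfolding pure_state_on_def
proof (intro conjI allI impI ballI)
  fix \<psi> \<psi>' :: "'a \<Rightarrow> complex" and t :: real
  assume a: "state_on S \<psi>" "state_on S \<psi>'" "0 < t" "t < 1"
    "\<forall>x\<in>S. \<phi> x = complex_of_real t * \<psi> x + complex_of_real (1 - t) * \<psi>' x"
  have main: "\<psi> x = \<phi> x" if a: "state_on S \<psi>" "state_on S \<psi>'" "0 < t" "t < 1"
    "\<forall>x\<in>S. \<phi> x = complex_of_real t * \<psi> x + complex_of_real (1 - t) * \<psi>' x"
    and x: "x \<in> S" for \<psi> \<psi>' x and t :: real
  proof -
    interpret q: positive_functional S \<psi>' using S a by unfold_locales (auto simp: state_on_iff)
    have "positive_on S (\<lambda>x. of_real t * \<psi> x)"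
      using a by (intro positive_on_scale) (auto simp: state_on_iff)
    moreover have "dominated_on S (\<lambda>x. of_real t * \<psi> x) \<phi>"
      unfolding dominated_on_def
    proof
      fix x assume x: "x \<in> S"
      have "Re (\<phi> (star x * x)) = t * Re (\<psi> (star x * x)) + (1 - t) * Re (\<psi>' (star x * x))"
        using a(5) x q.mem by simp
      moreover have "0 \<le> (1 - t) * Re (\<psi>' (star x * x))"
        using q.self_nonneg[OF x] a by (intro mult_nonneg_nonneg) auto
      ultimately show "Re (of_real t * \<psi> (star x * x)) \<le> Re (\<phi> (star x * x))" by simp
    qed
    ultimately have "of_real t * \<psi> x = of_real t * \<psi> 1 * \<phi> x" using x by (rule dom)
    then show ?thesis using a by (simp add: state_on_def)
  qed
  fix x assume x: "x \<in> S"
  show "\<psi> x = \<phi> x" by (rule main[OF a x])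
  show "\<psi>' x = \<phi> x"
    by (rule main[of \<psi>' \<psi> "1 - t"]) (use a x in \<open>auto simp: add.commute\<close>)
qed (rule st)

section \<open>Parity and graded commutation in the CAR algebra\<close>

lemma cstar_subalgebraI:
  fixes T :: "'a::cstar_algebra set"
  assumes "\<And>x y. x \<in> T \<Longrightarrow> y \<in> T \<Longrightarrow> x + y \<in> T" "\<And>c x. x \<in> T \<Longrightarrow> c *\<^sub>C x \<in> T" "1 \<in> T"
    "\<And>x y. x \<in> T \<Longrightarrow> y \<in> T \<Longrightarrow> x * y \<in> T" "\<And>x. x \<in> T \<Longrightarrow> star x \<in> T" "closed T"
  shows "cstar_subalgebra T"
proof -
  have "0 \<in> T" using assms(2)[OF assms(3), of 0] by simp
  then show ?thesis using assms by (auto simp: cstar_subalgebra_def closed_csubspace_def)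
qed

locale car =
  fixes a :: "nat \<Rightarrow> 'a::cstar_algebra"
  assumes generators: "car_generators a"
begin

abbreviation \<A> :: "nat set \<Rightarrow> 'a set" where "\<A> \<equiv> car_subalgebra a"

abbreviation \<Theta> :: "'a \<Rightarrow> 'a" where "\<Theta> \<equiv> car_parity a"

lemma subalg: "cstar_subalgebra (\<A> I)"
  by (simp add: car_subalgebra_def cstar_subalgebra_hull)

lemma gen_mem: "i \<in> I \<Longrightarrow> a i \<in> \<A> I"
  unfolding car_subalgebra_def by (rule hull_inc) simp

text \<open>Serves as induction over generators: a property holds on \<open>\<A> I\<close> as soon
  as the elements having it form a C*-subalgebra that contains the \<open>a i\<close>. Adjoints of
  generators are then covered as well.\<close>

lemma subalg_least: "cstar_subalgebra T \<Longrightarrow> a ` I \<subseteq> T \<Longrightarrow> \<A> I \<subseteq> T"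
  unfolding car_subalgebra_def by (rule hull_minimal)

lemma subalg_mono: "I \<subseteq> J \<Longrightarrow> \<A> I \<subseteq> \<A> J"
  by (rule subalg_least[OF subalg]) (auto simp: gen_mem)

lemma subalg_UNIV: "\<A> UNIV = UNIV"
  using generators by (simp add: car_generators_def car_subalgebra_def)

lemma UNIV_least: "cstar_subalgebra T \<Longrightarrow> range a \<subseteq> T \<Longrightarrow> x \<in> T"
  using subalg_least[of T UNIV] subalg_UNIV by auto

lemmas mem_one = cstar_subalgebra_one[OF subalg]
lemmas mem_mult = cstar_subalgebra_mult[OF subalg]
lemmas mem_star = cstar_subalgebra_star[OF subalg]
lemmas mem_sub = csubspaceD[OF cstar_subalgebra_csubspace[OF subalg]]
lemmas mems = mem_one mem_mult mem_star mem_sub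

section \<open>The parity as a limit of conjugations\<close>

lemma car:
  shows "i \<noteq> j \<Longrightarrow> star (a i) * a j = - (a j * star (a i))"
    and "star (a i) * a i = 1 - a i * star (a i)"
    and "a i * a j = - (a j * a i)"
    and "star (a i) * star (a j) = - (star (a j) * star (a i))"
    and "a i * a i = 0"
proof -
  have 1: "star (a i) * a j + a j * star (a i) = (if i = j then 1 else 0)"
    and 2: "star (a i) * star (a j) + star (a j) * star (a i) = 0"
    and 3: "a i * a j + a j * a i = 0" for i j
    using generators by (auto simp: car_generators_def anticommutator_def)
  show "i \<noteq> j \<Longrightarrow> star (a i) * a j = - (a j * star (a i))"
    using 1[of i j] by (simp add: eq_neg_iff_add_eq_0)
  show "star (a i) * a i = 1 - a i * star (a i)"
    using 1[of i i] by (simp add: eq_diff_eq)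
  show "a i * a j = - (a j * a i)" using 3[of i j] by (simp add: eq_neg_iff_add_eq_0)
  show "star (a i) * star (a j) = - (star (a j) * star (a i))"
    using 2[of i j] by (simp add: eq_neg_iff_add_eq_0)
  have "(2::real) *\<^sub>R (a i * a i) = 0" using 3[of i i] by (simp add: scaleR_2)
  then show "a i * a i = 0" by simp
qed

text \<open>\<open>-1\<close> to the power of the number operator \<open>star (a i) * a i\<close>,
  which is a projection. The result is a self-adjoint unitary, and conjugation by it changes the
  sign of mode \<open>i\<close> alone.\<close>

definition V :: "nat \<Rightarrow> 'a" where "V i = 1 - 2 *\<^sub>R (star (a i) * a i)"

lemma star_V: "star (V i) = V i"
  by (simp add: V_def star_diff star_scaleR star_mult star_star)

lemma V_gen:
  "V i * a j = (if i = j then - (a j * V i) else a j * V i)"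
proof (cases "i = j")
  case True
  have "star (a i) * a i * a i = 0" by (simp add: mult.assoc car(5))
  moreover have "a i * (star (a i) * a i) = a i"
    by (simp add: car(2) right_diff_distrib mult.assoc[symmetric] car(5))
  ultimately show ?thesis using True
    by (simp add: V_def left_diff_distrib right_diff_distrib) (simp add: scaleR_2)
next
  case False
  have "star (a i) * a i * a j = - (star (a i) * a j * a i)"
    using car(3)[of i j] by (simp add: mult.assoc)
  also have "\<dots> = a j * (star (a i) * a i)" using car(1)[OF False] by (simp add: mult.assoc)
  finally show ?thesis using False
    by (simp add: V_def left_diff_distrib right_diff_distrib)
qed

lemma V_square: "V i * V i = 1"
proof -
  have "star (a i) * a i * (star (a i) * a i) = star (a i) * (a i * star (a i)) * a i"
    by (simp add: mult.assoc)
  also have "a i * star (a i) = 1 - star (a i) * a i" using car(2)[of i] by simp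
  also have "star (a i) * (1 - star (a i) * a i) * a i = star (a i) * a i"
    using car(4)[of i i] car(5)[of i] by (simp add: left_diff_distrib right_diff_distrib mult.assoc)
  finally have n: "star (a i) * a i * (star (a i) * a i) = star (a i) * a i" .
  have "V i * V i = 1 - 2 *\<^sub>R (star (a i) * a i) - (2 *\<^sub>R (star (a i) * a i) - 4 *\<^sub>R (star (a i) * a i))"
    by (simp add: V_def left_diff_distrib right_diff_distrib n scaleR_right_diff_distrib)
  also have "\<dots> = 1 - (2 + 2 - 4) *\<^sub>R (star (a i) * a i)"
    by (simp only: scaleR_left_diff_distrib scaleR_left_distrib) (simp add: algebra_simps)
  finally show ?thesis by simp
qed

lemma V_flip: "V i * a j * V i = (if i = j then - a j else a j)"
  by (simp add: V_gen mult.assoc V_square)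

lemma norm_V: "norm (V i) = 1"
proof -
  have "(norm (V i))\<^sup>2 = 1" using cstar_identity[of "V i"] by (simp add: star_V V_square)
  then show ?thesis using norm_ge_zero[of "V i"] by (simp add: power2_eq_1_iff)
qed

lemma norm_conj_V: "norm (V i * x * V i) = norm x"
proof (rule antisym)
  have le: "norm (V i * x * V i) \<le> norm x" for x
    using norm_mult_ineq[of "V i * x" "V i"] norm_mult_ineq[of "V i" x] by (simp add: norm_V)
  show "norm (V i * x * V i) \<le> norm x" by (rule le)
  have "V i * (V i * x * V i) * V i = (V i * V i) * x * (V i * V i)" by (simp only: mult.assoc)
  then show "norm x \<le> norm (V i * x * V i)" using le[of "V i * x * V i"] by (simp add: V_square)
qed

text \<open>Reverses the modes below \<open>n\<close>, so on each single generator it agrees with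
  the parity for all large \<open>n\<close>.\<close>

primrec flip :: "nat \<Rightarrow> 'a \<Rightarrow> 'a" where
  "flip 0 x = x"
| "flip (Suc n) x = V n * flip n x * V n"

lemma flip_add: "flip n (x + y) = flip n x + flip n y"
  by (induction n) (simp_all add: distrib_left distrib_right)

lemma flip_scale: "flip n (c *\<^sub>C x) = c *\<^sub>C flip n x"
  by (induction n) (simp_all add: mult_scaleC_left mult_scaleC_right)

lemma flip_diff: "flip n (x - y) = flip n x - flip n y"
  using flip_add[of n x "-y"] flip_scale[of n "-1" y] by simp

lemma flip_mult: "flip n (x * y) = flip n x * flip n y"
proof (induction n)
  case (Suc n)
  have "V n * (flip n x * flip n y) * V n = V n * flip n x * (V n * V n) * flip n y * V n"
    by (simp add: V_square mult.assoc)
  then show ?case using Suc by (simp add: mult.assoc)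
qed simp

lemma flip_star: "flip n (star x) = star (flip n x)"
  by (induction n) (simp_all add: star_mult star_V mult.assoc)

lemma flip_one: "flip n 1 = 1"
  by (induction n) (simp_all add: V_square)

lemma norm_flip: "norm (flip n x) = norm x"
  by (induction n) (simp_all add: norm_conj_V)

lemma flip_gen: "flip n (a i) = (if i < n then - a i else a i)"
  by (induction n) (auto simp: V_flip less_Suc_eq)

text \<open>Each \<open>flip n\<close> is isometric, so a three-epsilon estimate makes the set of
  points of convergence closed. It is then a C*-subalgebra, and on generators the sequence is
  eventually constant.\<close>

lemma flip_convergent: "convergent (\<lambda>n. flip n x)"
proof -
  let ?T = "{x. convergent (\<lambda>n. flip n x)}"
  have "cstar_subalgebra ?T"
  proof (rule cstar_subalgebraI)
    show "closed ?T"
      unfolding closed_sequential_limits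
    proof (intro allI impI, elim conjE)
      fix f x assume f: "\<forall>k. f k \<in> ?T" "f \<longlonglongrightarrow> x"
      have "Cauchy (\<lambda>n. flip n x)"
      proof (rule metric_CauchyI)
        fix e :: real assume e: "0 < e"
        obtain k where k: "norm (f k - x) < e / 3"
          using LIMSEQ_D[OF f(2), of "e / 3"] e by auto
        obtain M where M: "\<And>m n. m \<ge> M \<Longrightarrow> n \<ge> M \<Longrightarrow> dist (flip m (f k)) (flip n (f k)) < e / 3"
          using convergent_Cauchy[of "\<lambda>n. flip n (f k)"] f(1) e metric_CauchyD[of "\<lambda>n. flip n (f k)" "e / 3"]
          by auto
        have "dist (flip m x) (flip n x) < e" if "m \<ge> M" "n \<ge> M" for m n
        proof -
          have d: "dist (flip n (f k)) (flip n x) < e / 3" for n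
            using k by (simp add: dist_norm flip_diff[symmetric] norm_flip)
          have "dist (flip m x) (flip n x) \<le>
              dist (flip m (f k)) (flip m x) + dist (flip m (f k)) (flip n (f k)) + dist (flip n (f k)) (flip n x)"
            using dist_triangle[of "flip m x" "flip n x" "flip m (f k)"]
              dist_triangle[of "flip m (f k)" "flip n x" "flip n (f k)"]
            by (simp add: dist_commute)
          then show ?thesis using d[of m] d[of n] M[OF that] by simp
        qed
        then show "\<exists>M. \<forall>m\<ge>M. \<forall>n\<ge>M. dist (flip m x) (flip n x) < e" by blast
      qed
      then show "x \<in> ?T" by (simp add: Cauchy_convergent_iff)
    qed
  next
    fix x y assume "x \<in> ?T" "y \<in> ?T"
    then show "x + y \<in> ?T" "x * y \<in> ?T"
      by (simp_all add: flip_add flip_mult convergent_add convergent_mult)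
  next
    fix x c assume "x \<in> ?T"
    then show "c *\<^sub>C x \<in> ?T" "star x \<in> ?T"
      unfolding convergent_def by (auto simp: flip_scale flip_star intro: tendsto_intros)
  qed (simp add: flip_one convergent_const)
  moreover have "a i \<in> ?T" for i
  proof -
    have "(\<lambda>n. flip n (a i)) \<longlonglongrightarrow> - a i"
      by (rule tendsto_eventually) (auto simp: flip_gen eventually_sequentially intro!: exI[of _ "Suc i"])
    then show ?thesis by (auto simp: convergent_def)
  qed
  ultimately have "x \<in> ?T" by (intro UNIV_least) auto
  then show ?thesis by simp
qed

text \<open>The pointwise limit of \<open>flip n\<close> inherits the algebraic identities and the
  norm; it is an involution on generators, hence everywhere, and bijectivity follows.\<close>

lemma parity_exists: "\<exists>\<theta>. cstar_automorphism \<theta> \<and>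
    (\<forall>i. \<theta> (a i) = - a i \<and> \<theta> (star (a i)) = - star (a i))"
proof -
  define \<theta> where "\<theta> x = lim (\<lambda>n. flip n x)" for x
  have lim: "(\<lambda>n. flip n x) \<longlonglongrightarrow> \<theta> x" for x
    unfolding \<theta>_def using flip_convergent convergent_LIMSEQ_iff by blast
  have eqI: "\<theta> x = y" if "(\<lambda>n. flip n x) \<longlonglongrightarrow> y" for x y
    using LIMSEQ_unique[OF lim that] .
  have add: "\<theta> (x + y) = \<theta> x + \<theta> y" for x y
    by (rule eqI) (unfold flip_add, intro tendsto_add lim)
  have mul: "\<theta> (x * y) = \<theta> x * \<theta> y" for x y
    by (rule eqI) (unfold flip_mult, intro tendsto_mult lim)
  have sc: "\<theta> (c *\<^sub>C x) = c *\<^sub>C \<theta> x" for c x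
    by (rule eqI) (unfold flip_scale, intro tendsto_scaleC lim)
  have st: "\<theta> (star x) = star (\<theta> x)" for x
    by (rule eqI) (unfold flip_star, intro tendsto_star lim)
  have one: "\<theta> 1 = 1" by (rule eqI) (simp add: flip_one)
  have nrm: "norm (\<theta> x) = norm x" for x
    using LIMSEQ_unique[OF tendsto_norm[OF lim]] by (simp add: norm_flip)
  have gen: "\<theta> (a i) = - a i" for i
    by (rule eqI, rule tendsto_eventually)
      (auto simp: flip_gen eventually_sequentially intro!: exI[of _ "Suc i"])
  have min: "\<theta> (- x) = - \<theta> x" for x using sc[of "-1" x] by simp
  have bl: "bounded_linear \<theta>"
    by (rule bounded_linear_intro[where K = 1]) (simp_all add: add sc nrm scaleR_scaleC)
  have inv: "\<theta> (\<theta> x) = x" for x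
  proof -
    let ?T = "{x. \<theta> (\<theta> x) = x}"
    have "cstar_subalgebra ?T"
      by (rule cstar_subalgebraI)
        (auto simp: add mul sc st one
          intro!: closed_Collect_eq continuous_intros bounded_linear.continuous_on[OF bl])
    then have "x \<in> ?T" by (rule UNIV_least) (auto simp: gen min)
    then show ?thesis by simp
  qed
  have "bij \<theta>" by (rule involuntory_imp_bij) (rule inv)
  then show ?thesis
    by (intro exI[of _ \<theta>])
      (auto simp: cstar_automorphism_def clinear_on_def add mul sc st nrm gen)
qed

text \<open>Resolving \<open>THE\<close> requires uniqueness: two such automorphisms agree on a
  C*-subalgebra containing the generators. That they fix \<open>1\<close> is extracted from
  surjectivity.\<close>

lemma parity_spec: "cstar_automorphism \<Theta> \<and> (\<forall>i. \<Theta> (a i) = - a i \<and> \<Theta> (star (a i)) = - star (a i))"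
proof -
  let ?P = "\<lambda>\<theta>. cstar_automorphism \<theta> \<and> (\<forall>i. \<theta> (a i) = - a i \<and> \<theta> (star (a i)) = - star (a i))"
  have "\<theta> = \<theta>'" if t: "?P \<theta>" "?P \<theta>'" for \<theta> \<theta>'
  proof
    fix x
    have bl: "bounded_linear \<theta>" if "?P \<theta>" for \<theta>
      using that by (intro bounded_linear_intro[where K = 1])
        (auto simp: cstar_automorphism_def clinear_on_def scaleR_scaleC)
    have one: "\<theta> 1 = 1" if "?P \<theta>" for \<theta>
    proof -
      have "surj \<theta>" and m: "\<And>x y. \<theta> (x * y) = \<theta> x * \<theta> y"
        using that by (auto simp: cstar_automorphism_def bij_def)
      then obtain u where "\<theta> u = 1" by (metis surjD)
      then show ?thesis using m[of u 1] by simp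
    qed
    let ?T = "{x. \<theta> x = \<theta>' x}"
    have "cstar_subalgebra ?T"
    proof (rule cstar_subalgebraI)
      show "closed ?T"
        by (intro closed_Collect_eq bounded_linear.continuous_on[OF bl[OF t(1)]]
            bounded_linear.continuous_on[OF bl[OF t(2)]] continuous_on_id)
    qed (use t one[OF t(1)] one[OF t(2)] in \<open>auto simp: cstar_automorphism_def clinear_on_def\<close>)
    then have "x \<in> ?T" by (rule UNIV_least) (use t in auto)
    then show "\<theta> x = \<theta>' x" by simp
  qed
  then have "\<exists>!\<theta>. ?P \<theta>" using parity_exists by blast
  then show ?thesis unfolding car_parity_def by (rule theI')
qed

lemma parity:
  shows parity_add: "\<Theta> (x + y) = \<Theta> x + \<Theta> y"
    and parity_scale: "\<Theta> (c *\<^sub>C x) = c *\<^sub>C \<Theta> x"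
    and parity_mult: "\<Theta> (x * y) = \<Theta> x * \<Theta> y"
    and parity_star: "\<Theta> (star x) = star (\<Theta> x)"
    and parity_norm: "norm (\<Theta> x) = norm x"
    and parity_gen: "\<Theta> (a i) = - a i"
  using parity_spec by (auto simp: cstar_automorphism_def clinear_on_def)

lemma parity_bounded_linear: "bounded_linear \<Theta>"
  by (rule bounded_linear_intro[where K = 1]) (simp_all add: parity scaleR_scaleC)

lemma parity_minus: "\<Theta> (- x) = - \<Theta> x"
  using parity_scale[of "-1" x] by simp

lemmas parity_diff = linear_diff[OF bounded_linear.linear[OF parity_bounded_linear]]
lemmas parity_continuous = bounded_linear.continuous_on[OF parity_bounded_linear]

lemma parity_one: "\<Theta> 1 = 1"
proof -
  have "surj \<Theta>" using parity_spec by (simp add: cstar_automorphism_def bij_def)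
  then obtain u where "\<Theta> u = 1" by (metis surjD)
  then show ?thesis using parity_mult[of u 1] by simp
qed

lemma parity_parity: "\<Theta> (\<Theta> x) = x"
proof -
  let ?T = "{x. \<Theta> (\<Theta> x) = x}"
  have "cstar_subalgebra ?T"
    by (rule cstar_subalgebraI)
      (auto simp: parity parity_one intro!: closed_Collect_eq continuous_intros parity_continuous)
  then have "x \<in> ?T" by (rule UNIV_least) (auto simp: parity_gen parity_minus)
  then show ?thesis by simp
qed

lemma parity_mem: "x \<in> \<A> I \<Longrightarrow> \<Theta> x \<in> \<A> I"
proof -
  let ?T = "{x. \<Theta> x \<in> \<A> I}"
  have "closed (\<Theta> -` \<A> I)"
    by (rule closed_vimage) (auto intro: cstar_subalgebra_closed[OF subalg] parity_continuous continuous_intros)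
  then have "cstar_subalgebra ?T"
    by (intro cstar_subalgebraI) (auto simp: parity parity_one mems vimage_def)
  then have "\<A> I \<subseteq> ?T" by (rule subalg_least) (auto simp: parity_gen mems gen_mem)
  then show "x \<in> \<A> I \<Longrightarrow> \<Theta> x \<in> \<A> I" by auto
qed

section \<open>Grading and graded commutation\<close>

definition ev :: "'a \<Rightarrow> 'a" where "ev x = (1/2) *\<^sub>C (x + \<Theta> x)"
definition od :: "'a \<Rightarrow> 'a" where "od x = (1/2) *\<^sub>C (x - \<Theta> x)"

lemma ev_od: "ev x + od x = x"
proof -
  have "ev x + od x = (1/2) *\<^sub>C x + (1/2) *\<^sub>C x"
    by (simp add: ev_def od_def scaleC_add_right cvec.scale_right_diff_distrib)
  also have "\<dots> = x" by (simp flip: scaleC_add_left)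
  finally show ?thesis .
qed

lemma parity_ev: "\<Theta> (ev x) = ev x"
  by (simp add: ev_def parity parity_parity add.commute)

lemma parity_od: "\<Theta> (od x) = - od x"
  by (simp add: od_def parity parity_diff parity_parity flip: cvec.scale_minus_right)

lemma ev_mem: "x \<in> \<A> I \<Longrightarrow> ev x \<in> \<A> I" and od_mem: "x \<in> \<A> I \<Longrightarrow> od x \<in> \<A> I"
  by (simp_all add: ev_def od_def mems parity_mem)

text \<open>Moving a foreign generator through \<open>b\<close> costs one sign per generator in
  \<open>b\<close>, and \<open>\<Theta>\<close> counts these signs. Both identities are proved
  together because taking adjoints exchanges \<open>a i\<close> and
  \<open>star (a i)\<close>.\<close>

lemma gen_commutes:
  assumes "b \<in> \<A> J" "i \<notin> J"
  shows "b * a i = a i * \<Theta> b" "b * star (a i) = star (a i) * \<Theta> b"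
proof -
  let ?T = "{b. b * a i = a i * \<Theta> b \<and> b * star (a i) = star (a i) * \<Theta> b}"
  have "cstar_subalgebra ?T"
  proof (rule cstar_subalgebraI)
    show "closed ?T"
      by (intro closed_Collect_conj closed_Collect_eq continuous_intros parity_continuous)
  next
    fix x y assume x: "x \<in> ?T" and y: "y \<in> ?T"
    show "x + y \<in> ?T" using x y by (simp add: parity distrib_left distrib_right)
    have "x * y * g = g * \<Theta> (x * y)" if "x * g = g * \<Theta> x" "y * g = g * \<Theta> y" for g
      using that by (metis mult.assoc parity_mult)
    then show "x * y \<in> ?T" using x y by simp
  next
    fix x assume x: "x \<in> ?T"
    show "c *\<^sub>C x \<in> ?T" for c using x by (simp add: parity mult_scaleC_left mult_scaleC_right)
    \<comment> \<open>Apply \<open>\<Theta>\<close> to the relation, cancel the sign of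
      \<open>g\<close> and take adjoints; the result is the relation for
      \<open>star g\<close>.\<close>
    have *: "star x * star g = star g * \<Theta> (star x)" if "x * g = g * \<Theta> x" "\<Theta> g = - g" for g
    proof -
      have "\<Theta> x * \<Theta> g = \<Theta> g * x" by (metis parity_mult parity_parity that(1))
      then have "\<Theta> x * g = g * x" using that(2) by simp
      then have "star g * \<Theta> (star x) = star x * star g"
        by (metis parity_star star_mult)
      then show ?thesis by simp
    qed
    show "star x \<in> ?T"
      using *[of "a i"] *[of "star (a i)"] x by (simp add: parity star_star)
  qed (simp add: parity_one)
  moreover have "a j \<in> ?T" if "j \<in> J" for j
  proof -
    have "i \<noteq> j" using assms(2) that by auto
    then show ?thesis using car(3)[of j i] car(1)[of i j] by (simp add: parity_gen)
  qed
  ultimately have "b \<in> ?T" using subalg_least[of ?T J] assms(1) by blast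
  then show "b * a i = a i * \<Theta> b" "b * star (a i) = star (a i) * \<Theta> b" by auto
qed

text \<open>An even \<open>b\<close> passes every generator of \<open>I\<close> without a sign. The
  relation for \<open>star b\<close> is carried along so that the admissible \<open>x\<close> are
  closed under adjoints.\<close>

lemma even_commutes:
  assumes x: "x \<in> \<A> I" and b: "b \<in> \<A> J" "\<Theta> b = b" and d: "I \<inter> J = {}"
  shows "b * x = x * b"
proof -
  let ?T = "{x. b * x = x * b \<and> star b * x = x * star b}"
  have "cstar_subalgebra ?T"
  proof (rule cstar_subalgebraI)
    show "closed ?T" by (intro closed_Collect_conj closed_Collect_eq continuous_intros)
  next
    fix x y assume x: "x \<in> ?T" and y: "y \<in> ?T"
    show "x + y \<in> ?T" using x y by (simp add: distrib_left distrib_right)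
    have "b * (x * y) = x * y * b" if "b * x = x * b" "b * y = y * b" for b
      using that by (metis mult.assoc)
    then show "x * y \<in> ?T" using x y by simp
  next
    fix x assume x: "x \<in> ?T"
    show "c *\<^sub>C x \<in> ?T" for c using x by (simp add: mult_scaleC_left mult_scaleC_right)
    have "star b * star x = star x * star b" "b * star x = star x * b"
      using x by (auto simp flip: star_mult) (metis star_mult star_star)
    then show "star x \<in> ?T" by simp
  qed simp
  moreover have "a i \<in> ?T" if "i \<in> I" for i
    using gen_commutes[OF b(1), of i] gen_commutes[OF mem_star[OF b(1)], of i] b(2) d that
    by (auto simp: parity)
  ultimately have "x \<in> ?T" using subalg_least[of ?T I] x by blast
  then show ?thesis by simp
qed

text \<open>Each generator of \<open>I\<close> now contributes one sign, and the signs accumulate to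
  \<open>\<Theta> x\<close>.\<close>

lemma odd_commutes:
  assumes x: "x \<in> \<A> I" and b: "b \<in> \<A> J" "\<Theta> b = - b" and d: "I \<inter> J = {}"
  shows "b * x = \<Theta> x * b"
proof -
  let ?T = "{x. b * x = \<Theta> x * b \<and> star b * x = \<Theta> x * star b}"
  have "cstar_subalgebra ?T"
  proof (rule cstar_subalgebraI)
    show "closed ?T"
      by (intro closed_Collect_conj closed_Collect_eq continuous_intros parity_continuous)
  next
    fix x y assume x: "x \<in> ?T" and y: "y \<in> ?T"
    show "x + y \<in> ?T" using x y by (simp add: parity distrib_left distrib_right)
    have "b * (x * y) = \<Theta> (x * y) * b" if "b * x = \<Theta> x * b" "b * y = \<Theta> y * b" for b
      using that by (metis mult.assoc parity_mult)
    then show "x * y \<in> ?T" using x y by simp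
  next
    fix x assume x: "x \<in> ?T"
    show "c *\<^sub>C x \<in> ?T" for c using x by (simp add: parity mult_scaleC_left mult_scaleC_right)
    have *: "star b' * star x = \<Theta> (star x) * star b'" if "b' * x = \<Theta> x * b'" "\<Theta> b' = - b'" for b'
    proof -
      have "\<Theta> b' * \<Theta> x = x * \<Theta> b'" by (metis parity_mult parity_parity that(1))
      then have "b' * \<Theta> x = x * b'" using that(2) by simp
      then show ?thesis by (metis parity_star star_mult)
    qed
    show "star x \<in> ?T"
      using *[of b] *[of "star b"] x b(2) by (simp add: parity star_star)
  qed (simp add: parity_one)
  moreover have "a i \<in> ?T" if "i \<in> I" for i
    using gen_commutes[OF b(1), of i] gen_commutes[OF mem_star[OF b(1)], of i] b(2) d that
    by (auto simp: parity)
  ultimately have "x \<in> ?T" using subalg_least[of ?T I] x by blast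
  then show ?thesis by simp
qed

text \<open>The substitute for commutation of disjoint subalgebras, used for the reorderings
  below.\<close>

lemma graded_commute:
  assumes "x \<in> \<A> I" "b \<in> \<A> J" "I \<inter> J = {}"
  shows "b * x = x * ev b + \<Theta> x * od b"
proof -
  have "b * x = ev b * x + od b * x" by (simp add: ev_od flip: distrib_right)
  then show ?thesis
    using even_commutes[OF assms(1) ev_mem[OF assms(2)] parity_ev assms(3)]
      odd_commutes[OF assms(1) od_mem[OF assms(2)] parity_od assms(3)] by simp
qed

section \<open>Dense subspaces of joint algebras\<close>

definition products :: "nat set \<Rightarrow> nat set \<Rightarrow> 'a set"
  where "products I J = {x * y | x y. x \<in> \<A> I \<and> y \<in> \<A> J}"

lemma csubspace_span: "csubspace (cvec.span (G :: 'a set))"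
  by (simp add: csubspace_def cvec.span_zero cvec.span_add cvec.span_scale)

lemma span_least: "csubspace K \<Longrightarrow> G \<subseteq> K \<Longrightarrow> cvec.span G \<subseteq> (K :: 'a set)"
  by (rule cvec.span_minimal) (auto simp: cvec.subspace_def csubspaceD)

lemma products_span_mem: "x \<in> \<A> I \<Longrightarrow> y \<in> \<A> J \<Longrightarrow> x * y \<in> cvec.span (products I J)"
  by (rule cvec.span_base) (auto simp: products_def)

lemma products_span_least:
  assumes "csubspace K" "\<And>x y. x \<in> \<A> I \<Longrightarrow> y \<in> \<A> J \<Longrightarrow> x * y \<in> K"
  shows "cvec.span (products I J) \<subseteq> K"
  by (rule span_least[OF assms(1)]) (auto simp: products_def assms(2))

text \<open>Only the inner pair \<open>y * x'\<close> is out of order, and exchanging it yields two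
  products in the right order. Linearity in each factor separately extends this to sums.\<close>

lemma products_span_mult:
  assumes d: "I \<inter> J = {}" and p: "p \<in> cvec.span (products I J)" and q: "q \<in> cvec.span (products I J)"
  shows "p * q \<in> cvec.span (products I J)"
proof -
  let ?W = "cvec.span (products I J)"
  have W: "csubspace ?W" by (rule csubspace_span)
  have gg: "x * y * (x' * y') \<in> ?W" if "x \<in> \<A> I" "y \<in> \<A> J" "x' \<in> \<A> I" "y' \<in> \<A> J" for x y x' y'
  proof -
    have "x * y * (x' * y') = x * (y * x') * y'" by (simp add: mult.assoc)
    also have "\<dots> = (x * x') * (ev y * y') + (x * \<Theta> x') * (od y * y')"
      unfolding graded_commute[OF that(3,2) d] by (simp add: distrib_left distrib_right mult.assoc)
    finally show ?thesis
      using that by (auto intro!: cvec.span_add products_span_mem mem_mult ev_mem od_mem parity_mem)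
  qed
  have g: "x * y * q \<in> ?W" if "x \<in> \<A> I" "y \<in> \<A> J" for x y
  proof -
    have "csubspace {q. x * y * q \<in> ?W}"
      using W by (auto simp: csubspace_def distrib_left mult_scaleC_right)
    then have "?W \<subseteq> {q. x * y * q \<in> ?W}"
      by (rule products_span_least) (use gg[OF that] in blast)
    then show ?thesis using q by auto
  qed
  have "csubspace {p. p * q \<in> ?W}"
    using W by (auto simp: csubspace_def distrib_right mult_scaleC_left)
  then have "?W \<subseteq> {p. p * q \<in> ?W}" by (rule products_span_least) (use g in blast)
  then show ?thesis using p by auto
qed

lemma products_span_star:
  assumes d: "I \<inter> J = {}" and p: "p \<in> cvec.span (products I J)"
  shows "star p \<in> cvec.span (products I J)"
proof -
  let ?W = "cvec.span (products I J)"
  have W: "csubspace ?W" by (rule csubspace_span)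
  have "star (x * y) \<in> ?W" if "x \<in> \<A> I" "y \<in> \<A> J" for x y
    unfolding star_mult graded_commute[OF mem_star[OF that(1)] mem_star[OF that(2)] d]
    using that by (auto intro!: cvec.span_add products_span_mem mem_star ev_mem od_mem parity_mem)
  moreover have "csubspace {p. star p \<in> ?W}"
    using W by (auto simp: csubspace_def star_add star_scaleC)
  ultimately have "?W \<subseteq> {p. star p \<in> ?W}" by (intro products_span_least) auto
  then show ?thesis using p by auto
qed

text \<open>By graded commutation the sums of ordered products already form a unital algebra closed
  under \<open>star\<close> and containing the generators, so their closure is the whole joint
  algebra.\<close>

lemma products_dense:
  assumes d: "I \<inter> J = {}"
  shows "\<A> (I \<union> J) = closure (cvec.span (products I J))"
proof
  let ?W = "cvec.span (products I J)"
  note in_W = products_span_mem[of _ I _ J]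
  have "cstar_subalgebra (closure ?W)"
    using in_W[OF mem_one mem_one]
    by (intro cstar_subalgebra_closure csubspace_span products_span_mult products_span_star d) auto
  moreover have "a i \<in> ?W" if "i \<in> I \<union> J" for i
    using in_W[OF gen_mem mem_one, of i] in_W[OF mem_one gen_mem, of i] that by auto
  ultimately show "\<A> (I \<union> J) \<subseteq> closure ?W"
    using closure_subset[of ?W] by (intro subalg_least) auto
  have "?W \<subseteq> \<A> (I \<union> J)"
    by (rule products_span_least[OF cstar_subalgebra_csubspace[OF subalg]])
      (use subalg_mono[of I "I \<union> J"] subalg_mono[of J "I \<union> J"] in \<open>auto intro!: mem_mult\<close>)
  then show "closure ?W \<subseteq> \<A> (I \<union> J)"
    by (rule closure_minimal) (rule cstar_subalgebra_closed[OF subalg])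
qed

text \<open>Typically \<open>K\<close> is the set where two continuous linear functionals agree,
  which reduces their comparison to products.\<close>

lemma union_least:
  assumes "I \<inter> J = {}" and K: "closed_csubspace K"
    and "\<And>x y. x \<in> \<A> I \<Longrightarrow> y \<in> \<A> J \<Longrightarrow> x * y \<in> K"
  shows "\<A> (I \<union> J) \<subseteq> K"
  unfolding products_dense[OF assms(1)]
  using K assms(3) by (intro closure_minimal products_span_least) (auto simp: closed_csubspace_iff)

text \<open>The passage to infinitely many subsystems: any two elements of the union of an
  increasing chain lie in a common member, so the union is an algebra and is dense.\<close>

lemma directed_union_least:
  assumes K: "closed_csubspace K" and inc: "incseq J" and J: "\<And>k. \<A> (J k) \<subseteq> K"
  shows "\<A> (\<Union>k. J k) \<subseteq> K"
proof -
  let ?W = "\<Union>k. \<A> (J k)"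
  have sub: "\<A> (J k) \<subseteq> \<A> (J (max k l))" "\<A> (J l) \<subseteq> \<A> (J (max k l))" for k l
    by (rule subalg_mono, rule incseqD[OF inc], simp)+
  have two: "\<exists>m. x \<in> \<A> (J m) \<and> y \<in> \<A> (J m)" if "x \<in> ?W" "y \<in> ?W" for x y
    using that sub by blast
  have "cstar_subalgebra (closure ?W)"
  proof (rule cstar_subalgebra_closure)
    show "csubspace ?W"
      unfolding csubspace_def
    proof (intro conjI ballI allI)
      show "x + y \<in> ?W" if "x \<in> ?W" "y \<in> ?W" for x y using two[OF that] mem_sub(2) by blast
      show "c *\<^sub>C x \<in> ?W" if "x \<in> ?W" for x c using that mem_sub(3) by blast
    qed (use mem_sub(1) in blast)
    show "x * y \<in> ?W" if "x \<in> ?W" "y \<in> ?W" for x y using two[OF that] mem_mult by blast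
    show "star x \<in> ?W" if "x \<in> ?W" for x using that mem_star by blast
  qed (use mem_one in blast)
  then have "\<A> (\<Union>k. J k) \<subseteq> closure ?W"
    by (rule subalg_least) (use closure_subset[of ?W] gen_mem in blast)
  also have "\<dots> \<subseteq> K" using J K by (intro closure_minimal) (auto simp: closed_csubspace_iff)
  finally show ?thesis .
qed

end

section \<open>Vector functionals\<close>

lemma closed_csubspace_eq:
  fixes f g :: "'a::complex_normed_vector \<Rightarrow> complex"
  assumes S: "csubspace S" "closed S" and lin: "clinear_on S f" "clinear_on S g"
    and cont: "continuous_on S f" "continuous_on S g"
  shows "closed_csubspace {x \<in> S. f x = g x}"
  unfolding closed_csubspace_iff
proof
  show "csubspace {x \<in> S. f x = g x}"
    unfolding csubspace_def
    using csubspaceD[OF S(1)] clinear_onD[OF lin(1) S(1)] clinear_onD[OF lin(2) S(1)] by auto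
  have "closed (S \<inter> (\<lambda>x. f x - g x) -` {0})"
    by (intro continuous_closed_preimage continuous_intros cont S closed_singleton)
  moreover have "S \<inter> (\<lambda>x. f x - g x) -` {0} = {x \<in> S. f x = g x}" by auto
  ultimately show "closed {x \<in> S. f x = g x}" by simp
qed

lemma positive_on_subset: "positive_on S \<omega> \<Longrightarrow> T \<subseteq> S \<Longrightarrow> positive_on T \<omega>"
  unfolding positive_on_def using clinear_on_subset by blast

lemma state_on_subset: "state_on S \<omega> \<Longrightarrow> T \<subseteq> S \<Longrightarrow> state_on T \<omega>"
  unfolding state_on_iff using positive_on_subset by blast

lemma gns_norm_dominated: "dominated_on S \<omega> \<phi> \<Longrightarrow> x \<in> S \<Longrightarrow> gns_norm \<omega> x \<le> gns_norm \<phi> x"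
  by (simp add: gns_norm_def dominated_on_def)

text \<open>Represents a vector of the GNS space of \<open>\<omega>\<close>. Algebra and functional
  are arguments so that one sequence can be used in a larger algebra and for a dominated
  functional.\<close>

definition gns_cauchy :: "'a::cstar_algebra set \<Rightarrow> ('a \<Rightarrow> complex) \<Rightarrow> (nat \<Rightarrow> 'a) \<Rightarrow> bool"
  where "gns_cauchy S \<omega> C \<longleftrightarrow> (\<forall>n. C n \<in> S) \<and>
    (\<forall>e>0. \<exists>M. \<forall>m\<ge>M. \<forall>n\<ge>M. gns_norm \<omega> (C m - C n) < e)"

lemma gns_cauchy_subset: "gns_cauchy S \<omega> C \<Longrightarrow> S \<subseteq> T \<Longrightarrow> gns_cauchy T \<omega> C"
  by (auto simp: gns_cauchy_def)

lemma gns_cauchy_dominated: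
  assumes S: "csubspace S" and C: "gns_cauchy S \<phi> C" and dom: "dominated_on S \<omega> \<phi>"
  shows "gns_cauchy S \<omega> C"
  unfolding gns_cauchy_def
proof (intro conjI allI impI)
  have mem: "C n \<in> S" for n using C by (simp add: gns_cauchy_def)
  then show "C n \<in> S" for n .
  fix e :: real assume "0 < e"
  then obtain M where "\<And>m n. m \<ge> M \<Longrightarrow> n \<ge> M \<Longrightarrow> gns_norm \<phi> (C m - C n) < e"
    using C unfolding gns_cauchy_def by meson
  then show "\<exists>M. \<forall>m\<ge>M. \<forall>n\<ge>M. gns_norm \<omega> (C m - C n) < e"
    using gns_norm_dominated[OF dom] csubspace_diff[OF S mem mem] by (meson le_less_trans)
qed

lemma convergent_of_cauchy_bound:
  fixes u :: "nat \<Rightarrow> complex"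
  assumes "\<And>e::real. 0 < e \<Longrightarrow> \<exists>M. \<forall>m\<ge>M. \<forall>n\<ge>M. d m n < e" "0 \<le> K"
    and "\<And>m n. cmod (u m - u n) \<le> K * d m n"
  shows "convergent u"
proof -
  have "Cauchy u"
  proof (rule metric_CauchyI)
    fix e :: real assume e: "0 < e"
    obtain M where M: "\<And>m n. m \<ge> M \<Longrightarrow> n \<ge> M \<Longrightarrow> d m n < e / (K + 1)"
      using assms(1)[of "e / (K + 1)"] e assms(2) by auto
    have "dist (u m) (u n) < e" if "m \<ge> M" "n \<ge> M" for m n
    proof -
      have "dist (u m) (u n) \<le> K * d m n" using assms(3) by (simp add: dist_norm)
      also have "\<dots> \<le> K * (e / (K + 1))"
        using M[OF that] assms(2) by (intro mult_left_mono) auto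
      also have "\<dots> < e" using e assms(2) by (simp add: field_simps)
      finally show ?thesis .
    qed
    then show "\<exists>M. \<forall>m\<ge>M. \<forall>n\<ge>M. dist (u m) (u n) < e" by blast
  qed
  then show ?thesis by (simp add: Cauchy_convergent_iff)
qed

text \<open>The functions \<open>1\<close>, \<open>c\<close>, \<open>cnj c\<close> and
  \<open>c * cnj c\<close> are linearly independent; the values at \<open>0\<close>,
  \<open>1\<close>, \<open>-1\<close> and \<open>\<i>\<close> already separate them.\<close>

lemma polarization_coefficient:
  fixes \<alpha> \<beta> \<gamma> \<delta> :: complex
  assumes "\<And>c. \<alpha> + c * \<beta> + cnj c * \<gamma> + c * cnj c * \<delta> = 0"
  shows "\<beta> = 0"
proof -
  from assms[of 0] assms[of 1] assms[of "-1"] assms[of \<i>]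
  have "\<alpha> = 0" "\<beta> + \<gamma> + \<delta> = 0" "\<delta> - \<beta> - \<gamma> = 0" "\<i> * \<beta> - \<i> * \<gamma> + \<delta> = 0"
    by (simp_all add: algebra_simps)
  then show ?thesis by (auto simp: complex_eq_iff)
qed

context positive_functional
begin

lemma gns_cauchy_iff: "gns_cauchy S \<omega> C \<longleftrightarrow> sp.scauchy C"
  by (simp add: gns_cauchy_def scauchy_def')

lemma gns_cauchy_bounded:
  assumes "gns_cauchy S \<omega> C" obtains K where "0 < K" "\<And>n. gns_norm \<omega> (C n) \<le> K"
  using scauchy_bounded'[of C] assms by (auto simp: gns_cauchy_iff)

text \<open>With \<open>v\<close> the limit of the vectors \<open>C n \<Omega>\<close>, this is the
  functional \<open>x \<mapsto> \<langle>v, x \<Omega>\<rangle>\<close>. It need not be positive, so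
  its norm bound is recorded separately.\<close>

lemma limit_functional:
  assumes C: "gns_cauchy S \<omega> C"
  obtains f K where "clinear_on S f" "\<And>x. x \<in> S \<Longrightarrow> (\<lambda>n. \<omega> (star (C n) * x)) \<longlonglongrightarrow> f x"
    "\<And>x. x \<in> S \<Longrightarrow> cmod (f x) \<le> K * norm x"
proof -
  have CS: "C n \<in> S" for n using C by (simp add: gns_cauchy_def)
  define f where "f x = lim (\<lambda>n. \<omega> (star (C n) * x))" for x
  have lim: "(\<lambda>n. \<omega> (star (C n) * x)) \<longlonglongrightarrow> f x" if x: "x \<in> S" for x
  proof -
    have "convergent (\<lambda>n. \<omega> (star (C n) * x))"
    proof (rule convergent_of_cauchy_bound[where K = "gns_norm \<omega> x" and d = "\<lambda>m n. gns_norm \<omega> (C m - C n)"])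
      fix m n
      have "\<omega> (star (C m) * x) - \<omega> (star (C n) * x) = \<omega> (star (C m - C n) * x)"
        using CS x by (simp add: star_diff left_diff_distrib linD mem)
      then show "cmod (\<omega> (star (C m) * x) - \<omega> (star (C n) * x)) \<le> gns_norm \<omega> x * gns_norm \<omega> (C m - C n)"
        using gns_cs[of "C m - C n" x] CS x by (simp add: mem mult.commute)
    qed (use C gns_nonneg[OF x] in \<open>auto simp: gns_cauchy_def\<close>)
    then show ?thesis by (simp add: f_def convergent_LIMSEQ_iff)
  qed
  obtain K where K: "0 < K" "\<And>n. gns_norm \<omega> (C n) \<le> K" using gns_cauchy_bounded[OF C] by blast
  have "cmod (f x) \<le> (K * sqrt (Re (\<omega> 1))) * norm x" if x: "x \<in> S" for x
  proof (rule LIMSEQ_le_const2[OF tendsto_norm[OF lim[OF x]]], intro exI allI impI)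
    fix n
    have "cmod (\<omega> (star (C n) * x)) \<le> gns_norm \<omega> (C n) * gns_norm \<omega> x" using CS x by (rule gns_cs)
    also have "\<dots> \<le> K * (norm x * sqrt (Re (\<omega> 1)))"
      using K gns_le_norm[OF x] gns_nonneg[OF x] by (intro mult_mono) (auto intro: less_imp_le)
    finally show "cmod (\<omega> (star (C n) * x)) \<le> (K * sqrt (Re (\<omega> 1))) * norm x" by (simp add: mult_ac)
  qed
  moreover have "clinear_on S f"
    unfolding clinear_on_def
  proof (intro conjI ballI allI)
    fix x assume x: "x \<in> S"
    show "f (c *\<^sub>C x) = c *\<^sub>C f x" for c
    proof (rule LIMSEQ_unique[OF lim])
      show "(\<lambda>n. \<omega> (star (C n) * (c *\<^sub>C x))) \<longlonglongrightarrow> c *\<^sub>C f x"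
        using tendsto_mult_left[OF lim[OF x], of c] CS x by (simp add: mult_scaleC_right linD mem)
    qed (use x in \<open>simp add: mem\<close>)
    fix y assume y: "y \<in> S"
    show "f (x + y) = f x + f y"
    proof (rule LIMSEQ_unique[OF lim])
      show "(\<lambda>n. \<omega> (star (C n) * (x + y))) \<longlonglongrightarrow> f x + f y"
        using tendsto_add[OF lim[OF x] lim[OF y]] CS x y by (simp add: distrib_left linD mem)
    qed (use x y in \<open>simp add: mem\<close>)
  qed
  ultimately show ?thesis using that lim by blast
qed

lemma form_perturb:
  assumes "x \<in> S" "u \<in> S" "v \<in> S"
  shows "cmod (\<omega> (star u * x * u) - \<omega> (star v * x * v))
    \<le> norm x * (gns_norm \<omega> u + gns_norm \<omega> v) * gns_norm \<omega> (u - v)"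
proof -
  have "\<omega> (star u * x * u) - \<omega> (star v * x * v) = \<omega> (star u * x * (u - v)) + \<omega> (star (u - v) * x * v)"
    using assms by (simp add: star_diff left_diff_distrib right_diff_distrib linD mem)
  also have "cmod \<dots> \<le> norm x * gns_norm \<omega> u * gns_norm \<omega> (u - v) + norm x * gns_norm \<omega> (u - v) * gns_norm \<omega> v"
    by (intro order_trans[OF norm_triangle_ineq] add_mono form_bound) (use assms in \<open>auto simp: mem\<close>)
  finally show ?thesis by (simp add: algebra_simps)
qed

text \<open>The functional of the limit of the vectors \<open>D n \<Omega>\<close>: on a bounded
  sequence the sandwiched form is Lipschitz in \<open>gns_norm\<close>, hence convergent.\<close>

lemma vector_functional:
  assumes D: "gns_cauchy S \<omega> D"
  obtains \<omega>' where "positive_on S \<omega>'" "\<And>x. x \<in> S \<Longrightarrow> (\<lambda>n. \<omega> (star (D n) * x * D n)) \<longlonglongrightarrow> \<omega>' x"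
proof -
  have DS: "D n \<in> S" for n using D by (simp add: gns_cauchy_def)
  obtain K where K: "0 < K" "\<And>n. gns_norm \<omega> (D n) \<le> K" using gns_cauchy_bounded[OF D] by blast
  define \<omega>' where "\<omega>' x = lim (\<lambda>n. \<omega> (star (D n) * x * D n))" for x
  have lim: "(\<lambda>n. \<omega> (star (D n) * x * D n)) \<longlonglongrightarrow> \<omega>' x" if x: "x \<in> S" for x
  proof -
    have "convergent (\<lambda>n. \<omega> (star (D n) * x * D n))"
    proof (rule convergent_of_cauchy_bound[where K = "norm x * (K + K)" and d = "\<lambda>m n. gns_norm \<omega> (D m - D n)"])
      fix m n
      have "cmod (\<omega> (star (D m) * x * D m) - \<omega> (star (D n) * x * D n))
          \<le> norm x * (gns_norm \<omega> (D m) + gns_norm \<omega> (D n)) * gns_norm \<omega> (D m - D n)"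
        by (rule form_perturb) (use x DS in auto)
      also have "\<dots> \<le> norm x * (K + K) * gns_norm \<omega> (D m - D n)"
        using K gns_nonneg[of "D m - D n"] DS
        by (intro mult_right_mono mult_left_mono add_mono) (auto simp: mem)
      finally show "cmod (\<omega> (star (D m) * x * D m) - \<omega> (star (D n) * x * D n))
          \<le> norm x * (K + K) * gns_norm \<omega> (D m - D n)" .
    qed (use D K in \<open>auto simp: gns_cauchy_def\<close>)
    then show ?thesis by (simp add: \<omega>'_def convergent_LIMSEQ_iff)
  qed
  interpret c: positive_functional S "\<lambda>x. \<omega> (star (D n) * x * D n)" for n
    by (rule conjugate[OF DS])
  have "positive_on S \<omega>'"
  proof (rule positive_onI)
    fix x assume x: "x \<in> S"
    show "\<omega>' (c *\<^sub>C x) = c * \<omega>' x" for c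
    proof (rule LIMSEQ_unique[OF lim])
      show "(\<lambda>n. \<omega> (star (D n) * (c *\<^sub>C x) * D n)) \<longlonglongrightarrow> c * \<omega>' x"
        using tendsto_mult_left[OF lim[OF x], of c] x by (simp add: c.linD)
    qed (use x in \<open>simp add: mem\<close>)
    have xx: "(\<lambda>n. \<omega> (star (D n) * (star x * x) * D n)) \<longlonglongrightarrow> \<omega>' (star x * x)"
      by (rule lim) (use x in \<open>simp add: mem\<close>)
    show "0 \<le> Re (\<omega>' (star x * x)) \<and> Im (\<omega>' (star x * x)) = 0"
    proof
      show "0 \<le> Re (\<omega>' (star x * x))"
        by (rule LIMSEQ_le_const[OF tendsto_Re[OF xx]]) (use c.self_nonneg[OF x] in auto)
      have "(\<lambda>n. 0) \<longlonglongrightarrow> Im (\<omega>' (star x * x))"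
        using tendsto_Im[OF xx] c.self_nonneg[OF x] by simp
      then show "Im (\<omega>' (star x * x)) = 0" by (simp add: LIMSEQ_const_iff)
    qed
    fix y assume y: "y \<in> S"
    show "\<omega>' (x + y) = \<omega>' x + \<omega>' y"
    proof (rule LIMSEQ_unique[OF lim])
      show "(\<lambda>n. \<omega> (star (D n) * (x + y) * D n)) \<longlonglongrightarrow> \<omega>' x + \<omega>' y"
        using tendsto_add[OF lim[OF x] lim[OF y]] x y by (simp add: c.linD)
    qed (use x y in \<open>simp add: mem\<close>)
  qed
  then show ?thesis using that lim by blast
qed

text \<open>Both sides of \<open>sand\<close> are polynomials in \<open>c\<close> and
  \<open>cnj c\<close>; the claim compares the coefficients of \<open>c\<close>.\<close>

lemma polarize:
  assumes x: "x \<in> S" and b: "b \<in> S"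
    and sand: "\<And>c. \<omega> (star (1 + c *\<^sub>C b) * x * (1 + c *\<^sub>C b)) = \<omega> (star (1 + c *\<^sub>C b) * (1 + c *\<^sub>C b)) * v"
  shows "\<omega> (x * b) = \<omega> b * v"
proof -
  define \<alpha> where "\<alpha> = \<omega> x - \<omega> 1 * v"
  define \<beta> where "\<beta> = \<omega> (x * b) - \<omega> b * v"
  define \<gamma> where "\<gamma> = \<omega> (star b * x) - \<omega> (star b) * v"
  define \<delta> where "\<delta> = \<omega> (star b * x * b) - \<omega> (star b * b) * v"
  have ex: "\<omega> (star (1 + c *\<^sub>C b) * y * (1 + c *\<^sub>C b)) =
      \<omega> y + c * \<omega> (y * b) + cnj c * \<omega> (star b * y) + c * cnj c * \<omega> (star b * y * b)"
    if y: "y \<in> S" for c y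
    using b y by (simp add: star_add star_scaleC distrib_left distrib_right mult_scaleC_left
        mult_scaleC_right linD mem scaleC_scaleC algebra_simps)
  have "\<alpha> + c * \<beta> + cnj c * \<gamma> + c * cnj c * \<delta> = 0" for c
    using sand[of c] ex[OF x, of c] ex[of 1 c]
    by (simp add: \<alpha>_def \<beta>_def \<gamma>_def \<delta>_def mem algebra_simps)
  then have "\<beta> = 0" by (rule polarization_coefficient)
  then show ?thesis by (simp add: \<beta>_def)
qed

end

section \<open>Transfer of purity between vector states\<close>

text \<open>The hypotheses on \<open>D\<close> and \<open>E\<close> say that, in the GNS space of \<open>\<phi>\<close>, the vectors \<open>D n \<Omega>\<close>
  converge to a vector \<open>\<xi>\<close> inducing \<open>\<phi>'\<close>, and \<open>E m \<xi>\<close> comes close to \<open>\<Omega>\<close>.\<close>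

lemma sandwich_near_one:
  assumes "positive_functional S \<omega>" and x: "x \<in> S" and z: "z \<in> S"
    and one: "gns_norm \<omega> 1 \<le> 1" and d: "gns_norm \<omega> (z - 1) \<le> e" and e: "e \<le> 1"
  shows "cmod (\<omega> (star z * x * z) - \<omega> x) \<le> 3 * norm x * e"
proof -
  interpret positive_functional S \<omega> by fact
  have z2: "gns_norm \<omega> z \<le> 2"
    using gns_triangle[of "z - 1" 1] z one d e by (simp add: mem)
  have "cmod (\<omega> (star z * x * z) - \<omega> (star 1 * x * 1))
      \<le> norm x * (gns_norm \<omega> z + gns_norm \<omega> 1) * gns_norm \<omega> (z - 1)"
    by (rule form_perturb) (use x z in \<open>auto simp: mem\<close>)
  also have "\<dots> \<le> norm x * (2 + 1) * e"
    using z2 one d gns_nonneg[of "z - 1"] gns_nonneg[of 1] gns_nonneg[of z] z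
    by (intro mult_mono add_mono mult_nonneg_nonneg) (auto simp: mem)
  finally show ?thesis by (simp add: mult_ac)
qed

text \<open>For \<open>\<omega>\<close> dominated by \<open>\<phi>\<close>, the functional
  \<open>\<omega>'\<close> obtained along \<open>D\<close> is dominated by \<open>\<phi>'\<close>,
  hence equals \<open>c * \<phi>'\<close> with \<open>c = \<omega>' 1\<close>. Since
  \<open>E m * D n\<close> is close to \<open>1\<close>, evaluating this at
  \<open>star (E m) * x * E m\<close> makes \<open>\<omega> x - c * \<phi> x\<close> arbitrarily
  small. The same sequences serve both functionals because
  \<open>gns_norm \<omega> \<le> gns_norm \<phi>\<close>.\<close>

lemma pure_transfer:
  assumes S: "cstar_subalgebra S" and st: "state_on S \<phi>" and pure: "pure_state_on S \<phi>'"
    and D: "gns_cauchy S \<phi> D" and E: "\<And>m. E m \<in> S"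
    and lim: "\<And>x. x \<in> S \<Longrightarrow> (\<lambda>n. \<phi> (star (D n) * x * D n)) \<longlonglongrightarrow> \<phi>' x"
    and approx: "\<And>e. 0 < e \<Longrightarrow> \<exists>m. \<forall>\<^sub>F n in sequentially. gns_norm \<phi> (E m * D n - 1) < e"
  shows "pure_state_on S \<phi>"
proof (rule pureI[OF S st])
  fix \<omega> y assume \<omega>: "positive_on S \<omega>" and dom: "dominated_on S \<omega> \<phi>" and y: "y \<in> S"
  interpret p: positive_functional S \<phi> using S st by unfold_locales (auto simp: state_on_iff)
  interpret w: positive_functional S \<omega> using S \<omega> by unfold_locales
  have DS: "D n \<in> S" for n using D by (simp add: gns_cauchy_def)
  have one: "gns_norm \<phi> 1 = 1" using st by (simp add: gns_norm_def state_on_def)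
  then have wone: "gns_norm \<omega> 1 \<le> 1" using gns_norm_dominated[OF dom p.mem(1)] by simp
  obtain \<omega>' where \<omega>': "positive_on S \<omega>'"
    and lim': "\<And>x. x \<in> S \<Longrightarrow> (\<lambda>n. \<omega> (star (D n) * x * D n)) \<longlonglongrightarrow> \<omega>' x"
    using w.vector_functional[OF gns_cauchy_dominated[OF p.subspace D dom]] by blast
  have "Re (\<omega>' (star y * y)) \<le> 1 * Re (\<phi>' (star y * y))" if y: "y \<in> S" for y
  proof -
    have yy: "star y * y \<in> S" using y by (simp add: p.mem)
    have "Re (\<omega> (star (D n) * (star y * y) * D n)) \<le> Re (\<phi> (star (D n) * (star y * y) * D n))" for n
    proof -
      have "Re (\<omega> (star (y * D n) * (y * D n))) \<le> Re (\<phi> (star (y * D n) * (y * D n)))"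
        using dom DS[of n] y by (auto simp: dominated_on_def p.mem)
      then show ?thesis by (simp add: star_mult mult.assoc)
    qed
    then show ?thesis
      using LIMSEQ_le[OF tendsto_Re[OF lim'[OF yy]] tendsto_Re[OF lim[OF yy]]] by auto
  qed
  then have eq: "\<omega>' y = \<omega>' 1 * \<phi>' y" if "y \<in> S" for y
    using pure_dominated[OF S pure \<omega>' _ that, of 1] by blast
  define c where "c = \<omega>' 1"
  have small: "cmod (\<omega> x - c * \<phi> x) \<le> (3 * norm x * (1 + cmod c)) * e"
    if e: "0 < e" "e \<le> 1" and x: "x \<in> S" for e x
  proof -
    obtain m where m: "\<forall>\<^sub>F n in sequentially. gns_norm \<phi> (E m * D n - 1) < e"
      using approx[OF e(1)] by blast
    \<comment> \<open>Tends to \<open>0\<close>, since \<open>\<omega>'\<close> and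
      \<open>c * \<phi>'\<close> agree on \<open>star (E m) * x * E m\<close>.\<close>
    define h where "h n = \<omega> (star (D n) * (star (E m) * x * E m) * D n)
        - c * \<phi> (star (D n) * (star (E m) * x * E m) * D n)" for n
    have EE: "star (E m) * x * E m \<in> S" using E x by (simp add: p.mem)
    have "h \<longlonglongrightarrow> \<omega>' (star (E m) * x * E m) - c * \<phi>' (star (E m) * x * E m)"
      unfolding h_def by (intro tendsto_intros lim lim' EE)
    then have "h \<longlonglongrightarrow> 0" using eq[OF EE] by (simp add: c_def)
    have ev: "\<forall>\<^sub>F n in sequentially. cmod (\<omega> x - c * \<phi> x) \<le> (3 * norm x * (1 + cmod c)) * e + cmod (h n)"
      using m
    proof eventually_elim
      case (elim n)
      let ?z = "E m * D n"
      have z: "?z \<in> S" using E DS by (simp add: p.mem)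
      have zz: "star (D n) * (star (E m) * x * E m) * D n = star ?z * x * ?z"
        by (simp add: star_mult mult.assoc)
      have 1: "cmod (\<phi> (star ?z * x * ?z) - \<phi> x) \<le> 3 * norm x * e"
        using sandwich_near_one[OF p.positive_functional_axioms x z] one elim e by simp
      have "gns_norm \<omega> (?z - 1) \<le> e"
        using gns_norm_dominated[OF dom, of "?z - 1"] z elim by (simp add: p.mem)
      then have 2: "cmod (\<omega> (star ?z * x * ?z) - \<omega> x) \<le> 3 * norm x * e"
        using sandwich_near_one[OF w.positive_functional_axioms x z wone] e by simp
      have "\<omega> x - c * \<phi> x = h n - (\<omega> (star ?z * x * ?z) - \<omega> x) + c * (\<phi> (star ?z * x * ?z) - \<phi> x)"
        unfolding h_def zz by (simp add: right_diff_distrib)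
      also have "cmod \<dots> \<le> cmod (h n) + cmod (\<omega> (star ?z * x * ?z) - \<omega> x)
          + cmod (c * (\<phi> (star ?z * x * ?z) - \<phi> x))"
        by (intro order_trans[OF norm_triangle_ineq] add_mono norm_triangle_ineq4 order_refl)
      also have "cmod (c * (\<phi> (star ?z * x * ?z) - \<phi> x)) \<le> cmod c * (3 * norm x * e)"
        unfolding norm_mult using 1 by (intro mult_left_mono) auto
      finally show ?case using 2 by (simp add: algebra_simps)
    qed
    have "(\<lambda>n. (3 * norm x * (1 + cmod c)) * e + cmod (h n)) \<longlonglongrightarrow> (3 * norm x * (1 + cmod c)) * e + cmod 0"
      by (intro tendsto_intros \<open>h \<longlonglongrightarrow> 0\<close>)
    from tendsto_lowerbound[OF this ev] show ?thesis by simp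
  qed
  have "\<omega> x = c * \<phi> x" if x: "x \<in> S" for x
  proof (rule ccontr)
    assume "\<omega> x \<noteq> c * \<phi> x"
    then have pos: "0 < cmod (\<omega> x - c * \<phi> x)" by simp
    \<comment> \<open>The summand \<open>1\<close> keeps \<open>L\<close> positive when
      \<open>x = 0\<close>; the factor 2 in \<open>e\<close> below lets \<open>small\<close> bound
      the distance by half of itself.\<close>
    define L where "L = 3 * norm x * (1 + cmod c) + 1"
    have L: "0 < L" by (simp add: L_def add_nonneg_pos)
    define e where "e = min 1 (cmod (\<omega> x - c * \<phi> x) / (2 * L))"
    have e: "0 < e" "e \<le> 1" using pos L by (auto simp: e_def)
    have "cmod (\<omega> x - c * \<phi> x) \<le> L * e"
      using small[OF e x] e by (simp add: L_def distrib_right)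
    also have "\<dots> \<le> L * (cmod (\<omega> x - c * \<phi> x) / (2 * L))"
      using L by (intro mult_left_mono) (auto simp: e_def)
    also have "\<dots> = cmod (\<omega> x - c * \<phi> x) / 2" using L by simp
    finally show False using pos by simp
  qed
  from this[OF y] this[OF p.mem(1)] show "\<omega> y = \<omega> 1 * \<phi> y"
    using st by (simp add: state_on_def)
qed

text \<open>If \<open>D n \<Omega>\<close> tends to \<open>\<xi>\<close> and
  \<open>E m \<xi>\<close> to \<open>\<Omega>\<close>, then the functional of
  \<open>E m \<xi>\<close> tends to that of \<open>\<Omega>\<close>. This supplies the convergence
  hypothesis of \<open>pure_transfer\<close> with the two states exchanged.\<close>

lemma vector_state_back:
  assumes S: "cstar_subalgebra S" and st: "state_on S \<phi>"
    and D: "gns_cauchy S \<phi> D" and E: "\<And>m. E m \<in> S"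
    and lim: "\<And>x. x \<in> S \<Longrightarrow> (\<lambda>n. \<phi> (star (D n) * x * D n)) \<longlonglongrightarrow> \<phi>' x"
    and approx: "\<And>e. 0 < e \<Longrightarrow>
      \<forall>\<^sub>F m in sequentially. \<forall>\<^sub>F n in sequentially. gns_norm \<phi> (E m * D n - 1) < e"
    and x: "x \<in> S"
  shows "(\<lambda>m. \<phi>' (star (E m) * x * E m)) \<longlonglongrightarrow> \<phi> x"
proof (rule tendstoI)
  interpret p: positive_functional S \<phi> using S st by unfold_locales (auto simp: state_on_iff)
  have DS: "D n \<in> S" for n using D by (simp add: gns_cauchy_def)
  have one: "gns_norm \<phi> 1 = 1" using st by (simp add: gns_norm_def state_on_def)
  fix e :: real assume e: "0 < e"
  \<comment> \<open>The denominator makes \<open>3 * norm x * d\<close> strictly smaller than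
    \<open>e\<close>, also for \<open>x = 0\<close>.\<close>
  define d where "d = min 1 (e / (6 * norm x + 1))"
  have d: "0 < d" "d \<le> 1" using e by (auto simp: d_def add_nonneg_pos)
  have "3 * norm x * d < e"
  proof -
    have "3 * norm x * d \<le> 3 * norm x * (e / (6 * norm x + 1))"
      by (intro mult_left_mono) (auto simp: d_def)
    also have "\<dots> < e" using e by (simp add: field_simps add_pos_nonneg add_nonneg_pos)
    finally show ?thesis .
  qed
  show "\<forall>\<^sub>F m in sequentially. dist (\<phi>' (star (E m) * x * E m)) (\<phi> x) < e"
    using approx[OF d(1)]
  proof eventually_elim
    case (elim m)
    have EE: "star (E m) * x * E m \<in> S" using E x by (simp add: p.mem)
    have ev: "\<forall>\<^sub>F n in sequentially.
        cmod (\<phi> (star (D n) * (star (E m) * x * E m) * D n) - \<phi> x) \<le> 3 * norm x * d"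
      using elim
    proof eventually_elim
      case (elim n)
      let ?z = "E m * D n"
      have z: "?z \<in> S" using E DS by (simp add: p.mem)
      have "star (D n) * (star (E m) * x * E m) * D n = star ?z * x * ?z"
        by (simp add: star_mult mult.assoc)
      then show ?case
        using sandwich_near_one[OF p.positive_functional_axioms x z] one elim d by simp
    qed
    have "cmod (\<phi>' (star (E m) * x * E m) - \<phi> x) \<le> 3 * norm x * d"
      by (rule tendsto_upperbound[OF _ ev]) (auto intro!: tendsto_intros lim EE)
    then show ?case using \<open>3 * norm x * d < e\<close> by (simp add: dist_norm)
  qed
qed

section \<open>Two subsystems\<close>

text \<open>One Gram-Schmidt step per induction step: removing from each \<open>B k\<close> its
  component along \<open>B j\<close> splits off the rank-one part
  \<open>cnj (lam k) * lam l * q\<close>, which contributes \<open>\<psi> (star C * C) * q\<close>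
  for a single element \<open>C\<close>. The remainder no longer involves \<open>j\<close>.\<close>

lemma schur_product:
  assumes "positive_functional S \<psi>" "positive_functional T \<rho>" "finite F"
    and "\<And>k. k \<in> F \<Longrightarrow> A k \<in> S" "\<And>k. k \<in> F \<Longrightarrow> B k \<in> T"
  shows "(\<Sum>k\<in>F. \<Sum>l\<in>F. \<psi> (star (A k) * A l) * \<rho> (star (B k) * B l)) \<in> \<real>\<^sub>\<ge>\<^sub>0"
proof -
  interpret s: positive_functional S \<psi> by fact
  interpret r: positive_functional T \<rho> by fact
  show ?thesis
    using assms(3-)
  proof (induction F arbitrary: B rule: finite_induct)
    case (insert j F)
    define g where "g k l = \<psi> (star (A k) * A l)" for k l
    have AS: "A k \<in> S" and BT: "B k \<in> T" if "k \<in> insert j F" for k using insert.prems that by auto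
    define q where "q = \<rho> (star (B j) * B j)"
    \<comment> \<open>If \<open>q = 0\<close>, then \<open>B j\<close> is null and by Cauchy-Schwarz
      pairs to \<open>0\<close> with every \<open>B k\<close>, so the coefficient \<open>0\<close>
      is correct.\<close>
    define lam where "lam k = (if q = 0 then 0 else \<rho> (star (B j) * B k) / q)" for k
    \<comment> \<open>Set to \<open>0\<close> outright at \<open>j\<close>: for \<open>q = 0\<close>
      the subtraction would leave \<open>B j\<close> itself. All terms with index \<open>j\<close>
      then drop out.\<close>
    define B' where "B' k = (if k = j then 0 else B k - lam k *\<^sub>C B j)" for k
    have B'T: "B' k \<in> T" if "k \<in> insert j F" for k
      using BT[OF that] BT[of j] by (auto simp: B'_def r.mem)
    have q: "0 \<le> Re q" "q = of_real (Re q)"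
      using r.self_nonneg[OF BT[of j]] by (auto simp: q_def complex_eq_iff)
    have Bj: "\<rho> (star (B j) * B k) = lam k * q" if k: "k \<in> insert j F" for k
    proof (cases "q = 0")
      case True
      then have "gns_norm \<rho> (B j) = 0" by (simp add: gns_norm_def q_def)
      then show ?thesis using r.gns_cs[OF BT[of j] BT[OF k]] True by simp
    qed (simp add: lam_def)
    have kB: "\<rho> (star (B k) * B j) = cnj (lam k) * q" if k: "k \<in> insert j F" for k
    proof -
      have "cnj q = q" by (subst (1 2) q(2)) (rule complex_cnj_complex_of_real)
      then show ?thesis using r.hermitian_form[OF BT[OF k] BT[of j]] Bj[OF k] by simp
    qed
    have split: "\<rho> (star (B k) * B l) = \<rho> (star (B' k) * B' l) + cnj (lam k) * lam l * q"
      if k: "k \<in> insert j F" and l: "l \<in> insert j F" for k l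
    proof -
      have lamj: "lam j * q = q" using Bj[of j] by (simp add: q_def)
      have lamj': "cnj (lam j) * q = q" using kB[of j] by (simp add: q_def)
      consider "k = j" | "k \<noteq> j" "l = j" | "k \<noteq> j" "l \<noteq> j" by blast
      then show ?thesis
      proof cases
        case 1
        have "cnj (lam j) * lam l * q = lam l * q" using lamj' by (metis mult.assoc mult.commute)
        then show ?thesis using 1 Bj[OF l] r.linD(3) by (simp add: B'_def)
      next
        case 2
        have "cnj (lam k) * lam j * q = cnj (lam k) * q" using lamj by (simp add: mult.assoc)
        then show ?thesis using 2 kB[OF k] r.linD(3) by (simp add: B'_def)
      next
        case 3
        then show ?thesis
          using BT[OF k] BT[OF l] BT[of j] Bj[OF k] Bj[OF l] kB[OF k] kB[OF l]
          by (simp add: B'_def star_diff star_scaleC left_diff_distrib right_diff_distrib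
              mult_scaleC_left mult_scaleC_right r.linD r.mem scaleC_scaleC q_def[symmetric])
      qed
    qed
    define C where "C = (\<Sum>k\<in>insert j F. lam k *\<^sub>C A k)"
    have CS: "C \<in> S" unfolding C_def by (rule csubspace_sum[OF s.subspace]) (use AS in \<open>auto simp: s.mem\<close>)
    have CC: "\<psi> (star C * C) = (\<Sum>k\<in>insert j F. \<Sum>l\<in>insert j F. cnj (lam k) * lam l * g k l)"
    proof -
      have "star C * C = (\<Sum>k\<in>insert j F. \<Sum>l\<in>insert j F. (cnj (lam k) * lam l) *\<^sub>C (star (A k) * A l))"
        by (simp only: C_def star_sum sum_product)
          (simp add: star_scaleC mult_scaleC_left mult_scaleC_right scaleC_scaleC mult.commute[of "lam _"])
      also have "\<psi> \<dots> = (\<Sum>k\<in>insert j F. \<Sum>l\<in>insert j F. cnj (lam k) * lam l * g k l)"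
      proof -
        have m: "(cnj (lam k) * lam l) *\<^sub>C (star (A k) * A l) \<in> S"
          if "k \<in> insert j F" "l \<in> insert j F" for k l
          using AS that by (simp add: s.mem)
        have "\<psi> (\<Sum>l\<in>insert j F. (cnj (lam k) * lam l) *\<^sub>C (star (A k) * A l)) =
            (\<Sum>l\<in>insert j F. cnj (lam k) * lam l * g k l)" if k: "k \<in> insert j F" for k
          using AS k by (subst clinear_on_sum[OF s.lin s.subspace m])
            (simp_all add: g_def s.linD s.mem del: sum.insert)
        then show ?thesis
          by (subst clinear_on_sum[OF s.lin s.subspace csubspace_sum[OF s.subspace m]])
            (auto simp del: sum.insert intro!: sum.cong)
      qed
      finally show ?thesis .
    qed
    have "(\<Sum>k\<in>insert j F. \<Sum>l\<in>insert j F. g k l * \<rho> (star (B k) * B l)) =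
        (\<Sum>k\<in>insert j F. \<Sum>l\<in>insert j F. g k l * \<rho> (star (B' k) * B' l)) + \<psi> (star C * C) * q"
      unfolding CC sum_distrib_right sum.distrib[symmetric]
      by (intro sum.cong refl) (simp only: split, simp add: algebra_simps)
    also have "(\<Sum>k\<in>insert j F. \<Sum>l\<in>insert j F. g k l * \<rho> (star (B' k) * B' l)) =
        (\<Sum>k\<in>F. \<Sum>l\<in>F. g k l * \<rho> (star (B' k) * B' l))"
      using insert.hyps by (simp add: B'_def r.linD(3))
    finally have eq: "(\<Sum>k\<in>insert j F. \<Sum>l\<in>insert j F. g k l * \<rho> (star (B k) * B l)) =
        (\<Sum>k\<in>F. \<Sum>l\<in>F. g k l * \<rho> (star (B' k) * B' l)) + \<psi> (star C * C) * q" .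
    have "(\<Sum>k\<in>F. \<Sum>l\<in>F. g k l * \<rho> (star (B' k) * B' l)) \<in> \<real>\<^sub>\<ge>\<^sub>0"
      unfolding g_def by (rule insert.IH) (use AS B'T in auto)
    moreover have "\<psi> (star C * C) * q \<in> \<real>\<^sub>\<ge>\<^sub>0"
      using s.self_nonneg[OF CS] q by (intro nonneg_Reals_mult_I) (auto simp: nonneg_Reals_iff complex_eq_iff)
    ultimately show ?case unfolding g_def[symmetric] eq by (rule nonneg_Reals_add_I)
  qed simp
qed

section \<open>Product functionals on two disjoint subsystems\<close>

context car
begin

lemma positive_functionalI: "positive_on (\<A> I) \<omega> \<Longrightarrow> positive_functional (\<A> I) \<omega>"
  using subalg by unfold_locales

lemma mem_union: "x \<in> \<A> I \<Longrightarrow> x \<in> \<A> (I \<union> J)" "y \<in> \<A> J \<Longrightarrow> y \<in> \<A> (I \<union> J)"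
  using subalg_mono[of I "I \<union> J"] subalg_mono[of J "I \<union> J"] by auto

lemma star_sandwich:
  assumes d: "I \<inter> J = {}" and z: "z \<in> \<A> I" and b: "b \<in> \<A> J" and c: "c \<in> \<A> J"
  shows "star b * z * c = z * (star (ev b) * c) + \<Theta> z * (star (od b) * c)"
proof -
  have "ev (star b) = star (ev b)" "od (star b) = star (od b)"
    by (simp_all add: ev_def od_def star_scaleC star_add star_diff parity)
  then show ?thesis
    unfolding graded_commute[OF z mem_star[OF b] d] by (simp add: distrib_right mult.assoc)
qed

lemma product_pure:
  assumes d: "I \<inter> J = {}" and st: "state_on (\<A> (I \<union> J)) \<phi>"
    and prod: "\<And>x y. x \<in> \<A> I \<Longrightarrow> y \<in> \<A> J \<Longrightarrow> \<phi> (x * y) = \<phi> x * \<phi> y"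
    and even: "even_on a I \<phi>" and pI: "pure_state_on (\<A> I) \<phi>" and pJ: "pure_state_on (\<A> J) \<phi>"
  shows "pure_state_on (\<A> (I \<union> J)) \<phi>"
proof (rule pureI[OF subalg st])
  fix \<omega> X assume \<omega>: "positive_on (\<A> (I \<union> J)) \<omega>" and dom: "dominated_on (\<A> (I \<union> J)) \<omega> \<phi>"
    and X: "X \<in> \<A> (I \<union> J)"
  interpret w: positive_functional "\<A> (I \<union> J)" \<omega> by (rule positive_functionalI[OF \<omega>])
  interpret p: positive_functional "\<A> (I \<union> J)" \<phi> using st by (intro positive_functionalI) (simp add: state_on_iff)
  \<comment> \<open>Evenness on \<open>\<A> I\<close> replaces \<open>\<Theta> z\<close> by
    \<open>z\<close>, so the contributions of the even and odd parts of \<open>b\<close>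
    recombine.\<close>
  have sand: "\<phi> (star b * z * b) = \<phi> z * \<phi> (star b * b)" if z: "z \<in> \<A> I" and b: "b \<in> \<A> J" for z b
  proof -
    have "\<phi> (star b * z * b) = \<phi> z * \<phi> (star (ev b) * b) + \<phi> z * \<phi> (star (od b) * b)"
      unfolding star_sandwich[OF d z b b]
      using z b prod even
      by (simp add: p.linD mem_union ev_mem od_mem mems parity_mem even_on_def)
    also have "\<dots> = \<phi> z * \<phi> (star (ev b) * b + star (od b) * b)"
      using b by (simp add: p.linD mem_union ev_mem od_mem mems distrib_left)
    also have "star (ev b) * b + star (od b) * b = star b * b"
      by (simp add: ev_od flip: distrib_right star_add)
    finally show ?thesis .
  qed
  have key: "\<omega> (star b * z * b) = \<omega> (star b * b) * \<phi> z" if z: "z \<in> \<A> I" and b: "b \<in> \<A> J" for z b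
  proof -
    interpret c: positive_functional "\<A> (I \<union> J)" "\<lambda>z. \<omega> (star b * z * b)"
      by (rule w.conjugate) (simp add: mem_union b)
    \<comment> \<open>By \<open>sand\<close>, this functional of \<open>z\<close> is bounded by
      \<open>\<phi> (star b * b)\<close> times \<open>\<phi>\<close>, and purity on
      \<open>\<A> I\<close> applies with that constant.\<close>
    have "\<omega> (star b * z * b) = \<omega> (star b * 1 * b) * \<phi> z"
    proof (rule pure_dominated[OF subalg pI _ _ z])
      show "positive_on (\<A> I) (\<lambda>z. \<omega> (star b * z * b))"
        by (rule positive_on_subset[OF c.positive]) (simp add: subalg_mono)
      fix x assume x: "x \<in> \<A> I"
      have "Re (\<omega> (star (x * b) * (x * b))) \<le> Re (\<phi> (star (x * b) * (x * b)))"
        using dom x b by (auto simp: dominated_on_def mem_union mems)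
      also have "\<phi> (star (x * b) * (x * b)) = \<phi> (star x * x) * \<phi> (star b * b)"
        using sand[of "star x * x" b] x b by (simp add: mems star_mult mult.assoc)
      also have "Re \<dots> = Re (\<phi> (star b * b)) * Re (\<phi> (star x * x))"
        using p.self_nonneg[of b] b by (simp add: mem_union)
      finally show "Re (\<omega> (star b * (star x * x) * b)) \<le> Re (\<phi> (star b * b)) * Re (\<phi> (star x * x))"
        by (simp add: star_mult mult.assoc)
    qed
    then show ?thesis by simp
  qed
  have J: "\<omega> y = \<omega> 1 * \<phi> y" if y: "y \<in> \<A> J" for y
  proof (rule pure_dominated[OF subalg pJ _ _ y])
    show "positive_on (\<A> J) \<omega>" by (rule positive_on_subset[OF \<omega>]) (simp add: subalg_mono)
    show "Re (\<omega> (star x * x)) \<le> 1 * Re (\<phi> (star x * x))" if "x \<in> \<A> J" for x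
      using dom that by (auto simp: dominated_on_def mem_union)
  qed
  have "\<A> (I \<union> J) \<subseteq> {x \<in> \<A> (I \<union> J). \<omega> x = \<omega> 1 * \<phi> x}"
  proof (rule union_least[OF d])
    show "closed_csubspace {x \<in> \<A> (I \<union> J). \<omega> x = \<omega> 1 * \<phi> x}"
      by (intro closed_csubspace_eq w.lin w.subspace cstar_subalgebra_closed[OF subalg]
          w.continuous p.continuous continuous_intros)
        (auto simp: clinear_on_def p.linD algebra_simps)
    fix x y assume x: "x \<in> \<A> I" and y: "y \<in> \<A> J"
    \<comment> \<open>\<open>key\<close> holds for all \<open>1 + c *\<^sub>C y\<close>, so it can
      be polarized; purity on \<open>\<A> J\<close> evaluates the remaining
      \<open>\<omega> y\<close>.\<close>
    have "\<omega> (x * y) = \<omega> y * \<phi> x"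
    proof (rule w.polarize)
      fix c
      have "1 + c *\<^sub>C y \<in> \<A> J" using y by (simp add: mems)
      then show "\<omega> (star (1 + c *\<^sub>C y) * x * (1 + c *\<^sub>C y)) = \<omega> (star (1 + c *\<^sub>C y) * (1 + c *\<^sub>C y)) * \<phi> x"
        by (rule key[OF x])
    qed (use x y in \<open>simp_all add: mem_union\<close>)
    then show "x * y \<in> {x \<in> \<A> (I \<union> J). \<omega> x = \<omega> 1 * \<phi> x}"
      using x y J[OF y] prod[OF x y] by (simp add: mem_union mem_mult)
  qed
  then show "\<omega> X = \<omega> 1 * \<phi> X" using X by auto
qed

lemma odd_vanish:
  assumes "even_on a J \<rho>" "positive_on (\<A> J) \<rho>" "y \<in> \<A> J" "\<Theta> y = - y" shows "\<rho> y = 0"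
proof -
  interpret positive_functional "\<A> J" \<rho> by (rule positive_functionalI[OF assms(2)])
  have "\<rho> (- y) = \<rho> y" using assms by (metis even_on_def)
  then show ?thesis using assms(3) by (simp add: linD)
qed

lemma products_span_cases:
  assumes "p \<in> cvec.span (products I J)"
  obtains n :: nat and X Y where "\<And>k. X k \<in> \<A> I" "\<And>k. Y k \<in> \<A> J" "p = (\<Sum>k<n. X k * Y k)"
proof -
  have "\<exists>n X Y. (\<forall>k. X k \<in> \<A> I) \<and> (\<forall>k. Y k \<in> \<A> J) \<and> p = (\<Sum>k<(n::nat). X k * Y k)"
    using assms
  proof (induction rule: cvec.span_induct_alt)
    case base
    \<comment> \<open>The empty sum; \<open>1\<close> is a default value for the total
      families.\<close>
    show ?case by (intro exI[of _ 0] exI[of _ "\<lambda>_. 1"]) (simp add: mems)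
  next
    case (step c u v)
    then obtain n X Y where XY: "\<forall>k. X k \<in> \<A> I" "\<forall>k. Y k \<in> \<A> J" "v = (\<Sum>k<(n::nat). X k * Y k)"
      by blast
    obtain x y where xy: "x \<in> \<A> I" "y \<in> \<A> J" "u = x * y" using step by (auto simp: products_def)
    show ?case
      by (intro exI[of _ "Suc n"] exI[of _ "X(n := c *\<^sub>C x)"] exI[of _ "Y(n := y)"])
        (use XY xy in \<open>auto simp: mems mult_scaleC_left add.commute\<close>)
  qed
  then show ?thesis using that by blast
qed

text \<open>Expanding \<open>star p * p\<close> and reordering gives one Gram sum from the even
  parts of the \<open>Y k\<close> with \<open>\<psi>\<close> and one from the odd parts with
  \<open>\<psi>\<close> composed with \<open>\<Theta>\<close>; evenness of \<open>\<rho>\<close>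
  removes the mixed terms. Both sums are nonnegative by \<open>schur_product\<close>, and
  \<open>bd\<close> supplies the continuity that carries this to the closure.\<close>

lemma product_positive:
  assumes d: "I \<inter> J = {}" and lin: "clinear_on (\<A> (I \<union> J)) f"
    and bd: "\<And>x. x \<in> \<A> (I \<union> J) \<Longrightarrow> cmod (f x) \<le> K * norm x"
    and \<psi>: "positive_on (\<A> I) \<psi>" and \<rho>: "positive_on (\<A> J) \<rho>" and even: "even_on a J \<rho>"
    and prod: "\<And>x y. x \<in> \<A> I \<Longrightarrow> y \<in> \<A> J \<Longrightarrow> f (x * y) = \<psi> x * \<rho> y"
  shows "positive_on (\<A> (I \<union> J)) f"
proof -
  let ?S = "\<A> (I \<union> J)" and ?W = "cvec.span (products I J)"
  have sub: "csubspace ?S" by (rule cstar_subalgebra_csubspace[OF subalg])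
  interpret c: positive_functional "\<A> I" \<psi> by (rule positive_functionalI[OF \<psi>])
  interpret r: positive_functional "\<A> J" \<rho> by (rule positive_functionalI[OF \<rho>])
  have "positive_on (\<A> I) (\<lambda>x. \<psi> (\<Theta> x))"
    by (rule positive_onI)
      (use c.self_nonneg[OF parity_mem] in \<open>auto simp: parity c.linD mems parity_mem\<close>)
  then have c': "positive_functional (\<A> I) (\<lambda>x. \<psi> (\<Theta> x))" by (rule positive_functionalI)
  note vanish = odd_vanish[OF even \<rho>]
  have W: "f (star p * p) \<in> \<real>\<^sub>\<ge>\<^sub>0" if p: "p \<in> ?W" for p
  proof -
    obtain n :: nat and X Y where XY: "\<And>k. X k \<in> \<A> I" "\<And>k. Y k \<in> \<A> J" "p = (\<Sum>k<n. X k * Y k)"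
      using products_span_cases[OF p] by metis
    have kl: "f (star (X k * Y k) * (X l * Y l)) =
        \<psi> (star (X k) * X l) * \<rho> (star (ev (Y k)) * ev (Y l)) +
        \<psi> (\<Theta> (star (X k) * X l)) * \<rho> (star (od (Y k)) * od (Y l))" for k l
    proof -
      let ?z = "star (X k) * X l"
      have z: "?z \<in> \<A> I" using XY by (simp add: mems)
      have "star (X k * Y k) * (X l * Y l) = star (Y k) * ?z * Y l"
        by (simp add: star_mult mult.assoc)
      also have "\<dots> = ?z * (star (ev (Y k)) * Y l) + \<Theta> ?z * (star (od (Y k)) * Y l)"
        by (rule star_sandwich[OF d z XY(2) XY(2)])
      finally have "f (star (X k * Y k) * (X l * Y l)) =
          \<psi> ?z * \<rho> (star (ev (Y k)) * Y l) + \<psi> (\<Theta> ?z) * \<rho> (star (od (Y k)) * Y l)"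
        using z XY(2)[of k] XY(2)[of l]
        by (simp add: clinear_on_add[OF lin sub] prod mem_union mems ev_mem od_mem parity_mem)
      moreover have "\<rho> (star (ev (Y k)) * Y l) = \<rho> (star (ev (Y k)) * ev (Y l))"
      proof -
        have "\<rho> (star (ev (Y k)) * od (Y l)) = 0"
          by (rule vanish) (use XY(2) in \<open>auto simp: mems ev_mem od_mem parity parity_ev parity_od\<close>)
        moreover have "\<rho> (star (ev (Y k)) * Y l) = \<rho> (star (ev (Y k)) * ev (Y l)) + \<rho> (star (ev (Y k)) * od (Y l))"
          using XY(2) by (simp add: ev_od mems ev_mem od_mem flip: r.linD(1) distrib_left)
        ultimately show ?thesis by simp
      qed
      moreover have "\<rho> (star (od (Y k)) * Y l) = \<rho> (star (od (Y k)) * od (Y l))"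
      proof -
        have "\<rho> (star (od (Y k)) * ev (Y l)) = 0"
          by (rule vanish) (use XY(2) in \<open>auto simp: mems ev_mem od_mem parity parity_ev parity_od\<close>)
        moreover have "\<rho> (star (od (Y k)) * Y l) = \<rho> (star (od (Y k)) * ev (Y l)) + \<rho> (star (od (Y k)) * od (Y l))"
          using XY(2) by (simp add: ev_od mems ev_mem od_mem flip: r.linD(1) distrib_left)
        ultimately show ?thesis by simp
      qed
      ultimately show ?thesis by simp
    qed
    have "star p * p = (\<Sum>k<n. \<Sum>l<n. star (X k * Y k) * (X l * Y l))"
      by (simp only: XY(3) star_sum sum_product)
    moreover have "star (X k * Y k) * (X l * Y l) \<in> ?S" for k l
      using XY by (simp add: mem_union mems)
    ultimately have "f (star p * p) = (\<Sum>k<n. \<Sum>l<n. f (star (X k * Y k) * (X l * Y l)))"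
      by (simp add: clinear_on_sum[OF lin sub] csubspace_sum[OF sub])
    also have "\<dots> = (\<Sum>k<n. \<Sum>l<n. \<psi> (star (X k) * X l) * \<rho> (star (ev (Y k)) * ev (Y l))) +
        (\<Sum>k<n. \<Sum>l<n. \<psi> (\<Theta> (star (X k) * X l)) * \<rho> (star (od (Y k)) * od (Y l)))"
      by (simp only: kl sum.distrib)
    also have "\<dots> \<in> \<real>\<^sub>\<ge>\<^sub>0"
      by (intro nonneg_Reals_add_I schur_product[OF c.positive_functional_axioms r.positive_functional_axioms]
          schur_product[OF c' r.positive_functional_axioms])
        (use XY in \<open>auto simp: ev_mem od_mem\<close>)
    finally show ?thesis .
  qed
  have cont: "continuous_on ?S f" by (rule continuous_on_bounded_functional[OF sub lin bd])
  have "continuous_on ?S (\<lambda>x. f (star x * x))"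
    by (rule continuous_on_compose2[OF cont]) (auto intro!: continuous_intros simp: mems)
  then have "closed (?S \<inter> (\<lambda>x. f (star x * x)) -` \<real>\<^sub>\<ge>\<^sub>0)"
    by (rule continuous_closed_preimage) (simp_all add: cstar_subalgebra_closed[OF subalg])
  moreover have "?W \<subseteq> ?S" using products_dense[OF d] closure_subset by blast
  ultimately have "closure ?W \<subseteq> ?S \<inter> (\<lambda>x. f (star x * x)) -` \<real>\<^sub>\<ge>\<^sub>0"
    using W by (intro closure_minimal) auto
  then show ?thesis using lin by (auto simp: positive_on_def products_dense[OF d])
qed

lemma marginal_pure:
  assumes d: "I \<inter> J = {}" and pure: "pure_state_on (\<A> (I \<union> J)) \<phi>"
    and prod: "\<And>x y. x \<in> \<A> I \<Longrightarrow> y \<in> \<A> J \<Longrightarrow> \<phi> (x * y) = \<phi> x * \<phi> y"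
    and even: "even_on a J \<phi>"
  shows "pure_state_on (\<A> I) \<phi>"
proof (rule pureI[OF subalg])
  have st: "state_on (\<A> (I \<union> J)) \<phi>" using pure by (simp add: pure_state_on_def)
  have sub: "\<A> I \<subseteq> \<A> (I \<union> J)" "\<A> J \<subseteq> \<A> (I \<union> J)" by (simp_all add: subalg_mono)
  show "state_on (\<A> I) \<phi>" by (rule state_on_subset[OF st sub(1)])
  have p: "positive_on (\<A> (I \<union> J)) \<phi>" using st by (simp add: state_on_iff)
  note pI = positive_on_subset[OF p sub(1)] and pJ = positive_on_subset[OF p sub(2)]
  interpret p: positive_functional "\<A> (I \<union> J)" \<phi> by (rule positive_functionalI[OF p])
  interpret q: positive_functional "\<A> I" \<phi> by (rule positive_functionalI[OF pI])
  fix \<omega> x assume \<omega>: "positive_on (\<A> I) \<omega>" and dom: "dominated_on (\<A> I) \<omega> \<phi>" and x: "x \<in> \<A> I"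
  interpret w: positive_functional "\<A> I" \<omega> by (rule positive_functionalI[OF \<omega>])
  \<comment> \<open>Domination bounds \<open>\<omega>\<close> by the seminorm of
    \<open>\<phi>\<close>, so the Riesz sequence can be taken for the form of \<open>\<phi>\<close>,
    which lives on the joint algebra as well.\<close>
  have "cmod (\<omega> y) \<le> gns_norm \<omega> 1 * gns_norm \<phi> y" if y: "y \<in> \<A> I" for y
  proof -
    have "cmod (\<omega> y) \<le> gns_norm \<omega> 1 * gns_norm \<omega> y" using w.gns_cs[of 1 y] y by (simp add: mems)
    also have "\<dots> \<le> gns_norm \<omega> 1 * gns_norm \<phi> y"
      using gns_norm_dominated[OF dom y] w.gns_nonneg[OF mem_one] by (rule mult_left_mono)
    finally show ?thesis .
  qed
  then obtain C where C: "q.sp.scauchy C" and lim: "\<And>y. y \<in> \<A> I \<Longrightarrow> (\<lambda>n. \<phi> (star (C n) * y)) \<longlonglongrightarrow> \<omega> y"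
    using q.sp.riesz[OF w.lin, of "gns_norm \<omega> 1"] by (auto simp: q.sn_eq)
  have CI: "C n \<in> \<A> I" for n using C by (simp add: q.sp.scauchy_def)
  have "gns_cauchy (\<A> (I \<union> J)) \<phi> C"
    using C gns_cauchy_subset[OF _ sub(1)] by (simp add: q.gns_cauchy_iff)
  then obtain f K where f: "clinear_on (\<A> (I \<union> J)) f"
    "\<And>y. y \<in> \<A> (I \<union> J) \<Longrightarrow> (\<lambda>n. \<phi> (star (C n) * y)) \<longlonglongrightarrow> f y"
    "\<And>y. y \<in> \<A> (I \<union> J) \<Longrightarrow> cmod (f y) \<le> K * norm y"
    using p.limit_functional by blast
  have fI: "f y = \<omega> y" if "y \<in> \<A> I" for y
    using LIMSEQ_unique[OF f(2) lim] that by (simp add: mem_union)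
  have fp: "f (y * z) = \<omega> y * \<phi> z" if y: "y \<in> \<A> I" and z: "z \<in> \<A> J" for y z
  proof (rule LIMSEQ_unique[OF f(2)])
    have "\<phi> (star (C n) * (y * z)) = \<phi> (star (C n) * y) * \<phi> z" for n
      using prod[of "star (C n) * y" z] y z CI by (simp add: mems mult.assoc)
    then show "(\<lambda>n. \<phi> (star (C n) * (y * z))) \<longlonglongrightarrow> \<omega> y * \<phi> z"
      by (simp add: tendsto_mult_right lim y)
  qed (use y z in \<open>simp add: mem_union mems\<close>)
  have pos: "positive_on (\<A> (I \<union> J)) f"
    by (rule product_positive[OF d f(1,3) \<omega> pJ even fp])
  \<comment> \<open>That \<open>f\<close> lies below \<open>\<phi>\<close> is again positivity of a
    product: the difference has the factor \<open>\<phi> - \<omega>\<close> on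
    \<open>\<A> I\<close>, positive by domination.\<close>
  have pos': "positive_on (\<A> (I \<union> J)) (\<lambda>y. \<phi> y - f y)"
  proof (rule product_positive[OF d])
    show "clinear_on (\<A> (I \<union> J)) (\<lambda>y. \<phi> y - f y)"
      using f(1) p.lin by (auto simp: clinear_on_def algebra_simps)
    show "cmod (\<phi> y - f y) \<le> (Re (\<phi> 1) + K) * norm y" if "y \<in> \<A> (I \<union> J)" for y
      using norm_triangle_ineq4[of "\<phi> y" "f y"] p.bounded[OF that] f(3)[OF that]
      by (simp add: distrib_right)
    show "positive_on (\<A> I) (\<lambda>y. \<phi> y - \<omega> y)" by (rule positive_on_diff[OF \<omega> pI dom])
    show "\<phi> (y * z) - f (y * z) = (\<phi> y - \<omega> y) * \<phi> z" if "y \<in> \<A> I" "z \<in> \<A> J" for y z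
      using that by (simp add: prod fp left_diff_distrib)
  qed (rule pJ even)+
  have "f x = f 1 * \<phi> x"
  proof (rule pure_dominated[OF subalg pure pos])
    show "Re (f (star y * y)) \<le> 1 * Re (\<phi> (star y * y))" if "y \<in> \<A> (I \<union> J)" for y
      using pos' that by (auto simp: positive_on_def nonneg_Reals_iff)
  qed (use x in \<open>simp add: mem_union\<close>)
  then show "\<omega> x = \<omega> 1 * \<phi> x" using fI x mem_one by simp
qed

end

section \<open>Hilbert spaces and GNS representations\<close>

lemma cinner_add_left: "cinner (x + y) z = cinner x z + cinner y (z::'h::chilbert_space)"
  by (metis cinner_add_right cinner_commute complex_cnj_add)

lemma cinner_scaleC_left: "cinner (c *\<^sub>C x) y = cnj c * cinner x (y::'h::chilbert_space)"
  by (metis cinner_scaleC_right cinner_commute complex_cnj_mult)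

lemma cinner_minus: "cinner (- x) y = - cinner x y" "cinner x (- y) = - cinner x (y::'h::chilbert_space)"
  using cinner_scaleC_left[of "-1" x y] cinner_scaleC_right[of x "-1" y] by simp_all

lemma cinner_diff: "cinner (x - z) y = cinner x y - cinner z y"
  "cinner x (y - z) = cinner x y - cinner x (z::'h::chilbert_space)"
  using cinner_add_left[of x "-z" y] cinner_add_right[of x y "-z"] by (simp_all add: cinner_minus)

lemma cinner_zero [simp]: "cinner 0 y = 0" "cinner y (0::'h::chilbert_space) = 0"
  using cinner_scaleC_left[of 0 0 y] cinner_scaleC_right[of y 0 0] by simp_all

lemma cinner_semi_inner: "csubspace M \<Longrightarrow> semi_inner M (cinner :: 'h::chilbert_space \<Rightarrow> 'h \<Rightarrow> complex)"
  by unfold_locales (simp_all add: cinner_add_right cinner_scaleC_right cinner_self, rule cinner_commute)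

lemma csubspace_UNIV: "csubspace UNIV" by (simp add: csubspace_def)

lemma cinner_sn: "csubspace (M :: 'h set) \<Longrightarrow> semi_inner.sn cinner (x::'h::chilbert_space) = norm x"
  using semi_inner.sn_def[OF cinner_semi_inner, of M x] by (simp add: cinner_self)

lemma norm_cinner_le: "cmod (cinner x y) \<le> norm x * norm (y::'h::chilbert_space)"
  using semi_inner.cauchy_schwarz[OF cinner_semi_inner[OF csubspace_UNIV], of x y]
  by (simp add: cinner_sn[OF csubspace_UNIV])

lemma bounded_bilinear_cinner: "bounded_bilinear (cinner :: 'h::chilbert_space \<Rightarrow> 'h \<Rightarrow> complex)"
proof
  show "\<exists>K. \<forall>a b::'h. cmod (cinner a b) \<le> norm a * norm b * K"
    using norm_cinner_le by (intro exI[of _ 1]) auto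
qed (simp_all add: cinner_add_left cinner_add_right scaleR_scaleC cinner_scaleC_left
    cinner_scaleC_right)

lemmas tendsto_cinner [tendsto_intros] = bounded_bilinear.tendsto[OF bounded_bilinear_cinner]

text \<open>The Riesz lemma for \<open>cinner z\<close> on \<open>M\<close>; completeness turns its
  sequence into a vector, the orthogonal projection of \<open>z\<close> onto
  \<open>M\<close>.\<close>

lemma projection_exists:
  fixes M :: "'h::chilbert_space set"
  assumes M: "closed_csubspace M"
  obtains q where "q \<in> M" "\<And>y. y \<in> M \<Longrightarrow> cinner q y = cinner z y"
proof -
  have M': "csubspace M" and cl: "closed M" using M by (simp_all add: closed_csubspace_iff)
  interpret semi_inner M cinner by (rule cinner_semi_inner[OF M'])
  have sn: "sn x = norm x" for x by (rule cinner_sn[OF M'])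
  have "clinear_on M (cinner z)" by (simp add: clinear_on_def cinner_add_right cinner_scaleC_right)
  then obtain C where C: "scauchy C" "\<And>y. y \<in> M \<Longrightarrow> (\<lambda>n. cinner (C n) y) \<longlonglongrightarrow> cinner z y"
    using riesz[of "cinner z" "norm z"] norm_cinner_le by (auto simp: sn)
  have CM: "C n \<in> M" for n using C(1) by (simp add: scauchy_def)
  have "Cauchy C"
    using C(1) by (intro metric_CauchyI) (auto simp: scauchy_def sn dist_norm)
  then obtain q where q: "C \<longlonglongrightarrow> q" by (auto simp: Cauchy_convergent_iff convergent_def)
  have "q \<in> M" by (rule closed_sequentially[OF cl CM q])
  moreover have "cinner q y = cinner z y" if "y \<in> M" for y
    by (rule LIMSEQ_unique[OF _ C(2)[OF that]]) (intro tendsto_intros q)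
  ultimately show ?thesis using that by blast
qed

section \<open>Vectors in a given GNS representation\<close>

locale gns =
  fixes S :: "'a::cstar_algebra set" and f :: "'a \<Rightarrow> complex"
    and H :: "'h::chilbert_space set" and \<pi> :: "'a \<Rightarrow> 'h \<Rightarrow> 'h" and \<Omega> :: 'h
  assumes alg: "cstar_subalgebra S" and triple: "gns_triple S f H \<pi> \<Omega>"
begin

lemmas algD = cstar_subalgebraD(3-5)[OF alg] csubspaceD[OF cstar_subalgebra_csubspace[OF alg]]

lemma H: "csubspace H" "closed H"
  using triple by (auto simp: gns_triple_def representation_on_def closed_csubspace_iff)

lemmas HD = csubspaceD[OF H(1)]

lemma \<Omega>: "\<Omega> \<in> H" using triple by (simp add: gns_triple_def)

lemma
  shows mem: "x \<in> S \<Longrightarrow> \<xi> \<in> H \<Longrightarrow> \<pi> x \<xi> \<in> H"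
    and one: "\<xi> \<in> H \<Longrightarrow> \<pi> 1 \<xi> = \<xi>"
    and mult: "x \<in> S \<Longrightarrow> y \<in> S \<Longrightarrow> \<xi> \<in> H \<Longrightarrow> \<pi> (x * y) \<xi> = \<pi> x (\<pi> y \<xi>)"
    and adj: "x \<in> S \<Longrightarrow> \<xi> \<in> H \<Longrightarrow> \<eta> \<in> H \<Longrightarrow> cinner (\<pi> (star x) \<xi>) \<eta> = cinner \<xi> (\<pi> x \<eta>)"
  using triple by (auto simp: gns_triple_def representation_on_def)

lemma rep_lin: "x \<in> S \<Longrightarrow> clinear_on H (\<pi> x)" "\<xi> \<in> H \<Longrightarrow> clinear_on S (\<lambda>x. \<pi> x \<xi>)"
  using triple by (auto simp: gns_triple_def representation_on_def)

lemmas op = clinear_onD[OF rep_lin(1) H(1)]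
lemmas alg_op = clinear_onD[OF rep_lin(2) cstar_subalgebra_csubspace[OF alg]]

lemma adj': "x \<in> S \<Longrightarrow> \<xi> \<in> H \<Longrightarrow> \<eta> \<in> H \<Longrightarrow> cinner (\<pi> x \<xi>) \<eta> = cinner \<xi> (\<pi> (star x) \<eta>)"
  using adj[of "star x" \<xi> \<eta>] by (simp add: algD star_star)

lemma f_eq: "x \<in> S \<Longrightarrow> f x = cinner \<Omega> (\<pi> x \<Omega>)"
  using triple by (simp add: gns_triple_def)

lemma op_tendsto:
  assumes x: "x \<in> S" and u: "\<And>n. u n \<in> H" "u \<longlonglongrightarrow> \<xi>"
  shows "(\<lambda>n. \<pi> x (u n)) \<longlonglongrightarrow> \<pi> x \<xi>"
proof -
  have \<xi>: "\<xi> \<in> H" by (rule closed_sequentially[OF H(2) u])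
  obtain C where C: "\<And>\<xi>. \<xi> \<in> H \<Longrightarrow> norm (\<pi> x \<xi>) \<le> C * norm \<xi>"
  proof -
    have "representation_on S H \<pi>" using triple by (simp add: gns_triple_def)
    then have "\<exists>C. \<forall>\<xi>\<in>H. norm (\<pi> x \<xi>) \<le> C * norm \<xi>" using x by (simp add: representation_on_def)
    then show ?thesis using that by blast
  qed
  have bd: "norm (\<pi> x (u n) - \<pi> x \<xi>) \<le> norm (u n - \<xi>) * C" for n
    using C[of "u n - \<xi>"] u(1)[of n] \<xi> by (simp add: op(5)[OF x, symmetric] HD mult.commute)
  have "(\<lambda>n. norm (u n - \<xi>) * C) \<longlonglongrightarrow> 0"
    using tendsto_mult_left_zero[OF tendsto_norm_zero[OF LIM_zero[OF u(2)]]] .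
  then have "(\<lambda>n. \<pi> x (u n) - \<pi> x \<xi>) \<longlonglongrightarrow> 0"
    by (rule Lim_null_comparison[OF always_eventually[OF allI[OF bd]]])
  then show ?thesis by (rule LIM_zero_cancel)
qed

lemma cyclic:
  assumes "\<xi> \<in> H" obtains C where "\<And>n. C n \<in> S" "(\<lambda>n. \<pi> (C n) \<Omega>) \<longlonglongrightarrow> \<xi>"
proof -
  have "\<xi> \<in> closure ((\<lambda>x. \<pi> x \<Omega>) ` S)" using triple assms by (simp add: gns_triple_def)
  then obtain u where u: "\<And>n. u n \<in> (\<lambda>x. \<pi> x \<Omega>) ` S" "u \<longlonglongrightarrow> \<xi>" by (auto simp: closure_sequential)
  then have "\<forall>n. \<exists>c. c \<in> S \<and> u n = \<pi> c \<Omega>" by auto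
  then obtain C where "\<And>n. C n \<in> S \<and> u n = \<pi> (C n) \<Omega>" by metis
  moreover from this have "u = (\<lambda>n. \<pi> (C n) \<Omega>)" by auto
  ultimately show ?thesis using that u(2) by auto
qed

lemma orthogonal_zero:
  assumes "\<xi> \<in> H" "\<And>x. x \<in> S \<Longrightarrow> cinner \<xi> (\<pi> x \<Omega>) = 0" shows "\<xi> = 0"
proof -
  obtain C where C: "\<And>n. C n \<in> S" "(\<lambda>n. \<pi> (C n) \<Omega>) \<longlonglongrightarrow> \<xi>" using cyclic[OF assms(1)] by blast
  have "(\<lambda>n. cinner \<xi> (\<pi> (C n) \<Omega>)) \<longlonglongrightarrow> cinner \<xi> \<xi>" by (intro tendsto_intros C)
  then have "cinner \<xi> \<xi> = 0" using assms(2) C(1) by (simp add: LIMSEQ_const_iff)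
  then show ?thesis by (simp add: cinner_self)
qed

lemma vector_self:
  assumes "x \<in> S" "\<xi> \<in> H" shows "cinner \<xi> (\<pi> (star x * x) \<xi>) = of_real ((norm (\<pi> x \<xi>))\<^sup>2)"
  using assms by (simp add: mult algD mem adj'[symmetric] cinner_self[symmetric] del: of_real_power)

lemma vector_positive: "\<xi> \<in> H \<Longrightarrow> positive_on S (\<lambda>x. cinner \<xi> (\<pi> x \<xi>))"
  by (rule positive_onI)
    (simp_all add: vector_self alg_op cinner_add_right cinner_scaleC_right del: of_real_power)

lemma gns_norm_vector: "x \<in> S \<Longrightarrow> \<xi> \<in> H \<Longrightarrow> gns_norm (\<lambda>x. cinner \<xi> (\<pi> x \<xi>)) x = norm (\<pi> x \<xi>)"
  by (simp add: gns_norm_def vector_self del: of_real_power)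

lemma f_self: "x \<in> S \<Longrightarrow> f (star x * x) = of_real ((norm (\<pi> x \<Omega>))\<^sup>2)"
  by (simp add: f_eq vector_self \<Omega> algD del: of_real_power)

lemma gns_norm_f: "x \<in> S \<Longrightarrow> gns_norm f x = norm (\<pi> x \<Omega>)"
  by (simp add: gns_norm_def f_self del: of_real_power)

text \<open>The bound says that \<open>\<pi> x \<Omega> \<mapsto> \<pi> x \<xi>\<close> extends to a
  bounded operator in the commutant. In terms of functionals, that of \<open>\<xi>\<close> is
  dominated by \<open>K\<^sup>2\<close> times \<open>f\<close>, so purity makes it a multiple of
  \<open>f\<close>.\<close>

lemma pure_vector:
  assumes pure: "pure_state_on S f" and \<xi>: "\<xi> \<in> H"
    and K: "\<And>x. x \<in> S \<Longrightarrow> norm (\<pi> x \<xi>) \<le> K * norm (\<pi> x \<Omega>)" and x: "x \<in> S"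
  shows "cinner \<xi> (\<pi> x \<xi>) = of_real ((norm \<xi>)\<^sup>2) * f x"
proof -
  have "cinner \<xi> (\<pi> x \<xi>) = cinner \<xi> (\<pi> 1 \<xi>) * f x"
  proof (rule pure_dominated[OF alg pure vector_positive[OF \<xi>] _ x])
    fix y assume y: "y \<in> S"
    have "(norm (\<pi> y \<xi>))\<^sup>2 \<le> (K * norm (\<pi> y \<Omega>))\<^sup>2" by (rule power_mono[OF K[OF y]]) simp
    then show "Re (cinner \<xi> (\<pi> (star y * y) \<xi>)) \<le> K\<^sup>2 * Re (f (star y * y))"
      by (simp add: vector_self f_self y \<xi> power_mult_distrib del: of_real_power)
  qed
  then show ?thesis by (simp add: one \<xi> cinner_self)
qed

text \<open>The vector \<open>q\<close> is the projection of \<open>\<Omega>\<close> onto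
  \<open>M\<close>. By invariance of \<open>M\<close>, \<open>\<pi> x q\<close> is the projection of
  \<open>\<pi> x \<Omega>\<close> and has no larger norm, so \<open>pure_vector\<close> applies. If
  \<open>q\<close> were zero, \<open>M\<close> would be orthogonal to all
  \<open>\<pi> x \<Omega>\<close>, hence zero.\<close>

lemma pure_projection:
  assumes pure: "pure_state_on S f" and M: "closed_csubspace M" "M \<subseteq> H"
    and inv: "\<And>x y. x \<in> S \<Longrightarrow> y \<in> M \<Longrightarrow> \<pi> x y \<in> M" and nz: "M \<noteq> {0}"
  obtains q where "q \<in> M" "q \<noteq> 0" "\<And>y. y \<in> M \<Longrightarrow> cinner q y = cinner \<Omega> y"
    "\<And>x. x \<in> S \<Longrightarrow> cinner q (\<pi> x q) = of_real ((norm q)\<^sup>2) * f x"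
proof -
  obtain q where q: "q \<in> M" "\<And>y. y \<in> M \<Longrightarrow> cinner q y = cinner \<Omega> y"
    using projection_exists[OF M(1), of \<Omega>] by blast
  have qH: "q \<in> H" using q M by auto
  have qc: "cinner y \<Omega> = cinner y q" if "y \<in> M" for y
    using q(2)[OF that] by (metis cinner_commute)
  have le: "norm (\<pi> x q) \<le> 1 * norm (\<pi> x \<Omega>)" if x: "x \<in> S" for x
  proof -
    have "cinner (\<pi> x q) (\<pi> x \<Omega>) = cinner (\<pi> (star x) (\<pi> x q)) \<Omega>"
      using x qH \<Omega> by (simp add: adj mem)
    also have "\<dots> = cinner (\<pi> (star x) (\<pi> x q)) q"
      by (rule qc) (use x q inv in \<open>simp add: algD\<close>)
    also have "\<dots> = cinner (\<pi> x q) (\<pi> x q)" using x qH by (simp add: adj mem)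
    finally have "cmod (cinner (\<pi> x q) (\<pi> x \<Omega>)) = (norm (\<pi> x q))\<^sup>2"
      by (simp only: cinner_self norm_of_real) simp
    then have "norm (\<pi> x q) * norm (\<pi> x q) \<le> norm (\<pi> x q) * norm (\<pi> x \<Omega>)"
      using norm_cinner_le[of "\<pi> x q" "\<pi> x \<Omega>"] by (simp add: power2_eq_square)
    then show ?thesis by (cases "norm (\<pi> x q) = 0") (auto simp: mult_le_cancel_left)
  qed
  have "q \<noteq> 0"
  proof
    assume "q = 0"
    have "y = 0" if y: "y \<in> M" for y
    proof (rule orthogonal_zero)
      show "y \<in> H" using y M by auto
      fix x assume x: "x \<in> S"
      have "cinner y (\<pi> x \<Omega>) = cinner (\<pi> (star x) y) \<Omega>" using x y M \<Omega> by (simp add: adj subsetD)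
      also have "\<dots> = cinner (\<pi> (star x) y) q" by (rule qc) (use x y inv in \<open>simp add: algD\<close>)
      finally show "cinner y (\<pi> x \<Omega>) = 0" using \<open>q = 0\<close> by simp
    qed
    then show False using nz q(1) \<open>q = 0\<close> by auto
  qed
  then show ?thesis using that q pure_vector[OF pure qH le] by blast
qed

text \<open>The projection \<open>q\<close> of \<open>\<Omega>\<close> onto the closed subspace
  generated by \<open>\<xi>\<close> turns out to be a nonzero multiple of \<open>\<Omega>\<close>,
  which therefore lies in that subspace. This is irreducibility for pure states.\<close>

lemma cyclic_vector:
  assumes pure: "pure_state_on S f" and \<xi>: "\<xi> \<in> H" "\<xi> \<noteq> 0"
  obtains E where "\<And>n. E n \<in> S" "(\<lambda>n. \<pi> (E n) \<xi>) \<longlonglongrightarrow> \<Omega>"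
proof -
  let ?R = "(\<lambda>x. \<pi> x \<xi>) ` S"
  let ?M = "closure ?R"
  have R: "csubspace ?R"
    unfolding csubspace_def
  proof (intro conjI ballI allI)
    show "0 \<in> ?R" using alg_op(3)[OF \<xi>(1)] algD(4) by (metis image_eqI)
    show "u + v \<in> ?R" if u: "u \<in> ?R" and v: "v \<in> ?R" for u v
    proof -
      obtain x y where "x \<in> S" "y \<in> S" "u = \<pi> x \<xi>" "v = \<pi> y \<xi>" using u v by auto
      then show ?thesis
        by (intro image_eqI[of _ _ "x + y"]) (simp_all add: alg_op(1)[OF \<xi>(1)] algD)
    qed
    show "c *\<^sub>C u \<in> ?R" if u: "u \<in> ?R" for u c
    proof -
      obtain x where "x \<in> S" "u = \<pi> x \<xi>" using u by auto
      then show ?thesis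
        by (intro image_eqI[of _ _ "c *\<^sub>C x"]) (simp_all add: alg_op(2)[OF \<xi>(1)] algD)
    qed
  qed
  have RH: "?R \<subseteq> H" using mem \<xi> by auto
  then have MH: "?M \<subseteq> H" by (rule closure_minimal) (rule H(2))
  have inv: "\<pi> x y \<in> ?M" if x: "x \<in> S" and y: "y \<in> ?M" for x y
  proof -
    obtain u where u: "\<And>n. u n \<in> ?R" "u \<longlonglongrightarrow> y" using y by (auto simp: closure_sequential)
    have "\<pi> x (u n) \<in> ?R" for n
    proof -
      obtain z where "z \<in> S" "u n = \<pi> z \<xi>" using u(1)[of n] by auto
      then show ?thesis using x \<xi> by (auto simp: mult algD intro!: image_eqI[of _ _ "x * z"])
    qed
    moreover have "(\<lambda>n. \<pi> x (u n)) \<longlonglongrightarrow> \<pi> x y" using u RH x by (intro op_tendsto) auto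
    ultimately show ?thesis by (auto simp: closure_sequential intro!: exI[of _ "\<lambda>n. \<pi> x (u n)"])
  qed
  have "\<xi> \<in> ?R" using one[OF \<xi>(1)] algD(1) by (metis image_eqI)
  then have nz: "?M \<noteq> {0}" using \<xi>(2) closure_subset[of ?R] by auto
  obtain q where q: "q \<in> ?M" "q \<noteq> 0" "\<And>y. y \<in> ?M \<Longrightarrow> cinner q y = cinner \<Omega> y"
    "\<And>x. x \<in> S \<Longrightarrow> cinner q (\<pi> x q) = of_real ((norm q)\<^sup>2) * f x"
    using pure_projection[OF pure csubspace_closure[OF R] MH inv nz] by metis
  have qH: "q \<in> H" using q MH by auto
  \<comment> \<open>The factor comes from
    \<open>cinner q (\<pi> y q) = cinner \<Omega> (\<pi> y q)\<close>, whose left side is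
    \<open>t * f y\<close>.\<close>
  define t where "t = complex_of_real ((norm q)\<^sup>2)"
  have t: "t \<noteq> 0" using q(2) by (simp add: t_def)
  have "q - t *\<^sub>C \<Omega> = 0"
  proof (rule orthogonal_zero)
    show "q - t *\<^sub>C \<Omega> \<in> H" using qH \<Omega> by (simp add: HD)
    fix x assume x: "x \<in> S"
    have "cinner \<Omega> (\<pi> (star x) q) = t * cinner \<Omega> (\<pi> (star x) \<Omega>)"
      using q(3)[OF inv[OF algD(3)[OF x] q(1)]] q(4)[OF algD(3)[OF x]] f_eq[OF algD(3)[OF x]]
      by (simp add: t_def)
    then have "cinner (\<pi> x \<Omega>) q = t * cinner (\<pi> x \<Omega>) \<Omega>"
      using x qH \<Omega> by (simp add: adj')
    then have "cinner q (\<pi> x \<Omega>) = cnj t * cinner \<Omega> (\<pi> x \<Omega>)"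
      by (metis cinner_commute complex_cnj_mult)
    then show "cinner (q - t *\<^sub>C \<Omega>) (\<pi> x \<Omega>) = 0" by (simp add: cinner_diff cinner_scaleC_left)
  qed
  then have "q = t *\<^sub>C \<Omega>" by simp
  then have "\<Omega> = (1 / t) *\<^sub>C q" using t by (simp add: scaleC_scaleC)
  then have "\<Omega> \<in> ?M"
    using csubspace_closure[OF R] q(1) by (metis closed_csubspace_iff csubspace_scale)
  then obtain u where u: "\<And>n. u n \<in> ?R" "u \<longlonglongrightarrow> \<Omega>" by (auto simp: closure_sequential)
  then have "\<forall>n. \<exists>c. c \<in> S \<and> u n = \<pi> c \<xi>" by auto
  then obtain E where E: "\<And>n. E n \<in> S \<and> u n = \<pi> (E n) \<xi>" by metis
  then have "u = (\<lambda>n. \<pi> (E n) \<xi>)" by auto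
  then show ?thesis using that[of E] u(2) E by auto
qed

lemma norm_\<Omega>: "state_on S f \<Longrightarrow> norm \<Omega> = 1"
  using f_self[of 1] by (auto simp: state_on_def algD one \<Omega> power2_eq_1_iff simp del: of_real_power)
    (metis norm_ge_zero not_one_le_zero neg_0_le_iff_le)

text \<open>Every \<open>\<Omega> + c *\<^sub>C \<zeta>\<close> satisfies the bound of
  \<open>pure_vector\<close>; comparing coefficients of \<open>c\<close> makes the mixed functional
  \<open>cinner \<Omega> (\<pi> x \<zeta>)\<close> a multiple of \<open>f\<close> too, which pins
  \<open>\<zeta>\<close> to the line of \<open>\<Omega>\<close>.\<close>

lemma pure_vector_unique:
  assumes pure: "pure_state_on S f" and \<zeta>: "\<zeta> \<in> H" and eq: "\<And>x. x \<in> S \<Longrightarrow> cinner \<zeta> (\<pi> x \<zeta>) = f x"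
  obtains c where "cmod c = 1" "\<zeta> = c *\<^sub>C \<Omega>"
proof -
  have st: "state_on S f" using pure by (simp add: pure_state_on_def)
  have n\<zeta>: "norm (\<pi> x \<zeta>) = norm (\<pi> x \<Omega>)" if x: "x \<in> S" for x
  proof -
    have "of_real ((norm (\<pi> x \<zeta>))\<^sup>2) = (of_real ((norm (\<pi> x \<Omega>))\<^sup>2) :: complex)"
      using vector_self[OF x \<zeta>] f_self[OF x] eq[of "star x * x"] x by (simp add: algD del: of_real_power)
    then show ?thesis by (simp only: of_real_eq_iff) simp
  qed
  define k where "k = cinner \<Omega> \<zeta>"
  have pol: "cinner \<Omega> (\<pi> x \<zeta>) = k * f x" if x: "x \<in> S" for x
  proof -
    define A where "A u v = cinner u (\<pi> x v) - cinner u v * f x" for u v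
    have "A \<Omega> \<Omega> + c * A \<Omega> \<zeta> + cnj c * A \<zeta> \<Omega> + c * cnj c * A \<zeta> \<zeta> = 0" for c
    proof -
      have v: "\<Omega> + c *\<^sub>C \<zeta> \<in> H" using \<Omega> \<zeta> by (simp add: HD)
      have "norm (\<pi> y (\<Omega> + c *\<^sub>C \<zeta>)) \<le> (1 + cmod c) * norm (\<pi> y \<Omega>)" if y: "y \<in> S" for y
        using norm_triangle_ineq[of "\<pi> y \<Omega>" "c *\<^sub>C \<pi> y \<zeta>"] y \<Omega> \<zeta>
        by (simp add: op HD norm_scaleC n\<zeta> distrib_right)
      from pure_vector[OF pure v this x]
      have "A (\<Omega> + c *\<^sub>C \<zeta>) (\<Omega> + c *\<^sub>C \<zeta>) = 0"
        by (simp only: A_def cinner_self) simp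
      then show ?thesis
        using x \<Omega> \<zeta> by (simp add: A_def op HD cinner_add_left cinner_add_right cinner_scaleC_left
            cinner_scaleC_right algebra_simps)
    qed
    then have "A \<Omega> \<zeta> = 0" by (rule polarization_coefficient)
    then show ?thesis by (simp add: A_def k_def)
  qed
  have "\<zeta> - k *\<^sub>C \<Omega> = 0"
  proof (rule orthogonal_zero)
    show "\<zeta> - k *\<^sub>C \<Omega> \<in> H" using \<zeta> \<Omega> by (simp add: HD)
    fix x assume x: "x \<in> S"
    have "cinner (\<pi> x \<Omega>) \<zeta> = k * cinner (\<pi> x \<Omega>) \<Omega>"
      using pol[OF algD(3)[OF x]] f_eq[OF algD(3)[OF x]] x \<Omega> \<zeta> by (simp add: adj')
    then have "cinner \<zeta> (\<pi> x \<Omega>) = cnj k * cinner \<Omega> (\<pi> x \<Omega>)"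
      by (metis cinner_commute complex_cnj_mult)
    then show "cinner (\<zeta> - k *\<^sub>C \<Omega>) (\<pi> x \<Omega>) = 0" by (simp add: cinner_diff cinner_scaleC_left)
  qed
  then have *: "\<zeta> = k *\<^sub>C \<Omega>" by simp
  have "norm \<zeta> = 1" using n\<zeta>[OF algD(1)] norm_\<Omega>[OF st] by (simp add: one \<zeta> \<Omega>)
  then have "cmod k = 1" using * norm_\<Omega>[OF st] by (simp add: norm_scaleC)
  then show ?thesis using that * by blast
qed

end

text \<open>Equal functionals make \<open>\<pi> x \<Omega> \<mapsto> \<rho> x \<Omega>'\<close>
  isometric between dense subspaces. This serves the even case, where a state is compared with its
  composition with the parity.\<close>

lemma gns_unique:
  fixes H :: "'h::chilbert_space set" and K :: "'k::chilbert_space set"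
  assumes alg: "cstar_subalgebra S" and g1: "gns_triple S f H \<pi> \<Omega>" and g2: "gns_triple S g K \<rho> \<Omega>'"
    and eq: "\<And>x. x \<in> S \<Longrightarrow> f x = g x"
  shows "unitarily_equivalent S H \<pi> K \<rho>"
proof -
  interpret h: gns S f H \<pi> \<Omega> using alg g1 by unfold_locales
  interpret k: gns S g K \<rho> \<Omega>' using alg g2 by unfold_locales
  have form: "cinner (\<pi> x \<Omega>) (\<pi> y \<Omega>) = cinner (\<rho> x \<Omega>') (\<rho> y \<Omega>')" if "x \<in> S" "y \<in> S" for x y
    using h.f_eq[of "star x * y"] k.f_eq[of "star x * y"] eq[of "star x * y"] that h.\<Omega> k.\<Omega>
    by (simp add: h.algD h.mult k.mult h.adj' k.adj' h.mem k.mem)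
  have isom: "norm (\<pi> x \<Omega>) = norm (\<rho> x \<Omega>')" if "x \<in> S" for x
    using form[OF that that] by (simp add: cinner_self flip: of_real_power)
  \<comment> \<open>The closure of the graph of
    \<open>\<pi> x \<Omega> \<mapsto> \<rho> x \<Omega>'\<close>. As a relation it involves no
    choice of representatives and treats both spaces alike.\<close>
  define R where "R \<xi> \<eta> \<longleftrightarrow> (\<exists>C. (\<forall>n. C n \<in> S) \<and> (\<lambda>n. \<pi> (C n) \<Omega>) \<longlonglongrightarrow> \<xi> \<and> (\<lambda>n. \<rho> (C n) \<Omega>') \<longlonglongrightarrow> \<eta>)"
    for \<xi> \<eta>
  have mem: "\<xi> \<in> H \<and> \<eta> \<in> K" if r: "R \<xi> \<eta>" for \<xi> \<eta>
  proof -
    obtain C where C: "\<And>n. C n \<in> S" "(\<lambda>n. \<pi> (C n) \<Omega>) \<longlonglongrightarrow> \<xi>" "(\<lambda>n. \<rho> (C n) \<Omega>') \<longlonglongrightarrow> \<eta>"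
      using r unfolding R_def by blast
    show ?thesis
      using closed_sequentially[OF h.H(2) h.mem[OF C(1) h.\<Omega>] C(2)]
        closed_sequentially[OF k.H(2) k.mem[OF C(1) k.\<Omega>] C(3)] by simp
  qed
  have R_inner: "cinner \<xi> \<xi>' = cinner \<eta> \<eta>'" if r: "R \<xi> \<eta>" "R \<xi>' \<eta>'" for \<xi> \<xi>' \<eta> \<eta>'
  proof -
    obtain C C' where C: "\<And>n. C n \<in> S" "(\<lambda>n. \<pi> (C n) \<Omega>) \<longlonglongrightarrow> \<xi>" "(\<lambda>n. \<rho> (C n) \<Omega>') \<longlonglongrightarrow> \<eta>"
      and C': "\<And>n. C' n \<in> S" "(\<lambda>n. \<pi> (C' n) \<Omega>) \<longlonglongrightarrow> \<xi>'" "(\<lambda>n. \<rho> (C' n) \<Omega>') \<longlonglongrightarrow> \<eta>'"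
      using r unfolding R_def by blast
    show ?thesis
      using tendsto_cinner[OF C(2) C'(2)] tendsto_cinner[OF C(3) C'(3)]
      by (simp add: form[OF C(1) C'(1)] LIMSEQ_unique)
  qed
  have dist_eq: "norm (\<eta> - \<eta>') = norm (\<xi> - \<xi>')" if "R \<xi> \<eta>" "R \<xi>' \<eta>'" for \<xi> \<xi>' \<eta> \<eta>'
  proof -
    have "cinner (\<eta> - \<eta>') (\<eta> - \<eta>') = cinner (\<xi> - \<xi>') (\<xi> - \<xi>')"
      using R_inner[OF that(1,1)] R_inner[OF that(1,2)] R_inner[OF that(2,1)] R_inner[OF that(2,2)]
      by (simp add: cinner_diff)
    then show ?thesis by (simp add: cinner_self flip: of_real_power)
  qed
  have R_add: "R (\<xi> + \<xi>') (\<eta> + \<eta>')" if r: "R \<xi> \<eta>" "R \<xi>' \<eta>'" for \<xi> \<xi>' \<eta> \<eta>'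
  proof -
    obtain C C' where C: "\<And>n. C n \<in> S" "(\<lambda>n. \<pi> (C n) \<Omega>) \<longlonglongrightarrow> \<xi>" "(\<lambda>n. \<rho> (C n) \<Omega>') \<longlonglongrightarrow> \<eta>"
      and C': "\<And>n. C' n \<in> S" "(\<lambda>n. \<pi> (C' n) \<Omega>) \<longlonglongrightarrow> \<xi>'" "(\<lambda>n. \<rho> (C' n) \<Omega>') \<longlonglongrightarrow> \<eta>'"
      using r unfolding R_def by blast
    show ?thesis
      unfolding R_def
      by (intro exI[of _ "\<lambda>n. C n + C' n"])
        (use tendsto_add[OF C(2) C'(2)] tendsto_add[OF C(3) C'(3)] C(1) C'(1) in
          \<open>simp add: h.algD h.alg_op h.\<Omega> k.alg_op k.\<Omega>\<close>)
  qed
  have R_scale: "R (c *\<^sub>C \<xi>) (c *\<^sub>C \<eta>)" if r: "R \<xi> \<eta>" for c \<xi> \<eta>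
  proof -
    obtain C where C: "\<And>n. C n \<in> S" "(\<lambda>n. \<pi> (C n) \<Omega>) \<longlonglongrightarrow> \<xi>" "(\<lambda>n. \<rho> (C n) \<Omega>') \<longlonglongrightarrow> \<eta>"
      using r unfolding R_def by blast
    show ?thesis
      unfolding R_def
      by (intro exI[of _ "\<lambda>n. c *\<^sub>C C n"])
        (use tendsto_scaleC[OF C(2), of c] tendsto_scaleC[OF C(3), of c] C(1) in
          \<open>simp add: h.algD h.alg_op h.\<Omega> k.alg_op k.\<Omega>\<close>)
  qed
  have R_op: "R (\<pi> x \<xi>) (\<rho> x \<eta>)" if r: "R \<xi> \<eta>" and x: "x \<in> S" for x \<xi> \<eta>
  proof -
    obtain C where C: "\<And>n. C n \<in> S" "(\<lambda>n. \<pi> (C n) \<Omega>) \<longlonglongrightarrow> \<xi>" "(\<lambda>n. \<rho> (C n) \<Omega>') \<longlonglongrightarrow> \<eta>"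
      using r unfolding R_def by blast
    show ?thesis
      unfolding R_def
      by (intro exI[of _ "\<lambda>n. x * C n"])
        (use h.op_tendsto[OF x h.mem[OF C(1) h.\<Omega>] C(2)] k.op_tendsto[OF x k.mem[OF C(1) k.\<Omega>] C(3)]
            C(1) x in \<open>simp add: h.algD h.mult k.mult h.\<Omega> k.\<Omega>\<close>)
  qed
  have total: "\<exists>\<eta>. R \<xi> \<eta>" if "\<xi> \<in> H" for \<xi>
  proof -
    obtain C where C: "\<And>n. C n \<in> S" "(\<lambda>n. \<pi> (C n) \<Omega>) \<longlonglongrightarrow> \<xi>" using h.cyclic[OF \<open>\<xi> \<in> H\<close>] by blast
    have "norm (\<rho> (C m) \<Omega>' - \<rho> (C n) \<Omega>') = norm (\<pi> (C m) \<Omega> - \<pi> (C n) \<Omega>)" for m n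
      using isom[of "C m - C n"] C(1) by (simp add: h.algD h.alg_op h.\<Omega> k.alg_op k.\<Omega>)
    then have "Cauchy (\<lambda>n. \<rho> (C n) \<Omega>')"
      using LIMSEQ_imp_Cauchy[OF C(2)] by (simp add: Cauchy_def dist_norm)
    then obtain \<eta> where "(\<lambda>n. \<rho> (C n) \<Omega>') \<longlonglongrightarrow> \<eta>" by (auto simp: Cauchy_convergent_iff convergent_def)
    then show ?thesis using C unfolding R_def by blast
  qed
  have total': "\<exists>\<xi>. R \<xi> \<eta>" if "\<eta> \<in> K" for \<eta>
  proof -
    obtain C where C: "\<And>n. C n \<in> S" "(\<lambda>n. \<rho> (C n) \<Omega>') \<longlonglongrightarrow> \<eta>" using k.cyclic[OF \<open>\<eta> \<in> K\<close>] by blast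
    have "norm (\<rho> (C m) \<Omega>' - \<rho> (C n) \<Omega>') = norm (\<pi> (C m) \<Omega> - \<pi> (C n) \<Omega>)" for m n
      using isom[of "C m - C n"] C(1) by (simp add: h.algD h.alg_op h.\<Omega> k.alg_op k.\<Omega>)
    then have "Cauchy (\<lambda>n. \<pi> (C n) \<Omega>)"
      using LIMSEQ_imp_Cauchy[OF C(2)] by (simp add: Cauchy_def dist_norm)
    then obtain \<xi> where "(\<lambda>n. \<pi> (C n) \<Omega>) \<longlonglongrightarrow> \<xi>" by (auto simp: Cauchy_convergent_iff convergent_def)
    then show ?thesis using C unfolding R_def by blast
  qed
  define U where "U \<xi> = (SOME \<eta>. R \<xi> \<eta>)" for \<xi>
  have U: "R \<xi> (U \<xi>)" if "\<xi> \<in> H" for \<xi> unfolding U_def by (rule someI_ex[OF total[OF that]])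
  have U_eq: "U \<xi> = \<eta>" if "R \<xi> \<eta>" for \<xi> \<eta>
    using dist_eq[OF U[of \<xi>] that] mem[OF that] by simp
  have "clinear_on H U"
    by (auto simp: clinear_on_def intro!: U_eq R_add R_scale U)
  moreover have "bij_betw U H K"
    unfolding bij_betw_def
  proof
    show "inj_on U H"
    proof (rule inj_onI)
      fix \<xi> \<xi>' assume a: "\<xi> \<in> H" "\<xi>' \<in> H" "U \<xi> = U \<xi>'"
      show "\<xi> = \<xi>'" using dist_eq[OF U[OF a(1)] U[OF a(2)]] a(3) by simp
    qed
    show "U ` H = K"
    proof
      show "U ` H \<subseteq> K" using mem U by blast
      show "K \<subseteq> U ` H" using total' U_eq mem by (metis image_eqI subsetI)
    qed
  qed
  moreover have "cinner (U \<xi>) (U \<eta>) = cinner \<xi> \<eta>" if "\<xi> \<in> H" "\<eta> \<in> H" for \<xi> \<eta>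
    using R_inner[OF U[OF that(1)] U[OF that(2)]] by simp
  moreover have "U (\<pi> x \<xi>) = \<rho> x (U \<xi>)" if "x \<in> S" "\<xi> \<in> H" for x \<xi>
    using U_eq R_op U that by blast
  ultimately show ?thesis unfolding unitarily_equivalent_def by blast
qed

lemma state_on_cong:
  assumes S: "cstar_subalgebra S" and eq: "\<And>x. x \<in> S \<Longrightarrow> f x = g x"
  shows "state_on S f \<longleftrightarrow> state_on S g"
  using cstar_subalgebraD(3-5)[OF S] csubspaceD(2,3)[OF cstar_subalgebra_csubspace[OF S]] eq
  by (simp add: state_on_def clinear_on_def)

lemma pure_state_on_cong:
  assumes S: "cstar_subalgebra S" and eq: "\<And>x. x \<in> S \<Longrightarrow> f x = g x"
  shows "pure_state_on S f \<longleftrightarrow> pure_state_on S g"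
  using state_on_cong[OF assms] eq by (simp add: pure_state_on_def)

context car
begin

section \<open>Even vectors\<close>

lemma positive_parity:
  assumes "positive_on (\<A> I) \<omega>" shows "positive_on (\<A> I) (\<lambda>x. \<omega> (\<Theta> x))"
proof -
  interpret positive_functional "\<A> I" \<omega> by (rule positive_functionalI[OF assms])
  show ?thesis
    by (rule positive_onI)
      (use self_nonneg[OF parity_mem] in \<open>auto simp: parity linD mems parity_mem\<close>)
qed

lemma pure_parity:
  assumes pure: "pure_state_on (\<A> I) f" shows "pure_state_on (\<A> I) (f \<circ> \<Theta>)"
proof (rule pureI[OF subalg])
  have f: "positive_on (\<A> I) f" "f 1 = 1" using pure by (auto simp: pure_state_on_def state_on_iff)
  show "state_on (\<A> I) (f \<circ> \<Theta>)"
    using positive_parity[OF f(1)] f(2) by (simp add: state_on_iff comp_def parity_one)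
  fix \<omega> x assume \<omega>: "positive_on (\<A> I) \<omega>" and dom: "dominated_on (\<A> I) \<omega> (f \<circ> \<Theta>)" and x: "x \<in> \<A> I"
  have "\<omega> (\<Theta> (\<Theta> x)) = \<omega> (\<Theta> 1) * f (\<Theta> x)"
  proof (rule pure_dominated[OF subalg pure positive_parity[OF \<omega>] _ parity_mem[OF x]])
    fix y assume y: "y \<in> \<A> I"
    have "Re (\<omega> (star (\<Theta> y) * \<Theta> y)) \<le> Re ((f \<circ> \<Theta>) (star (\<Theta> y) * \<Theta> y))"
      using dom parity_mem[OF y] unfolding dominated_on_def by blast
    then show "Re (\<omega> (\<Theta> (star y * y))) \<le> 1 * Re (f (star y * y))"
      by (simp add: parity parity_parity)
  qed
  then show "\<omega> x = \<omega> 1 * (f \<circ> \<Theta>) x" by (simp add: parity_parity parity_one)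
qed

text \<open>Inside the common subrepresentation, \<open>pure_projection\<close> for the pure state
  \<open>f \<circ> \<Theta>\<close> finds a vector inducing a multiple of it; the intertwiner
  carries this vector back into \<open>H\<close>, where it is normalised.\<close>

lemma nondisjoint_vector:
  fixes H :: "'h::chilbert_space set" and H' :: "'k::chilbert_space set"
  assumes g1: "gns_triple (\<A> I) f H \<pi> \<Omega>" and g2: "gns_triple (\<A> I) (f \<circ> \<Theta>) H' \<pi>' \<Omega>'"
    and pure: "pure_state_on (\<A> I) f" and nd: "\<not> disjoint_representations (\<A> I) H \<pi> H' \<pi>'"
  obtains \<xi> where "\<xi> \<in> H" "\<And>x. x \<in> \<A> I \<Longrightarrow> cinner \<xi> (\<pi> x \<xi>) = f (\<Theta> x)"
proof -
  interpret h: gns "\<A> I" f H \<pi> \<Omega> using subalg g1 by unfold_locales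
  interpret k: gns "\<A> I" "f \<circ> \<Theta>" H' \<pi>' \<Omega>' using subalg g2 by unfold_locales
  obtain M M' U where M: "subrepresentation (\<A> I) H \<pi> M" and M': "subrepresentation (\<A> I) H' \<pi>' M'" "M' \<noteq> {0}"
    and U: "bij_betw U M M'" "\<And>\<xi> \<eta>. \<xi> \<in> M \<Longrightarrow> \<eta> \<in> M \<Longrightarrow> cinner (U \<xi>) (U \<eta>) = cinner \<xi> \<eta>"
      "\<And>x \<xi>. x \<in> \<A> I \<Longrightarrow> \<xi> \<in> M \<Longrightarrow> U (\<pi> x \<xi>) = \<pi>' x (U \<xi>)"
    using nd unfolding disjoint_representations_def unitarily_equivalent_def by blast
  have inv: "\<pi>' x y \<in> M'" if "x \<in> \<A> I" "y \<in> M'" for x y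
    using M'(1) that by (auto simp: subrepresentation_def)
  have "closed_csubspace M'" "M' \<subseteq> H'" using M'(1) by (auto simp: subrepresentation_def)
  then obtain q where q: "q \<in> M'" "q \<noteq> 0"
    "\<And>x. x \<in> \<A> I \<Longrightarrow> cinner q (\<pi>' x q) = of_real ((norm q)\<^sup>2) * (f \<circ> \<Theta>) x"
    using k.pure_projection[OF pure_parity[OF pure] _ _ inv M'(2)] by metis
  obtain p where p: "p \<in> M" "U p = q" using U(1) q(1) by (auto simp: bij_betw_def)
  have pH: "p \<in> H" and pM: "\<And>x. x \<in> \<A> I \<Longrightarrow> \<pi> x p \<in> M"
    using M p(1) by (auto simp: subrepresentation_def)
  define r where "r = complex_of_real (1 / norm q)"
  have "r *\<^sub>C p \<in> H" using pH by (simp add: h.HD)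
  moreover have "cinner (r *\<^sub>C p) (\<pi> x (r *\<^sub>C p)) = f (\<Theta> x)" if x: "x \<in> \<A> I" for x
  proof -
    have "cinner p (\<pi> x p) = cinner q (\<pi>' x q)"
      using U(2)[OF p(1) pM[OF x]] U(3)[OF x p(1)] p(2) by simp
    then have "cinner (r *\<^sub>C p) (\<pi> x (r *\<^sub>C p)) = (cnj r * r * of_real ((norm q)\<^sup>2)) * f (\<Theta> x)"
      using q(3)[OF x] x pH by (simp add: h.op cinner_scaleC_left cinner_scaleC_right)
    also have "cnj r * r * of_real ((norm q)\<^sup>2) = of_real ((1 / norm q) * (1 / norm q) * (norm q)\<^sup>2)"
      by (simp add: r_def)
    also have "(1 / norm q) * (1 / norm q) * (norm q)\<^sup>2 = 1" using q(2) by (simp add: power2_eq_square)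
    finally show ?thesis by simp
  qed
  ultimately show ?thesis using that by blast
qed

text \<open>The vector \<open>\<xi>\<^sub>0\<close> is the image of \<open>\<Omega>\<close> under a unitary \<open>u\<close> implementing the parity, and
  \<open>\<zeta>\<close> below is \<open>u (u \<Omega>)\<close>. By irreducibility \<open>u\<close> can be normalised to \<open>u\<^sup>2 = 1\<close>; then \<open>\<Omega> + u \<Omega>\<close>
  is invariant under \<open>u\<close>.\<close>

lemma even_vector:
  fixes H :: "'h::chilbert_space set"
  assumes g: "gns_triple (\<A> I) f H \<pi> \<Omega>" and pure: "pure_state_on (\<A> I) f"
    and \<xi>0: "\<xi>\<^sub>0 \<in> H" "\<And>x. x \<in> \<A> I \<Longrightarrow> cinner \<xi>\<^sub>0 (\<pi> x \<xi>\<^sub>0) = f (\<Theta> x)"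
  obtains \<eta> where "\<eta> \<in> H" "norm \<eta> = 1" "\<And>x. x \<in> \<A> I \<Longrightarrow> cinner \<eta> (\<pi> (\<Theta> x) \<eta>) = cinner \<eta> (\<pi> x \<eta>)"
proof -
  interpret h: gns "\<A> I" f H \<pi> \<Omega> using subalg g by unfold_locales
  have st: "state_on (\<A> I) f" using pure by (simp add: pure_state_on_def)
  obtain C where C: "\<And>n. C n \<in> \<A> I" "(\<lambda>n. \<pi> (C n) \<Omega>) \<longlonglongrightarrow> \<xi>\<^sub>0" using h.cyclic[OF \<xi>0(1)] by blast
  \<comment> \<open>With \<open>u\<close> sending \<open>\<pi> y \<Omega>\<close> to
    \<open>\<pi> (\<Theta> y) \<xi>\<^sub>0\<close>, these are the vectors
    \<open>u (\<pi> (C n) \<Omega>)\<close>, which approach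
    \<open>u \<xi>\<^sub>0 = u (u \<Omega>)\<close>.\<close>
  define Z where "Z n = \<pi> (\<Theta> (C n)) \<xi>\<^sub>0" for n
  have ZH: "Z n \<in> H" for n using C(1) \<xi>0(1) by (simp add: Z_def h.mem parity_mem)
  have isom: "norm (\<pi> (\<Theta> x) \<xi>\<^sub>0) = norm (\<pi> x \<Omega>)" if x: "x \<in> \<A> I" for x
  proof -
    have "of_real ((norm (\<pi> (\<Theta> x) \<xi>\<^sub>0))\<^sup>2) = f (\<Theta> (star (\<Theta> x) * \<Theta> x))"
      using h.vector_self[OF parity_mem[OF x] \<xi>0(1)] \<xi>0(2)[of "star (\<Theta> x) * \<Theta> x"] x
      by (simp add: mems parity_mem del: of_real_power)
    also have "\<dots> = of_real ((norm (\<pi> x \<Omega>))\<^sup>2)"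
      using h.f_self[OF x] by (simp add: parity parity_parity del: of_real_power)
    finally show ?thesis by (simp only: of_real_eq_iff) simp
  qed
  have "norm (Z m - Z n) = norm (\<pi> (C m) \<Omega> - \<pi> (C n) \<Omega>)" for m n
    using isom[of "C m - C n"] C(1) \<xi>0(1)
    by (simp add: Z_def parity_diff parity_mem mems h.alg_op h.\<Omega>)
  then have "Cauchy Z"
    using LIMSEQ_imp_Cauchy[OF C(2)] by (simp add: Cauchy_def dist_norm)
  then obtain \<zeta> where \<zeta>: "Z \<longlonglongrightarrow> \<zeta>" by (auto simp: Cauchy_convergent_iff convergent_def)
  have \<zeta>H: "\<zeta> \<in> H" by (rule closed_sequentially[OF h.H(2) ZH \<zeta>])
  have xZ: "(\<lambda>n. \<pi> x (Z n)) \<longlonglongrightarrow> \<pi> x \<zeta>" if "x \<in> \<A> I" for x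
    by (rule h.op_tendsto[OF that ZH \<zeta>])
  \<comment> \<open>Two applications of \<open>u\<close> undo the parity, so \<open>\<zeta>\<close>
    induces \<open>f\<close> again; uniqueness then gives the phase \<open>c\<close> with
    \<open>u (u \<Omega>) = c *\<^sub>C \<Omega>\<close>.\<close>
  have "cinner \<zeta> (\<pi> x \<zeta>) = f x" if x: "x \<in> \<A> I" for x
  proof (rule LIMSEQ_unique)
    show "(\<lambda>n. cinner (Z n) (\<pi> x (Z n))) \<longlonglongrightarrow> cinner \<zeta> (\<pi> x \<zeta>)" by (intro tendsto_intros \<zeta> xZ x)
    have "cinner (Z n) (\<pi> x (Z n)) = cinner (\<pi> (C n) \<Omega>) (\<pi> (\<Theta> x) (\<pi> (C n) \<Omega>))" for n
    proof -
      have "cinner (Z n) (\<pi> x (Z n)) = cinner \<xi>\<^sub>0 (\<pi> (star (\<Theta> (C n)) * (x * \<Theta> (C n))) \<xi>\<^sub>0)"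
        using C(1) \<xi>0(1) x by (simp add: Z_def h.mult h.adj' parity_mem mems h.mem)
      also have "\<dots> = f (star (C n) * (\<Theta> x * C n))"
        using C(1) x by (simp add: \<xi>0(2) mems parity_mem parity parity_parity)
      also have "\<dots> = cinner (\<pi> (C n) \<Omega>) (\<pi> (\<Theta> x) (\<pi> (C n) \<Omega>))"
        using C(1) x by (simp add: h.f_eq mems parity_mem h.mult h.adj' h.\<Omega> h.mem)
      finally show ?thesis .
    qed
    moreover have "(\<lambda>n. cinner (\<pi> (C n) \<Omega>) (\<pi> (\<Theta> x) (\<pi> (C n) \<Omega>))) \<longlonglongrightarrow> cinner \<xi>\<^sub>0 (\<pi> (\<Theta> x) \<xi>\<^sub>0)"
      by (intro tendsto_intros C h.op_tendsto parity_mem x h.mem h.\<Omega>)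
    ultimately show "(\<lambda>n. cinner (Z n) (\<pi> x (Z n))) \<longlonglongrightarrow> f x"
      using x by (simp add: \<xi>0(2) parity_mem parity_parity)
  qed
  then obtain c where c: "cmod c = 1" "\<zeta> = c *\<^sub>C \<Omega>" using h.pure_vector_unique[OF pure \<zeta>H] by blast
  \<comment> \<open>As \<open>u\<close> is unitary and implements the parity, the left side is
    \<open>\<langle>u \<Omega>, \<pi> (\<Theta> x) (u (u \<Omega>))\<rangle>\<close>.\<close>
  have cross: "cinner \<Omega> (\<pi> x \<xi>\<^sub>0) = c * cinner \<xi>\<^sub>0 (\<pi> (\<Theta> x) \<Omega>)" if x: "x \<in> \<A> I" for x
  proof (rule LIMSEQ_unique)
    show "(\<lambda>n. cinner \<Omega> (\<pi> x (\<pi> (C n) \<Omega>))) \<longlonglongrightarrow> cinner \<Omega> (\<pi> x \<xi>\<^sub>0)"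
      by (intro tendsto_intros h.op_tendsto C x h.mem h.\<Omega>)
    have "cinner \<Omega> (\<pi> x (\<pi> (C n) \<Omega>)) = cinner \<xi>\<^sub>0 (\<pi> (\<Theta> x) (Z n))" for n
    proof -
      have "cinner \<Omega> (\<pi> x (\<pi> (C n) \<Omega>)) = f (x * C n)"
        using C(1) x by (simp add: h.f_eq mems h.mult h.\<Omega>)
      also have "\<dots> = cinner \<xi>\<^sub>0 (\<pi> (\<Theta> x * \<Theta> (C n)) \<xi>\<^sub>0)"
        using C(1) x by (simp add: \<xi>0(2) mems parity_mem parity parity_parity)
      finally show ?thesis using C(1) x \<xi>0(1) by (simp add: Z_def h.mult parity_mem)
    qed
    moreover have "(\<lambda>n. cinner \<xi>\<^sub>0 (\<pi> (\<Theta> x) (Z n))) \<longlonglongrightarrow> cinner \<xi>\<^sub>0 (\<pi> (\<Theta> x) \<zeta>)"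
      by (intro tendsto_intros xZ parity_mem x)
    ultimately show "(\<lambda>n. cinner \<Omega> (\<pi> x (\<pi> (C n) \<Omega>))) \<longlonglongrightarrow> c * cinner \<xi>\<^sub>0 (\<pi> (\<Theta> x) \<Omega>)"
      using x c(2) by (simp add: h.op h.\<Omega> parity_mem cinner_scaleC_right)
  qed
  \<comment> \<open>The multiple \<open>w * u\<close> squares to the identity, since
    \<open>w * w * c = cnj c * c = 1\<close>.\<close>
  define w where "w = csqrt (cnj c)"
  have w2: "w * w = cnj c" by (metis power2_csqrt power2_eq_square w_def)
  have cw: "cmod w = 1"
  proof -
    have "cmod w * cmod w = 1" using w2 c(1) by (metis complex_mod_cnj norm_mult)
    then show ?thesis using norm_ge_zero[of w] by (simp add: square_eq_1_iff)
  qed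
  have ww: "cnj w * w = 1" using cw complex_norm_square[of w] by (simp add: mult.commute)
  have cc: "cnj c * c = 1" using c(1) complex_norm_square[of c] by (simp add: mult.commute)
  have wc: "w * c = cnj w"
  proof -
    have "cnj w * (w * w * c) = cnj w" using cc w2 by simp
    then show ?thesis using ww by (simp add: mult.assoc[symmetric])
  qed
  define \<xi> where "\<xi> = w *\<^sub>C \<xi>\<^sub>0"
  have \<xi>H: "\<xi> \<in> H" using \<xi>0(1) by (simp add: \<xi>_def h.HD)
  have \<xi>v: "cinner \<xi> (\<pi> x \<xi>) = f (\<Theta> x)" if x: "x \<in> \<A> I" for x
  proof -
    have "cinner \<xi> (\<pi> x \<xi>) = (cnj w * w) * cinner \<xi>\<^sub>0 (\<pi> x \<xi>\<^sub>0)"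
      using x \<xi>0(1) by (simp add: \<xi>_def h.op cinner_scaleC_left cinner_scaleC_right)
    then show ?thesis using \<xi>0(2)[OF x] ww by simp
  qed
  have \<xi>c: "cinner \<Omega> (\<pi> x \<xi>) = cinner \<xi> (\<pi> (\<Theta> x) \<Omega>)" if x: "x \<in> \<A> I" for x
  proof -
    have "cinner \<Omega> (\<pi> x \<xi>) = (w * c) * cinner \<xi>\<^sub>0 (\<pi> (\<Theta> x) \<Omega>)"
      using x \<xi>0(1) cross[OF x] by (simp add: \<xi>_def h.op cinner_scaleC_right)
    then show ?thesis by (simp add: wc \<xi>_def cinner_scaleC_left)
  qed
  show ?thesis
  proof (cases "\<Omega> + \<xi> = 0")
    \<comment> \<open>Here \<open>\<Omega>\<close> is an eigenvector for the eigenvalue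
      \<open>-1\<close>, so \<open>f\<close> is already even and \<open>\<Omega>\<close> itself
      serves.\<close>
    case True
    then have "\<xi> = - \<Omega>" by (simp add: add_eq_0_iff)
    then have "f (\<Theta> x) = f x" if "x \<in> \<A> I" for x
      using \<xi>v[OF that] h.f_eq[OF that] that by (simp add: h.op h.\<Omega> cinner_minus)
    then show ?thesis
      using that[OF h.\<Omega> h.norm_\<Omega>[OF st]] by (simp add: h.f_eq[symmetric] parity_mem)
  next
    case False
    define r where "r = complex_of_real (1 / norm (\<Omega> + \<xi>))"
    have v: "\<Omega> + \<xi> \<in> H" using h.\<Omega> \<xi>H by (simp add: h.HD)
    have ex: "cinner (\<Omega> + \<xi>) (\<pi> x (\<Omega> + \<xi>)) = f x + f (\<Theta> x) + cinner \<Omega> (\<pi> x \<xi>) + cinner \<xi> (\<pi> x \<Omega>)"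
      if x: "x \<in> \<A> I" for x
      using x h.\<Omega> \<xi>H h.f_eq[OF x] \<xi>v[OF x] by (simp add: h.op cinner_add_left cinner_add_right)
    have "cinner (\<Omega> + \<xi>) (\<pi> (\<Theta> x) (\<Omega> + \<xi>)) = cinner (\<Omega> + \<xi>) (\<pi> x (\<Omega> + \<xi>))" if x: "x \<in> \<A> I" for x
      using \<xi>c[OF x] \<xi>c[OF parity_mem[OF x]] x by (simp add: ex parity_mem parity_parity)
    moreover have "norm (r *\<^sub>C (\<Omega> + \<xi>)) = 1"
      using False by (simp add: r_def norm_scaleC norm_divide)
    moreover have "r *\<^sub>C (\<Omega> + \<xi>) \<in> H" using v by (simp only: h.HD)
    moreover have "cinner (r *\<^sub>C (\<Omega> + \<xi>)) (\<pi> x (r *\<^sub>C (\<Omega> + \<xi>))) =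
        cnj r * (r * cinner (\<Omega> + \<xi>) (\<pi> x (\<Omega> + \<xi>)))" if "x \<in> \<A> I" for x
      using h.op(2)[OF that v] by (simp only: cinner_scaleC_left cinner_scaleC_right mult.left_commute)
    ultimately show ?thesis using that[of "r *\<^sub>C (\<Omega> + \<xi>)"] parity_mem by metis
  qed
qed

text \<open>\<open>D n \<Omega>\<close> tends to \<open>\<eta>\<close>, and, \<open>\<eta>\<close>
  being cyclic by purity, \<open>E m \<eta>\<close> tends to \<open>\<Omega>\<close>. The two
  approximation statements differ in the order of the limits, one for each direction of
  \<open>pure_transfer\<close>. They mention only seminorms of algebra elements and so survive in a
  larger algebra.\<close>

lemma even_vector_sequences:
  fixes H :: "'h::chilbert_space set"
  assumes g: "gns_triple (\<A> I) f H \<pi> \<Omega>" and pure: "pure_state_on (\<A> I) f"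
    and \<eta>: "\<eta> \<in> H" "norm \<eta> = 1" "\<And>x. x \<in> \<A> I \<Longrightarrow> cinner \<eta> (\<pi> (\<Theta> x) \<eta>) = cinner \<eta> (\<pi> x \<eta>)"
  obtains D E f' where "gns_cauchy (\<A> I) f D" "gns_cauchy (\<A> I) f' E"
    "state_on (\<A> I) f'" "even_on a I f'"
    "\<And>x. x \<in> \<A> I \<Longrightarrow> (\<lambda>n. f (star (D n) * x * D n)) \<longlonglongrightarrow> f' x"
    "\<And>e. 0 < e \<Longrightarrow> \<forall>\<^sub>F m in sequentially. \<forall>\<^sub>F n in sequentially. gns_norm f (E m * D n - 1) < e"
    "\<And>e. 0 < e \<Longrightarrow> \<forall>\<^sub>F n in sequentially. \<forall>\<^sub>F m in sequentially. gns_norm f' (D n * E m - 1) < e"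
proof -
  interpret h: gns "\<A> I" f H \<pi> \<Omega> using subalg g by unfold_locales
  define f' where "f' = (\<lambda>x. cinner \<eta> (\<pi> x \<eta>))"
  have f': "gns_norm f' x = norm (\<pi> x \<eta>)" if "x \<in> \<A> I" for x
    unfolding f'_def by (rule h.gns_norm_vector[OF that \<eta>(1)])
  obtain D where D: "\<And>n. D n \<in> \<A> I" "(\<lambda>n. \<pi> (D n) \<Omega>) \<longlonglongrightarrow> \<eta>" using h.cyclic[OF \<eta>(1)] by blast
  have "\<eta> \<noteq> 0" using \<eta>(2) by auto
  then obtain E where E: "\<And>n. E n \<in> \<A> I" "(\<lambda>n. \<pi> (E n) \<eta>) \<longlonglongrightarrow> \<Omega>"
    using h.cyclic_vector[OF pure \<eta>(1)] by blast
  have cau: "gns_cauchy (\<A> I) k C"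
    if C: "\<And>n. C n \<in> \<A> I" "(\<lambda>n. \<pi> (C n) \<theta>) \<longlonglongrightarrow> \<theta>'" and \<theta>: "\<theta> \<in> H"
      and k: "\<And>x. x \<in> \<A> I \<Longrightarrow> gns_norm k x = norm (\<pi> x \<theta>)" for C k \<theta> \<theta>'
  proof -
    have "gns_norm k (C m - C n) = dist (\<pi> (C m) \<theta>) (\<pi> (C n) \<theta>)" for m n
      using C(1) \<theta> by (simp add: k mems dist_norm h.alg_op)
    then show ?thesis
      using LIMSEQ_imp_Cauchy[OF C(2)] C(1) by (simp add: gns_cauchy_def Cauchy_def)
  qed
  have app: "\<forall>\<^sub>F m in sequentially. \<forall>\<^sub>F n in sequentially. gns_norm k (B m * C n - 1) < e"
    if C: "\<And>n. C n \<in> \<A> I" "(\<lambda>n. \<pi> (C n) \<theta>) \<longlonglongrightarrow> \<theta>'" and \<theta>: "\<theta> \<in> H"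
      and k: "\<And>x. x \<in> \<A> I \<Longrightarrow> gns_norm k x = norm (\<pi> x \<theta>)"
      and B: "\<And>n. B n \<in> \<A> I" "(\<lambda>n. \<pi> (B n) \<theta>') \<longlonglongrightarrow> \<theta>" and e: "0 < e" for B C k \<theta> \<theta>' e
  proof -
    have "(\<lambda>m. norm (\<pi> (B m) \<theta>' - \<theta>)) \<longlonglongrightarrow> norm (\<theta> - \<theta>)" by (intro tendsto_intros B)
    then have "\<forall>\<^sub>F m in sequentially. norm (\<pi> (B m) \<theta>' - \<theta>) < e"
      using order_tendstoD(2) e by fastforce
    then show ?thesis
    proof eventually_elim
      case (elim m)
      have "(\<lambda>n. norm (\<pi> (B m) (\<pi> (C n) \<theta>) - \<theta>)) \<longlonglongrightarrow> norm (\<pi> (B m) \<theta>' - \<theta>)"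
        by (intro tendsto_intros h.op_tendsto B C h.mem \<theta>)
      then have "\<forall>\<^sub>F n in sequentially. norm (\<pi> (B m) (\<pi> (C n) \<theta>) - \<theta>) < e"
        using order_tendstoD(2) elim by blast
      moreover have "gns_norm k (B m * C n - 1) = norm (\<pi> (B m) (\<pi> (C n) \<theta>) - \<theta>)" for n
        using B(1) C(1) \<theta> by (simp add: k mems h.alg_op h.mult h.one)
      ultimately show ?case by simp
    qed
  qed
  have "state_on (\<A> I) f'"
    unfolding state_on_iff f'_def using h.vector_positive[OF \<eta>(1)] \<eta> by (simp add: h.one cinner_self)
  moreover have "even_on a I f'" using \<eta>(3) by (simp add: even_on_def f'_def)
  moreover have "(\<lambda>n. f (star (D n) * x * D n)) \<longlonglongrightarrow> f' x" if x: "x \<in> \<A> I" for x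
  proof -
    have "f (star (D n) * x * D n) = cinner (\<pi> (D n) \<Omega>) (\<pi> x (\<pi> (D n) \<Omega>))" for n
      using D(1) x by (simp add: h.f_eq mems h.mult h.adj' h.\<Omega> h.mem mult.assoc)
    then show ?thesis
      unfolding f'_def by (simp, intro tendsto_intros D h.op_tendsto x h.mem h.\<Omega>)
  qed
  ultimately show ?thesis
    by (intro that[of D f' E] cau[OF D h.\<Omega> h.gns_norm_f] cau[OF E \<eta>(1) f']
        app[OF D h.\<Omega> h.gns_norm_f E] app[OF E \<eta>(1) f' D])
qed

section \<open>Replacing the first marginal by an even one\<close>

lemma even_on_ev:
  assumes even: "even_on a J \<phi>" and p: "positive_on (\<A> J) \<phi>" and y: "y \<in> \<A> J"
  shows "\<phi> (od y) = 0" "\<phi> (ev y) = \<phi> y"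
proof -
  interpret positive_functional "\<A> J" \<phi> by (rule positive_functionalI[OF p])
  show *: "\<phi> (od y) = 0" by (rule odd_vanish[OF even p od_mem[OF y] parity_od])
  have "\<phi> (ev y + od y) = \<phi> (ev y) + \<phi> (od y)" using y by (simp add: linD ev_mem od_mem)
  then show "\<phi> (ev y) = \<phi> y" using * by (simp add: ev_od)
qed

text \<open>Reordering leaves the even part of \<open>y\<close> alone, and the odd part brings the
  factor \<open>\<phi> (od y) = 0\<close>.\<close>

lemma product_swap:
  assumes d: "I \<inter> J = {}" and p: "positive_on (\<A> (I \<union> J)) \<phi>" and even: "even_on a J \<phi>"
    and prod: "\<And>x y. x \<in> \<A> I \<Longrightarrow> y \<in> \<A> J \<Longrightarrow> \<phi> (x * y) = \<phi> x * \<phi> y"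
    and x: "x \<in> \<A> I" and y: "y \<in> \<A> J"
  shows "\<phi> (y * x) = \<phi> y * \<phi> x"
proof -
  interpret positive_functional "\<A> (I \<union> J)" \<phi> by (rule positive_functionalI[OF p])
  have pJ: "positive_on (\<A> J) \<phi>" by (rule positive_on_subset[OF p]) (simp add: subalg_mono)
  show ?thesis
    using x y even_on_ev[OF even pJ y]
    by (simp add: graded_commute[OF x y d] linD mem_union mems ev_mem od_mem parity_mem prod)
qed

lemma even_pair_pure_iff:
  assumes d: "I \<inter> J = {}" and st: "state_on (\<A> (I \<union> J)) \<phi>"
    and prod: "\<And>x y. x \<in> \<A> I \<Longrightarrow> y \<in> \<A> J \<Longrightarrow> \<phi> (x * y) = \<phi> x * \<phi> y"
    and even: "even_on a I \<phi>" "even_on a J \<phi>"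
  shows "pure_state_on (\<A> (I \<union> J)) \<phi> \<longleftrightarrow> pure_state_on (\<A> I) \<phi> \<and> pure_state_on (\<A> J) \<phi>"
proof
  assume pure: "pure_state_on (\<A> (I \<union> J)) \<phi>"
  have p: "positive_on (\<A> (I \<union> J)) \<phi>" using st by (simp add: state_on_iff)
  have d': "J \<inter> I = {}" using d by auto
  have "pure_state_on (\<A> (J \<union> I)) \<phi>" using pure by (simp add: Un_commute)
  then have "pure_state_on (\<A> J) \<phi>"
    using product_swap[OF d p even(2) prod] even(1) by (rule marginal_pure[OF d'])
  then show "pure_state_on (\<A> I) \<phi> \<and> pure_state_on (\<A> J) \<phi>"
    using marginal_pure[OF d pure prod even(2)] by blast
qed (use product_pure[OF d st prod even(1)] in blast)

lemma gns_cauchy_cong: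
  assumes "\<And>x. x \<in> \<A> I \<Longrightarrow> f x = g x" shows "gns_cauchy (\<A> I) f C \<longleftrightarrow> gns_cauchy (\<A> I) g C"
proof -
  have "gns_norm f x = gns_norm g x" if "x \<in> \<A> I" for x
    using assms that by (simp add: gns_norm_def mems)
  then show ?thesis unfolding gns_cauchy_def by (metis mem_sub(5))
qed

text \<open>Because \<open>D\<close> lies in \<open>\<A> I\<close> and \<open>\<phi>\<close> is even
  on \<open>\<A> J\<close>, the functional obtained along \<open>D\<close> on the joint algebra is
  the product of the even state \<open>f'\<close> with \<open>\<phi>\<close> on
  \<open>\<A> J\<close>. Purity passes between \<open>\<phi>\<close> and \<open>\<phi>'\<close> in
  both directions by \<open>pure_transfer\<close>, with \<open>D\<close> and \<open>E\<close>
  trading places.\<close>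

lemma replace_by_even_marginal:
  fixes H :: "'h::chilbert_space set"
  assumes d: "I \<inter> J = {}" and st: "state_on (\<A> (I \<union> J)) \<phi>"
    and prod: "\<And>x y. x \<in> \<A> I \<Longrightarrow> y \<in> \<A> J \<Longrightarrow> \<phi> (x * y) = \<phi> x * \<phi> y"
    and even: "even_on a J \<phi>" and pI: "pure_state_on (\<A> I) \<phi>"
    and g: "gns_triple (\<A> I) \<phi> H \<pi> \<Omega>"
    and \<xi>: "\<xi> \<in> H" "\<And>x. x \<in> \<A> I \<Longrightarrow> cinner \<xi> (\<pi> x \<xi>) = \<phi> (\<Theta> x)"
  obtains \<phi>' where "state_on (\<A> (I \<union> J)) \<phi>'" "even_on a I \<phi>'" "pure_state_on (\<A> I) \<phi>'"
    "\<And>y. y \<in> \<A> J \<Longrightarrow> \<phi>' y = \<phi> y"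
    "\<And>x y. x \<in> \<A> I \<Longrightarrow> y \<in> \<A> J \<Longrightarrow> \<phi>' (x * y) = \<phi>' x * \<phi>' y"
    "pure_state_on (\<A> (I \<union> J)) \<phi>' \<longleftrightarrow> pure_state_on (\<A> (I \<union> J)) \<phi>"
proof -
  let ?S = "\<A> (I \<union> J)"
  have sub: "\<A> I \<subseteq> ?S" "\<A> J \<subseteq> ?S" by (simp_all add: subalg_mono)
  have p: "positive_on ?S \<phi>" using st by (simp add: state_on_iff)
  interpret p: positive_functional ?S \<phi> by (rule positive_functionalI[OF p])
  note pJ = positive_on_subset[OF p sub(2)]
  have stI: "state_on (\<A> I) \<phi>" by (rule state_on_subset[OF st sub(1)])
  obtain \<eta> where \<eta>: "\<eta> \<in> H" "norm \<eta> = 1" "\<And>x. x \<in> \<A> I \<Longrightarrow> cinner \<eta> (\<pi> (\<Theta> x) \<eta>) = cinner \<eta> (\<pi> x \<eta>)"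
    using even_vector[OF g pI \<xi>] by blast
  obtain D E f' where D: "gns_cauchy (\<A> I) \<phi> D" and E: "gns_cauchy (\<A> I) f' E"
    and f': "state_on (\<A> I) f'" "even_on a I f'"
    and lim: "\<And>x. x \<in> \<A> I \<Longrightarrow> (\<lambda>n. \<phi> (star (D n) * x * D n)) \<longlonglongrightarrow> f' x"
    and app: "\<And>e. 0 < e \<Longrightarrow> \<forall>\<^sub>F m in sequentially. \<forall>\<^sub>F n in sequentially. gns_norm \<phi> (E m * D n - 1) < e"
    and app': "\<And>e. 0 < e \<Longrightarrow> \<forall>\<^sub>F n in sequentially. \<forall>\<^sub>F m in sequentially. gns_norm f' (D n * E m - 1) < e"
    by (rule even_vector_sequences[OF g pI \<eta>]) (assumption | rule that)+
  have DI: "D n \<in> \<A> I" and EI: "E n \<in> \<A> I" for n using D E by (auto simp: gns_cauchy_def)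
  have DS: "D n \<in> ?S" and ES: "E n \<in> ?S" for n using DI EI sub by auto
  have D': "gns_cauchy ?S \<phi> D" by (rule gns_cauchy_subset[OF D sub(1)])
  obtain \<phi>' where \<phi>': "positive_on ?S \<phi>'"
    and lim': "\<And>x. x \<in> ?S \<Longrightarrow> (\<lambda>n. \<phi> (star (D n) * x * D n)) \<longlonglongrightarrow> \<phi>' x"
    using p.vector_functional[OF D'] by blast
  have \<phi>'I: "\<phi>' x = f' x" if "x \<in> \<A> I" for x
    using LIMSEQ_unique[OF lim' lim] that sub by auto
  have one: "\<phi>' 1 = 1" using \<phi>'I[OF mem_one] f'(1) by (simp add: state_on_def)
  have st': "state_on ?S \<phi>'" using \<phi>' one by (simp add: state_on_iff)
  have prod': "\<phi>' (x * y) = f' x * \<phi> y" if x: "x \<in> \<A> I" and y: "y \<in> \<A> J" for x y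
  proof (rule LIMSEQ_unique[OF lim'])
    have "\<phi> (star (D n) * (x * y) * D n) = \<phi> (star (D n) * x * D n) * \<phi> y" for n
    proof -
      have "star (D n) * (x * y) * D n = (star (D n) * x) * (y * D n)" by (simp add: mult.assoc)
      \<comment> \<open>Moving \<open>y\<close> past \<open>D n\<close> leaves a term with
        \<open>\<Theta> (D n)\<close>, but that term carries the odd part of \<open>y\<close>, on
        which \<open>\<phi>\<close> vanishes.\<close>
      also have "\<dots> = (star (D n) * x * D n) * ev y + (star (D n) * x * \<Theta> (D n)) * od y"
        unfolding graded_commute[OF DI y d] by (simp add: distrib_left mult.assoc)
      also have "\<phi> \<dots> = \<phi> (star (D n) * x * D n) * \<phi> (ev y) + \<phi> (star (D n) * x * \<Theta> (D n)) * \<phi> (od y)"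
        using x y DI[of n] by (simp add: p.linD mem_union mems ev_mem od_mem parity_mem prod)
      finally show ?thesis using even_on_ev[OF even pJ y] by simp
    qed
    then show "(\<lambda>n. \<phi> (star (D n) * (x * y) * D n)) \<longlonglongrightarrow> f' x * \<phi> y"
      by (simp add: tendsto_mult_right lim x)
  qed (use x y sub in \<open>auto intro: mem_mult\<close>)
  have \<phi>'J: "\<phi>' y = \<phi> y" if "y \<in> \<A> J" for y
    using prod'[OF mem_one that] f'(1) by (simp add: state_on_def)
  have E': "gns_cauchy ?S \<phi>' E"
    using gns_cauchy_subset[OF _ sub(1)] gns_cauchy_cong[of I \<phi>' f' E] \<phi>'I E by simp
  have app'': "\<forall>\<^sub>F n in sequentially. \<forall>\<^sub>F m in sequentially. gns_norm \<phi>' (D n * E m - 1) < e" if "0 < e" for e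
  proof -
    have "gns_norm \<phi>' (D n * E m - 1) = gns_norm f' (D n * E m - 1)" for n m
      using \<phi>'I DI EI by (simp add: gns_norm_def mems)
    then show ?thesis using app'[OF that] by simp
  qed
  have ev_ex: "\<exists>m. P m" if "\<forall>\<^sub>F m in sequentially. P m" for P :: "nat \<Rightarrow> bool"
    using that by (rule eventually_happens'[OF sequentially_bot])
  have "pure_state_on ?S \<phi>" if "pure_state_on ?S \<phi>'"
    by (rule pure_transfer[OF subalg st that D' ES lim' ev_ex[OF app]])
  moreover have "pure_state_on ?S \<phi>'" if "pure_state_on ?S \<phi>"
    by (rule pure_transfer[OF subalg st' that E' DS vector_state_back[OF subalg st D' ES lim' app] ev_ex[OF app'']])
  moreover have "pure_state_on (\<A> I) f'"
    by (rule pure_transfer[OF subalg f'(1) pI E DI vector_state_back[OF subalg stI D EI lim app] ev_ex[OF app']])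
  then have "pure_state_on (\<A> I) \<phi>'" using pure_state_on_cong[OF subalg, of I \<phi>' f'] \<phi>'I by simp
  moreover have "even_on a I \<phi>'" using f'(2) by (simp add: even_on_def \<phi>'I parity_mem)
  ultimately have "pure_state_on ?S \<phi>' \<longleftrightarrow> pure_state_on ?S \<phi>" "even_on a I \<phi>'" "pure_state_on (\<A> I) \<phi>'"
    by blast+
  moreover have "\<phi>' (x * y) = \<phi>' x * \<phi>' y" if "x \<in> \<A> I" "y \<in> \<A> J" for x y
    using that by (simp only: prod' \<phi>'I \<phi>'J)
  ultimately show ?thesis
    by (intro that[of \<phi>'] st' \<phi>'J)
qed

end

section \<open>Sequences of subsystems\<close>

context car
begin

text \<open>The scalars are closed because \<open>c \<mapsto> c *\<^sub>C 1\<close> is isometric and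
  the complex numbers are complete. Empty index sets occur in base cases and as padding for finitely
  many subsystems.\<close>

lemma empty_scalar: "\<A> {} \<subseteq> range (\<lambda>c. c *\<^sub>C 1)"
proof -
  let ?R = "range (\<lambda>c. c *\<^sub>C (1::'a))"
  have "cstar_subalgebra ?R"
  proof (rule cstar_subalgebraI)
    show "x + y \<in> ?R" if "x \<in> ?R" "y \<in> ?R" for x y
      using that by (auto simp flip: scaleC_add_left)
    show "c *\<^sub>C x \<in> ?R" if "x \<in> ?R" for c x using that by (auto simp: scaleC_scaleC)
    show "1 \<in> ?R" by (rule image_eqI[of _ _ 1]) simp_all
    show "x * y \<in> ?R" if "x \<in> ?R" "y \<in> ?R" for x y
      using that by (auto simp: mult_scaleC_left mult_scaleC_right scaleC_scaleC)
    show "star x \<in> ?R" if "x \<in> ?R" for x using that by (auto simp: star_scaleC)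
    show "closed ?R"
      unfolding closed_sequential_limits
    proof (intro allI impI, elim conjE)
      fix u x assume u: "\<forall>n. u n \<in> ?R" and x: "u \<longlonglongrightarrow> x"
      then have "\<forall>n. \<exists>c. u n = c *\<^sub>C 1" by auto
      then obtain c where c: "\<And>n. u n = c n *\<^sub>C 1" by metis
      have "norm (u m - u n) = norm (c m - c n)" for m n
        by (simp add: c norm_scaleC flip: cvec.scale_left_diff_distrib)
      then have "Cauchy c" using LIMSEQ_imp_Cauchy[OF x] by (simp add: Cauchy_def dist_norm)
      then obtain d where d: "c \<longlonglongrightarrow> d" by (auto simp: Cauchy_convergent_iff convergent_def)
      have "(\<lambda>n. norm (u n - d *\<^sub>C 1)) \<longlonglongrightarrow> 0"
        using tendsto_norm_zero[OF LIM_zero[OF d]]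
        by (simp add: c norm_scaleC flip: cvec.scale_left_diff_distrib)
      then have "u \<longlonglongrightarrow> d *\<^sub>C 1" by (simp add: LIM_zero_iff tendsto_norm_zero_iff)
      then have "x = d *\<^sub>C 1" using x LIMSEQ_unique by blast
      then show "x \<in> ?R" by blast
    qed
  qed
  then show ?thesis by (rule subalg_least) simp
qed

lemma empty_subset: "csubspace K \<Longrightarrow> 1 \<in> K \<Longrightarrow> \<A> {} \<subseteq> K"
  using empty_scalar csubspace_scale by blast

lemma state_functional: "state_on (\<A> T) \<phi> \<Longrightarrow> positive_functional (\<A> T) \<phi>"
  by (rule positive_functionalI) (simp add: state_on_iff)

lemma empty_state: "state_on (\<A> {}) \<phi> \<Longrightarrow> \<phi> (c *\<^sub>C 1) = c"
  using clinear_on_scale[OF _ cstar_subalgebra_csubspace[OF subalg], of "{}" \<phi> 1 c]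
  by (simp add: state_on_def mem_one)

lemma empty_state_unique:
  assumes "state_on (\<A> {}) \<psi>" "state_on (\<A> {}) \<phi>" "x \<in> \<A> {}" shows "\<psi> x = \<phi> x"
proof -
  obtain c where "x = c *\<^sub>C 1" using assms(3) empty_scalar by blast
  then show ?thesis using empty_state[OF assms(1), of c] empty_state[OF assms(2), of c] by simp
qed

lemma empty_pure: "state_on (\<A> {}) \<phi> \<Longrightarrow> pure_state_on (\<A> {}) \<phi>"
  unfolding pure_state_on_def
  by (intro conjI allI impI ballI) (assumption | rule empty_state_unique)+

lemma empty_even: "even_on a {} \<phi>"
  using empty_scalar by (auto simp: even_on_def parity_scale parity_one)

text \<open>Stated for \<open>\<phi>\<close> alone rather than for separate marginals, which are its
  restrictions.\<close>

definition factorizes :: "('a \<Rightarrow> complex) \<Rightarrow> nat set \<Rightarrow> nat set \<Rightarrow> bool"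
  where "factorizes \<phi> I J \<longleftrightarrow> (\<forall>x\<in>\<A> I. \<forall>y\<in>\<A> J. \<phi> (x * y) = \<phi> x * \<phi> y)"

lemma factorizesD: "factorizes \<phi> I J \<Longrightarrow> x \<in> \<A> I \<Longrightarrow> y \<in> \<A> J \<Longrightarrow> \<phi> (x * y) = \<phi> x * \<phi> y"
  by (simp add: factorizes_def)

lemma factorizes_subset: "factorizes \<phi> I J \<Longrightarrow> I' \<subseteq> I \<Longrightarrow> J' \<subseteq> J \<Longrightarrow> factorizes \<phi> I' J'"
  unfolding factorizes_def using subalg_mono by blast

text \<open>Prepared for \<open>union_least\<close> and \<open>directed_union_least\<close>:
  identities checked on products or along a chain extend by linearity and continuity of
  \<open>\<phi>\<close> on \<open>\<A> T\<close>.\<close>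

lemma factorizes_closed:
  assumes st: "state_on (\<A> T) \<phi>" and x: "x \<in> \<A> T"
  shows "closed_csubspace {y \<in> \<A> T. \<phi> (x * y) = \<phi> x * \<phi> y}"
    and "closed_csubspace {y \<in> \<A> T. \<phi> (y * x) = \<phi> y * \<phi> x}"
    and "closed_csubspace {y \<in> \<A> T. \<phi> (\<Theta> y) = \<phi> y}"
proof -
  interpret positive_functional "\<A> T" \<phi> by (rule state_functional[OF st])
  note closed = cstar_subalgebra_closed[OF subalg]
  show "closed_csubspace {y \<in> \<A> T. \<phi> (x * y) = \<phi> x * \<phi> y}"
    by (rule closed_csubspace_eq[OF subspace closed])
      (auto simp: clinear_on_def linD mems x distrib_left mult_scaleC_right algebra_simps
        intro!: continuous_on_compose2[OF continuous] continuous_intros continuous)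
  show "closed_csubspace {y \<in> \<A> T. \<phi> (y * x) = \<phi> y * \<phi> x}"
    by (rule closed_csubspace_eq[OF subspace closed])
      (auto simp: clinear_on_def linD mems x distrib_right mult_scaleC_left algebra_simps
        intro!: continuous_on_compose2[OF continuous] continuous_intros continuous)
  show "closed_csubspace {y \<in> \<A> T. \<phi> (\<Theta> y) = \<phi> y}"
    by (rule closed_csubspace_eq[OF subspace closed])
      (auto simp: clinear_on_def linD mems parity parity_mem
        intro!: continuous_on_compose2[OF continuous] parity_continuous continuous_intros continuous)
qed

lemma factorizes_empty:
  assumes st: "state_on (\<A> T) \<phi>" and I: "I \<subseteq> T"
  shows "factorizes \<phi> I {}"
  unfolding factorizes_def
proof (intro ballI)
  fix x y assume x: "x \<in> \<A> I" and y: "y \<in> \<A> {}"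
  have "x \<in> \<A> T" using x subalg_mono[OF I] by auto
  then have "\<A> {} \<subseteq> {y \<in> \<A> T. \<phi> (x * y) = \<phi> x * \<phi> y}"
    using factorizes_closed(1)[OF st] st
    by (intro empty_subset) (auto simp: closed_csubspace_iff mem_one state_on_def)
  then show "\<phi> (x * y) = \<phi> x * \<phi> y" using y by auto
qed

lemma factorizes_swap:
  assumes d: "I \<inter> J = {}" and st: "state_on (\<A> T) \<phi>" and T: "I \<union> J \<subseteq> T"
    and fac: "factorizes \<phi> I J" and even: "even_on a J \<phi>"
  shows "factorizes \<phi> J I"
proof -
  have "positive_on (\<A> (I \<union> J)) \<phi>"
    using state_on_subset[OF st subalg_mono[OF T]] by (simp add: state_on_iff)
  then show ?thesis
    unfolding factorizes_def using product_swap[OF d _ even] fac by (simp add: factorizes_def)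
qed

lemma factorizes_union:
  assumes d: "J \<inter> K = {}" and st: "state_on (\<A> T) \<phi>" and T: "I \<union> J \<union> K \<subseteq> T"
    and fac: "factorizes \<phi> I J" "factorizes \<phi> (I \<union> J) K"
  shows "factorizes \<phi> I (J \<union> K)"
  unfolding factorizes_def
proof (intro ballI)
  fix x y assume x: "x \<in> \<A> I" and y: "y \<in> \<A> (J \<union> K)"
  have sub: "\<A> I \<subseteq> \<A> T" "\<A> J \<subseteq> \<A> T" "\<A> K \<subseteq> \<A> T"
    "\<A> I \<subseteq> \<A> (I \<union> J)" "\<A> J \<subseteq> \<A> (I \<union> J)"
    using T by (auto intro!: subalg_mono)
  have "\<A> (J \<union> K) \<subseteq> {y \<in> \<A> T. \<phi> (x * y) = \<phi> x * \<phi> y}"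
  proof (rule union_least[OF d factorizes_closed(1)[OF st]])
    show "x \<in> \<A> T" using x sub by auto
    fix u v assume u: "u \<in> \<A> J" and v: "v \<in> \<A> K"
    have "x * u \<in> \<A> (I \<union> J)" using x u sub by (intro mem_mult) auto
    then have "\<phi> (x * (u * v)) = \<phi> (x * u) * \<phi> v"
      using factorizesD[OF fac(2) _ v] by (simp add: mult.assoc[symmetric])
    also have "\<dots> = \<phi> x * \<phi> (u * v)"
      using factorizesD[OF fac(1) x u] factorizesD[OF fac(2), of u v] u v sub by auto
    finally show "u * v \<in> {y \<in> \<A> T. \<phi> (x * y) = \<phi> x * \<phi> y}"
      using u v sub by (auto intro: mem_mult)
  qed
  then show "\<phi> (x * y) = \<phi> x * \<phi> y" using y by auto
qed

lemma even_union:
  assumes d: "J \<inter> K = {}" and st: "state_on (\<A> T) \<phi>" and T: "J \<union> K \<subseteq> T"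
    and fac: "factorizes \<phi> J K" and even: "even_on a J \<phi>" "even_on a K \<phi>"
  shows "even_on a (J \<union> K) \<phi>"
proof -
  have sub: "\<A> J \<subseteq> \<A> T" "\<A> K \<subseteq> \<A> T" using T by (auto intro!: subalg_mono)
  have "\<A> (J \<union> K) \<subseteq> {y \<in> \<A> T. \<phi> (\<Theta> y) = \<phi> y}"
  proof (rule union_least[OF d factorizes_closed(3)[OF st mem_one]])
    fix u v assume u: "u \<in> \<A> J" and v: "v \<in> \<A> K"
    have "\<phi> (\<Theta> (u * v)) = \<phi> (u * v)"
      using factorizesD[OF fac parity_mem[OF u] parity_mem[OF v]] factorizesD[OF fac u v] even u v
      by (simp add: parity even_on_def)
    then show "u * v \<in> {y \<in> \<A> T. \<phi> (\<Theta> y) = \<phi> y}" using u v sub by (auto intro: mem_mult)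
  qed
  then show ?thesis by (auto simp: even_on_def)
qed

section \<open>A fixed sequence in which each block factorizes from its predecessors\<close>

context
  fixes W :: "nat \<Rightarrow> nat set" and \<phi> :: "'a \<Rightarrow> complex"
  assumes disj: "disjoint_family W" and st: "state_on (\<A> (\<Union>k. W k)) \<phi>"
    and fac: "\<And>k. factorizes \<phi> (\<Union>i<k. W i) (W k)"
begin

lemma disjW: "i \<noteq> j \<Longrightarrow> W i \<inter> W j = {}"
  using disj by (auto simp: disjoint_family_on_def)

lemma disj_Union:
  assumes "k \<notin> M" shows "(\<Union>i\<in>M. W i) \<inter> W k = {}"
proof -
  have "W i \<inter> W k = {}" if "i \<in> M" for i using disjW[of i k] that assms by auto
  then show ?thesis by auto
qed

lemma sequence_even:
  assumes even: "\<And>k. k \<in> M \<Longrightarrow> even_on a (W k) \<phi>"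
  shows "even_on a (\<Union>k\<in>M. W k) \<phi>"
proof -
  define Q where "Q k = (\<Union>i\<in>M \<inter> {..<k}. W i)" for k
  have Q: "even_on a (Q k) \<phi>" for k
  proof (induction k)
    case 0 then show ?case by (simp add: Q_def empty_even)
  next
    case (Suc k)
    show ?case
    proof (cases "k \<in> M")
      case True
      have eq: "Q (Suc k) = Q k \<union> W k" using True by (auto simp: Q_def less_Suc_eq)
      show ?thesis
        unfolding eq
      proof (rule even_union[OF _ st])
        show "Q k \<inter> W k = {}" unfolding Q_def by (rule disj_Union) simp
        show "factorizes \<phi> (Q k) (W k)" by (rule factorizes_subset[OF fac[of k]]) (auto simp: Q_def)
      qed (use Suc even True in \<open>auto simp: Q_def\<close>)
    next
      case False
      then have "Q (Suc k) = Q k" by (auto simp: Q_def less_Suc_eq)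
      then show ?thesis using Suc by simp
    qed
  qed
  have UQ: "(\<Union>k. Q k) = (\<Union>k\<in>M. W k)" by (auto simp: Q_def)
  have "\<A> (\<Union>k. Q k) \<subseteq> {y \<in> \<A> (\<Union>k. W k). \<phi> (\<Theta> y) = \<phi> y}"
  proof (rule directed_union_least[OF factorizes_closed(3)[OF st mem_one]])
    show "incseq Q" unfolding Q_def by (intro incseq_SucI UN_mono) auto
    fix k
    have "\<A> (Q k) \<subseteq> \<A> (\<Union>k. W k)" by (rule subalg_mono) (auto simp: Q_def)
    then show "\<A> (Q k) \<subseteq> {y \<in> \<A> (\<Union>k. W k). \<phi> (\<Theta> y) = \<phi> y}"
      using Q[of k] by (auto simp: even_on_def)
  qed
  then show ?thesis by (auto simp: even_on_def UQ)
qed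

text \<open>Later blocks already stand on the right of \<open>W j\<close>; earlier ones stand on its
  left and must be moved across, which uses evenness on \<open>W j\<close>. Block \<open>0\<close>
  has no predecessors, hence the form of the hypothesis.\<close>

lemma sequence_factorizes:
  assumes even: "j \<noteq> 0 \<Longrightarrow> even_on a (W j) \<phi>"
  shows "factorizes \<phi> (W j) (\<Union>i\<in>-{j}. W i)"
proof -
  \<comment> \<open>\<open>R 0\<close> collects the predecessors of \<open>j\<close>. Each step adds
    the block \<open>j + m\<close>, except for \<open>m = 0\<close>, because \<open>j\<close> itself
    is left out.\<close>
  define R where "R m = (\<Union>i\<in>{..<j + m} - {j}. W i)" for m
  have R: "factorizes \<phi> (W j) (R m)" for m
  proof (induction m)
    case 0
    show ?case
    proof (cases "j = 0")
      case True
      then show ?thesis using factorizes_empty[OF st, of "W 0"] by (auto simp: R_def)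
    next
      case False
      have "R 0 = (\<Union>i<j. W i)" by (auto simp: R_def)
      then show ?thesis
        using factorizes_swap[OF _ st _ fac even[OF False]] disj_Union[of j "{..<j}"] by auto
    qed
  next
    case (Suc m)
    show ?case
    proof (cases "m = 0")
      case True
      then have "R (Suc m) = R m" by (auto simp: R_def less_Suc_eq)
      then show ?thesis using Suc by simp
    next
      case False
      have "{..<j + Suc m} - {j} = insert (j + m) ({..<j + m} - {j})" using False by auto
      then have eq: "R (Suc m) = R m \<union> W (j + m)" by (simp add: R_def Un_commute)
      show ?thesis
        unfolding eq
      proof (rule factorizes_union[OF _ st _ Suc])
        show "R m \<inter> W (j + m) = {}" unfolding R_def by (rule disj_Union) simp
        show "factorizes \<phi> (W j \<union> R m) (W (j + m))"
        proof (rule factorizes_subset[OF fac[of "j + m"]])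
          show "W j \<union> R m \<subseteq> (\<Union>i<j + m. W i)"
            unfolding R_def using False by (intro Un_least UN_upper UN_mono) auto
        qed simp
      qed (auto simp: R_def)
    qed
  qed
  have UR: "(\<Union>m. R m) = (\<Union>i\<in>-{j}. W i)"
  proof
    show "(\<Union>i\<in>-{j}. W i) \<subseteq> (\<Union>m. R m)"
    proof
      fix x assume "x \<in> (\<Union>i\<in>-{j}. W i)"
      then obtain i where "i \<noteq> j" "x \<in> W i" by auto
      then have "x \<in> R (Suc i)" by (auto simp: R_def)
      then show "x \<in> (\<Union>m. R m)" by blast
    qed
  qed (auto simp: R_def)
  show ?thesis
    unfolding factorizes_def
  proof (intro ballI)
    fix x y assume x: "x \<in> \<A> (W j)" and y: "y \<in> \<A> (\<Union>i\<in>-{j}. W i)"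
    have xT: "x \<in> \<A> (\<Union>k. W k)" using x subalg_mono[of "W j" "\<Union>k. W k"] by auto
    have "\<A> (\<Union>m. R m) \<subseteq> {y \<in> \<A> (\<Union>k. W k). \<phi> (x * y) = \<phi> x * \<phi> y}"
    proof (rule directed_union_least[OF factorizes_closed(1)[OF st xT]])
      show "incseq R" unfolding R_def by (intro incseq_SucI UN_mono) auto
      fix k
      have "\<A> (R k) \<subseteq> \<A> (\<Union>k. W k)" by (rule subalg_mono) (auto simp: R_def)
      then show "\<A> (R k) \<subseteq> {y \<in> \<A> (\<Union>k. W k). \<phi> (x * y) = \<phi> x * \<phi> y}"
        using factorizesD[OF R x] by auto
    qed
    then show "\<phi> (x * y) = \<phi> x * \<phi> y" using y by (auto simp: UR)
  qed
qed

text \<open>Finite unions of pure blocks are pure by \<open>product_pure\<close>. A functional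
  \<open>\<omega>\<close> dominated by \<open>\<phi>\<close> is then
  \<open>\<omega> 1 * \<phi>\<close> on every finite stage, with a constant independent of the
  stage, hence also on the closure. The converse is \<open>marginal_pure\<close> for one block
  against all others.\<close>

lemma even_sequence_pure_iff:
  assumes even: "\<And>k. even_on a (W k) \<phi>"
  shows "pure_state_on (\<A> (\<Union>k. W k)) \<phi> \<longleftrightarrow> (\<forall>k. pure_state_on (\<A> (W k)) \<phi>)"
proof
  assume pure: "pure_state_on (\<A> (\<Union>k. W k)) \<phi>"
  show "\<forall>k. pure_state_on (\<A> (W k)) \<phi>"
  proof
    fix j
    have eq: "(\<Union>k. W k) = W j \<union> (\<Union>i\<in>-{j}. W i)" by auto
    show "pure_state_on (\<A> (W j)) \<phi>"
    proof (rule marginal_pure)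
      show "W j \<inter> (\<Union>i\<in>-{j}. W i) = {}" using disj_Union[of j "-{j}"] by auto
      show "pure_state_on (\<A> (W j \<union> (\<Union>i\<in>-{j}. W i))) \<phi>" using pure eq by simp
      show "even_on a (\<Union>i\<in>-{j}. W i) \<phi>" by (rule sequence_even) (rule even)
    qed (rule factorizesD[OF sequence_factorizes[OF even]])
  qed
next
  assume pure: "\<forall>k. pure_state_on (\<A> (W k)) \<phi>"
  have sub: "\<A> (\<Union>i<k. W i) \<subseteq> \<A> (\<Union>k. W k)" for k by (rule subalg_mono) auto
  have fin: "pure_state_on (\<A> (\<Union>i<k. W i)) \<phi>" for k
  proof (induction k)
    case 0
    then show ?case using empty_pure state_on_subset[OF st sub[of 0]] by simp
  next
    case (Suc k)
    have eq: "(\<Union>i<Suc k. W i) = (\<Union>i<k. W i) \<union> W k" by (auto simp: less_Suc_eq)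
    show ?case
      unfolding eq
    proof (rule product_pure[OF _ _ factorizesD[OF fac] _ Suc])
      show "(\<Union>i<k. W i) \<inter> W k = {}" by (rule disj_Union) simp
      show "state_on (\<A> ((\<Union>i<k. W i) \<union> W k)) \<phi>"
        using state_on_subset[OF st sub[of "Suc k"]] by (simp add: eq)
      show "even_on a (\<Union>i<k. W i) \<phi>" by (rule sequence_even) (rule even)
    qed (use pure in auto)
  qed
  show "pure_state_on (\<A> (\<Union>k. W k)) \<phi>"
  proof (rule pureI[OF subalg st])
    fix \<omega> x assume \<omega>: "positive_on (\<A> (\<Union>k. W k)) \<omega>" and dom: "dominated_on (\<A> (\<Union>k. W k)) \<omega> \<phi>"
      and x: "x \<in> \<A> (\<Union>k. W k)"
    interpret w: positive_functional "\<A> (\<Union>k. W k)" \<omega> by (rule positive_functionalI[OF \<omega>])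
    interpret p: positive_functional "\<A> (\<Union>k. W k)" \<phi> by (rule state_functional[OF st])
    have eq: "(\<Union>k. \<Union>i<k. W i) = (\<Union>k. W k)" by auto
    have "\<A> (\<Union>k. \<Union>i<k. W i) \<subseteq> {x \<in> \<A> (\<Union>k. W k). \<omega> x = \<omega> 1 * \<phi> x}"
    proof (rule directed_union_least)
      show "closed_csubspace {x \<in> \<A> (\<Union>k. W k). \<omega> x = \<omega> 1 * \<phi> x}"
        by (intro closed_csubspace_eq w.lin w.subspace cstar_subalgebra_closed[OF subalg]
            w.continuous p.continuous continuous_intros)
          (auto simp: clinear_on_def p.linD algebra_simps)
      show "incseq (\<lambda>k. \<Union>i<k. W i)" by (intro incseq_SucI UN_mono) auto
      fix k
      have "\<omega> y = \<omega> 1 * \<phi> y" if y: "y \<in> \<A> (\<Union>i<k. W i)" for y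
      proof (rule pure_dominated[OF subalg fin positive_on_subset[OF \<omega> sub] _ y])
        show "Re (\<omega> (star z * z)) \<le> 1 * Re (\<phi> (star z * z))" if "z \<in> \<A> (\<Union>i<k. W i)" for z
          using dom that sub by (auto simp: dominated_on_def)
      qed
      then show "\<A> (\<Union>i<k. W i) \<subseteq> {x \<in> \<A> (\<Union>k. W k). \<omega> x = \<omega> 1 * \<phi> x}" using sub by auto
    qed
    then show "\<omega> x = \<omega> 1 * \<phi> x" using x unfolding eq by auto
  qed
qed

end

text \<open>Induction detaches the last factor: for fixed \<open>y\<close> the elements
  \<open>x\<close> with \<open>x * y \<in> K\<close> form another closed subspace, which is why
  \<open>K\<close> is generalised.\<close>

lemma finite_products_least:
  assumes "disjoint_family_on I {1..k}" and K: "closed_csubspace K"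
    and "\<And>A. (\<And>i. i \<in> {1..k} \<Longrightarrow> A i \<in> \<A> (I i)) \<Longrightarrow> prod_list (map A [1..<Suc k]) \<in> K"
  shows "\<A> (\<Union>i\<in>{1..k}. I i) \<subseteq> K"
  using assms
proof (induction k arbitrary: K)
  case 0
  then show ?case by (auto intro!: empty_subset[THEN subsetD] simp: closed_csubspace_iff)
next
  case (Suc k)
  have eq: "(\<Union>i\<in>{1..Suc k}. I i) = (\<Union>i\<in>{1..k}. I i) \<union> I (Suc k)"
    by (simp add: atLeastAtMostSuc_conv Un_commute)
  have d: "disjoint_family_on I {1..k}" using Suc.prems(1) by (auto simp: disjoint_family_on_def)
  show ?case
    unfolding eq
  proof (rule union_least[OF _ Suc.prems(2)])
    have "I i \<inter> I (Suc k) = {}" if "i \<in> {1..k}" for i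
      using disjoint_family_onD[OF Suc.prems(1), of i "Suc k"] that by simp
    then show "(\<Union>i\<in>{1..k}. I i) \<inter> I (Suc k) = {}" by blast
    fix x y assume x: "x \<in> \<A> (\<Union>i\<in>{1..k}. I i)" and y: "y \<in> \<A> (I (Suc k))"
    have "\<A> (\<Union>i\<in>{1..k}. I i) \<subseteq> {x. x * y \<in> K}"
    proof (rule Suc.IH[OF d])
      have "closed ((\<lambda>x. x * y) -` K)"
        by (rule closed_vimage) (use Suc.prems(2) in \<open>auto simp: closed_csubspace_iff intro!: continuous_intros\<close>)
      then show "closed_csubspace {x. x * y \<in> K}"
        using Suc.prems(2)
        by (auto simp: closed_csubspace_def distrib_right mult_scaleC_left vimage_def)
      fix A assume A: "\<And>i. i \<in> {1..k} \<Longrightarrow> A i \<in> \<A> (I i)"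
      have "prod_list (map (A(Suc k := y)) [1..<Suc (Suc k)]) \<in> K"
        by (rule Suc.prems(3)) (use A y in \<open>auto simp: le_Suc_eq\<close>)
      moreover have "map (A(Suc k := y)) [1..<Suc (Suc k)] = map A [1..<Suc k] @ [y]" by auto
      ultimately show "prod_list (map A [1..<Suc k]) \<in> {x. x * y \<in> K}" by (simp del: upt_Suc)
    qed
    then show "x * y \<in> K" using x by auto
  qed
qed

end

theorem theorem2:
  fixes a :: "nat \<Rightarrow> 'a::cstar_algebra"
    and N :: enat
    and I :: "nat \<Rightarrow> nat set"
    and \<phi>s :: "nat \<Rightarrow> 'a \<Rightarrow> complex"
    and \<phi> :: "'a \<Rightarrow> complex"
    and H :: "'h::chilbert_space set" and \<pi> :: "'a \<Rightarrow> 'h \<Rightarrow> 'h" and \<Omega> :: 'h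
    and H' :: "'k::chilbert_space set" and \<pi>' :: "'a \<Rightarrow> 'k \<Rightarrow> 'k" and \<Omega>' :: 'k
  assumes "car_generators a"
    and "N \<ge> 1"
    and "disjoint_family_on I (labels N)"
    and "\<And>i. i \<in> labels N \<Longrightarrow> state_on (car_subalgebra a (I i)) (\<phi>s i)"
    and "product_state_extension a N I \<phi>s \<phi>"
    and "\<And>i. i \<in> labels N \<Longrightarrow> i \<noteq> 1 \<Longrightarrow> even_on a (I i) (\<phi>s i)"
  shows
    "(pure_state_on (car_subalgebra a (\<Union>i\<in>labels N. I i)) \<phi> \<longrightarrow>
        pure_state_on (car_subalgebra a (I 1)) (\<phi>s 1)) \<and>
     (gns_triple (car_subalgebra a (I 1)) (\<phi>s 1) H \<pi> \<Omega> \<longrightarrow>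
        gns_triple (car_subalgebra a (I 1)) (\<phi>s 1 \<circ> car_parity a) H' \<pi>' \<Omega>' \<longrightarrow>
        \<not> disjoint_representations (car_subalgebra a (I 1)) H \<pi> H' \<pi>' \<longrightarrow>
        (pure_state_on (car_subalgebra a (\<Union>i\<in>labels N. I i)) \<phi> \<longleftrightarrow>
          (\<forall>i\<in>labels N. pure_state_on (car_subalgebra a (I i)) (\<phi>s i)))) \<and>
     (even_on a (\<Union>i\<in>labels N. I i) \<phi> \<longrightarrow>
        (gns_triple (car_subalgebra a (I 1)) (\<phi>s 1) H \<pi> \<Omega> \<longrightarrow>
          gns_triple (car_subalgebra a (I 1)) (\<phi>s 1 \<circ> car_parity a) H' \<pi>' \<Omega>' \<longrightarrow>
          \<not> disjoint_representations (car_subalgebra a (I 1)) H \<pi> H' \<pi>') \<and>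
        (pure_state_on (car_subalgebra a (\<Union>i\<in>labels N. I i)) \<phi> \<longleftrightarrow>
          (\<forall>i\<in>labels N. pure_state_on (car_subalgebra a (I i)) (\<phi>s i))))"
proof -
  interpret car a by unfold_locales (rule assms(1))
  let ?T = "\<Union>i\<in>labels N. I i"
  have one: "1 \<in> labels N" using assms(2) by (simp add: labels_def one_enat_def)
  have down: "j \<in> labels N" if "k \<in> labels N" "1 \<le> j" "j \<le> k" for j k
    using that by (auto simp: labels_def intro: order_trans[of "enat j" "enat k"])
  have st: "state_on (\<A> ?T) \<phi>"
    and ext: "\<And>k A. k \<in> labels N \<Longrightarrow> (\<And>i. i \<in> {1..k} \<Longrightarrow> A i \<in> \<A> (I i)) \<Longrightarrow>
      \<phi> (prod_list (map A [1..<Suc k])) = (\<Prod>i=1..k. \<phi>s i (A i))"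
    using assms(5) by (auto simp: product_state_extension_def)
  \<comment> \<open>The product formula concerns lists of elements; density of ordered products
    turns it into factorization between the first \<open>k - 1\<close> subalgebras and the next
    one.\<close>
  have fac_labels: "\<phi> (x * y) = \<phi> x * \<phi>s k y"
    if k: "k \<in> labels N" and x: "x \<in> \<A> (\<Union>i\<in>{1..<k}. I i)" and y: "y \<in> \<A> (I k)" for k x y
  proof -
    interpret p: positive_functional "\<A> ?T" \<phi> by (rule state_functional[OF st])
    obtain l where l: "k = Suc l" using k by (cases k) (auto simp: labels_def)
    have ll: "{1..<k} = {1..l}" by (auto simp: l)
    have lN: "i \<in> labels N" if "i \<in> {1..l}" for i using down[OF k] that l by auto
    have sub: "\<A> (I i) \<subseteq> \<A> ?T" if "i \<in> labels N" for i using that by (intro subalg_mono) auto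
    have yT: "y \<in> \<A> ?T" using y k sub by auto
    have "\<A> (\<Union>i\<in>{1..l}. I i) \<subseteq> {x \<in> \<A> ?T. \<phi> (x * y) = \<phi> x * \<phi>s k y}"
    proof (rule finite_products_least)
      show "disjoint_family_on I {1..l}"
        using assms(3) lN by (auto simp: disjoint_family_on_def)
      show "closed_csubspace {x \<in> \<A> ?T. \<phi> (x * y) = \<phi> x * \<phi>s k y}"
        by (rule closed_csubspace_eq[OF p.subspace cstar_subalgebra_closed[OF subalg]])
          (auto simp: clinear_on_def p.linD mems yT distrib_right mult_scaleC_left algebra_simps
            intro!: continuous_on_compose2[OF p.continuous] continuous_intros p.continuous)
      fix A assume A: "\<And>i. i \<in> {1..l} \<Longrightarrow> A i \<in> \<A> (I i)"
      have m: "map (A(k := y)) [1..<Suc k] = map A [1..<Suc l] @ [y]" by (auto simp: l)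
      have "\<phi> (prod_list (map (A(k := y)) [1..<Suc k])) = (\<Prod>i=1..k. \<phi>s i ((A(k := y)) i))"
        by (rule ext[OF k]) (use A y in \<open>auto simp: l\<close>)
      also have "(\<Prod>i=1..k. \<phi>s i ((A(k := y)) i)) = (\<Prod>i=1..l. \<phi>s i (A i)) * \<phi>s k y"
        by (simp add: l prod.cl_ivl_Suc)
      also have "(\<Prod>i=1..l. \<phi>s i (A i)) = \<phi> (prod_list (map A [1..<Suc l]))"
      \<comment> \<open>There is no label \<open>0\<close>, so the empty product is evaluated by
        \<open>\<phi> 1 = 1\<close>.\<close>
      proof (cases "l = 0")
        case True then show ?thesis using st by (simp add: state_on_def)
      next
        case False then show ?thesis using ext[OF lN[of l] A] by simp
      qed
      finally have "\<phi> (prod_list (map A [1..<Suc l]) * y) = \<phi> (prod_list (map A [1..<Suc l])) * \<phi>s k y"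
        by (simp only: m prod_list.append prod_list.Cons prod_list.Nil mult_1_right)
      moreover have pm: "prod_list (map A xs) \<in> \<A> ?T" if "set xs \<subseteq> {1..l}" for xs
        using that A lN sub by (induction xs) (auto intro!: mem_one mem_mult)
      have "prod_list (map A [1..<Suc l]) \<in> \<A> ?T" by (rule pm) (simp only: set_upt, auto)
      ultimately show "prod_list (map A [1..<Suc l]) \<in> {x \<in> \<A> ?T. \<phi> (x * y) = \<phi> x * \<phi>s k y}"
        by simp
    qed
    moreover have "x \<in> \<A> (\<Union>i\<in>{1..l}. I i)" using x by (simp only: ll)
    ultimately show ?thesis by blast
  qed
  have eq_s: "\<phi> y = \<phi>s k y" if "k \<in> labels N" "y \<in> \<A> (I k)" for k y
    using fac_labels[OF that(1) mem_one that(2)] st by (simp add: state_on_def)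
  have pure_s: "pure_state_on (\<A> (I k)) (\<phi>s k) \<longleftrightarrow> pure_state_on (\<A> (I k)) \<phi>" if "k \<in> labels N" for k
    using pure_state_on_cong[OF subalg, of "I k" \<phi> "\<phi>s k"] eq_s[OF that] by simp

  \<comment> \<open>Labels are shifted to start at \<open>0\<close> and missing ones filled with the
    empty set, so that finite and infinite \<open>N\<close> are treated alike.\<close>
  define W where "W k = (if Suc k \<in> labels N then I (Suc k) else {})" for k
  have WU: "(\<Union>k. W k) = ?T"
  proof
    show "?T \<subseteq> (\<Union>k. W k)"
    proof
      fix x assume "x \<in> ?T"
      then obtain i where i: "i \<in> labels N" "x \<in> I i" by auto
      then obtain k where "i = Suc k" by (cases i) (auto simp: labels_def)
      then have "x \<in> W k" using i by (simp add: W_def)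
      then show "x \<in> (\<Union>k. W k)" by blast
    qed
  qed (auto simp: W_def split: if_splits)
  have W0: "W 0 = I 1" using one by (simp add: W_def)
  have disj: "disjoint_family W"
    using assms(3) by (auto simp: disjoint_family_on_def W_def)
  have stW: "state_on (\<A> (\<Union>k. W k)) \<phi>" using st WU by simp
  have fac: "factorizes \<phi> (\<Union>i<k. W i) (W k)" for k
  proof (cases "Suc k \<in> labels N")
    case True
    have sub: "\<A> (\<Union>i<k. W i) \<subseteq> \<A> (\<Union>i\<in>{1..<Suc k}. I i)"
      by (rule subalg_mono) (fastforce simp: W_def split: if_splits)
    show ?thesis
      unfolding factorizes_def
    proof (intro ballI)
      fix x y assume x: "x \<in> \<A> (\<Union>i<k. W i)" and y: "y \<in> \<A> (W k)"
      have "y \<in> \<A> (I (Suc k))" using y True by (simp add: W_def)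
      then show "\<phi> (x * y) = \<phi> x * \<phi> y"
        using fac_labels[OF True _] eq_s[OF True] x sub by auto
    qed
  next
    case False
    then show ?thesis using factorizes_empty[OF stW, of "\<Union>i<k. W i"] by (auto simp: W_def)
  qed
  have evenW: "even_on a (W k) \<phi>" if "k \<noteq> 0" for k
  proof (cases "Suc k \<in> labels N")
    case True
    then have "even_on a (I (Suc k)) (\<phi>s (Suc k))" using assms(6) that by simp
    then show ?thesis using True by (simp add: W_def even_on_def eq_s parity_mem)
  qed (simp add: W_def empty_even)
  let ?I = "I 1" and ?R = "\<Union>k\<in>-{0}. W k"
  have Teq: "?T = ?I \<union> ?R" unfolding WU[symmetric] W0[symmetric] by auto
  have d: "?I \<inter> ?R = {}" using disj_Union[OF disj stW fac, of 0 "- {0}"] W0 by (simp add: Int_commute)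
  have prod: "\<phi> (x * y) = \<phi> x * \<phi> y" if "x \<in> \<A> ?I" "y \<in> \<A> ?R" for x y
    using factorizesD[OF sequence_factorizes[OF disj stW fac, of 0]] that W0 by simp
  have evenR: "even_on a ?R \<phi>" by (rule sequence_even[OF disj stW fac]) (use evenW in auto)
  have st2: "state_on (\<A> (?I \<union> ?R)) \<phi>" using st Teq by simp
  have Rpure: "pure_state_on (\<A> ?R) \<phi> \<longleftrightarrow> (\<forall>i\<in>labels N - {1}. pure_state_on (\<A> (I i)) (\<phi>s i))"
  proof -
    \<comment> \<open>Shifting once more leaves a sequence of even blocks, to which
      \<open>even_sequence_pure_iff\<close> applies.\<close>
    define W' where "W' k = W (Suc k)" for k
    have W'U: "(\<Union>k. W' k) = ?R"
    proof
      show "?R \<subseteq> (\<Union>k. W' k)"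
      proof
        fix x assume "x \<in> ?R"
        then obtain i where "i \<noteq> 0" "x \<in> W i" by auto
        then have "x \<in> W' (i - 1)" by (simp add: W'_def)
        then show "x \<in> (\<Union>k. W' k)" by blast
      qed
    qed (auto simp: W'_def)
    have "pure_state_on (\<A> (\<Union>k. W' k)) \<phi> \<longleftrightarrow> (\<forall>k. pure_state_on (\<A> (W' k)) \<phi>)"
    proof (rule even_sequence_pure_iff)
      show "disjoint_family W'" using disj by (auto simp: disjoint_family_on_def W'_def)
      show "state_on (\<A> (\<Union>k. W' k)) \<phi>"
        by (rule state_on_subset[OF stW subalg_mono]) (auto simp: W'_def)
      show "factorizes \<phi> (\<Union>i<k. W' i) (W' k)" for k
        by (rule factorizes_subset[OF fac[of "Suc k"]]) (auto simp: W'_def)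
      show "even_on a (W' k) \<phi>" for k by (simp add: W'_def evenW)
    qed
    also have "(\<forall>k. pure_state_on (\<A> (W' k)) \<phi>) \<longleftrightarrow> (\<forall>i\<in>labels N - {1}. pure_state_on (\<A> (I i)) (\<phi>s i))"
    proof
      assume p: "\<forall>k. pure_state_on (\<A> (W' k)) \<phi>"
      show "\<forall>i\<in>labels N - {1}. pure_state_on (\<A> (I i)) (\<phi>s i)"
      proof
        fix i assume i: "i \<in> labels N - {1}"
        then obtain k where k: "i = Suc (Suc k)"
          by (cases i; cases "i - 1") (auto simp: labels_def)
        then show "pure_state_on (\<A> (I i)) (\<phi>s i)"
          using p[rule_format, of k] i pure_s[of i] by (simp add: W'_def W_def)
      qed
    next
      assume p: "\<forall>i\<in>labels N - {1}. pure_state_on (\<A> (I i)) (\<phi>s i)"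
      show "\<forall>k. pure_state_on (\<A> (W' k)) \<phi>"
      proof
        fix k
        show "pure_state_on (\<A> (W' k)) \<phi>"
        proof (cases "Suc (Suc k) \<in> labels N")
          case True
          then show ?thesis using p pure_s[OF True] by (simp add: W'_def W_def)
        next
          case False
          have "state_on (\<A> {}) \<phi>" by (rule state_on_subset[OF st subalg_mono]) simp
          then show ?thesis using False by (simp add: W'_def W_def empty_pure)
        qed
      qed
    qed
    finally show ?thesis by (simp add: W'U)
  qed
  have all: "(\<forall>i\<in>labels N. pure_state_on (\<A> (I i)) (\<phi>s i)) \<longleftrightarrow>
      pure_state_on (\<A> ?I) \<phi> \<and> pure_state_on (\<A> ?R) \<phi>"
    using Rpure pure_s[OF one] one by auto
  have part1: "pure_state_on (\<A> ?I) \<phi>" if "pure_state_on (\<A> ?T) \<phi>"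
    by (rule marginal_pure[OF d _ prod evenR]) (use that Teq in simp)
  have part2: "pure_state_on (\<A> ?T) \<phi> \<longleftrightarrow> (\<forall>i\<in>labels N. pure_state_on (\<A> (I i)) (\<phi>s i))"
    if g1: "gns_triple (\<A> ?I) (\<phi>s 1) H \<pi> \<Omega>" and g2: "gns_triple (\<A> ?I) (\<phi>s 1 \<circ> \<Theta>) H' \<pi>' \<Omega>'"
      and nd: "\<not> disjoint_representations (\<A> ?I) H \<pi> H' \<pi>'"
  proof -
    \<comment> \<open>A pure first marginal may be assumed: otherwise both sides of the goal fail,
      by \<open>part1\<close> and \<open>all\<close>.\<close>
    have "pure_state_on (\<A> ?T) \<phi> \<longleftrightarrow> pure_state_on (\<A> ?R) \<phi>" if pI: "pure_state_on (\<A> ?I) \<phi>"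
    proof -
      have pI1: "pure_state_on (\<A> ?I) (\<phi>s 1)" using pI pure_s[OF one] by simp
      obtain \<xi> where \<xi>: "\<xi> \<in> H" "\<And>x. x \<in> \<A> ?I \<Longrightarrow> cinner \<xi> (\<pi> x \<xi>) = \<phi>s 1 (\<Theta> x)"
        using nondisjoint_vector[OF g1 g2 pI1 nd] by blast
      have g: "gns_triple (\<A> ?I) \<phi> H \<pi> \<Omega>" using g1 eq_s[OF one] by (simp add: gns_triple_def)
      have \<xi>': "cinner \<xi> (\<pi> x \<xi>) = \<phi> (\<Theta> x)" if "x \<in> \<A> ?I" for x
        using \<xi>(2)[OF that] eq_s[OF one parity_mem[OF that]] by simp
      obtain \<phi>' where \<phi>': "state_on (\<A> (?I \<union> ?R)) \<phi>'" "even_on a ?I \<phi>'" "pure_state_on (\<A> ?I) \<phi>'"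
        "\<And>y. y \<in> \<A> ?R \<Longrightarrow> \<phi>' y = \<phi> y"
        "\<And>x y. x \<in> \<A> ?I \<Longrightarrow> y \<in> \<A> ?R \<Longrightarrow> \<phi>' (x * y) = \<phi>' x * \<phi>' y"
        "pure_state_on (\<A> (?I \<union> ?R)) \<phi>' \<longleftrightarrow> pure_state_on (\<A> (?I \<union> ?R)) \<phi>"
        by (rule replace_by_even_marginal[OF d st2 prod evenR pI g \<xi>(1) \<xi>']) (assumption | rule that)+
      have "even_on a ?R \<phi>'" using evenR by (simp add: even_on_def \<phi>'(4) parity_mem)
      then have "pure_state_on (\<A> (?I \<union> ?R)) \<phi>' \<longleftrightarrow> pure_state_on (\<A> ?R) \<phi>'"
        using even_pair_pure_iff[OF d \<phi>'(1) \<phi>'(5) \<phi>'(2)] \<phi>'(3) by blast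
      also have "\<dots> \<longleftrightarrow> pure_state_on (\<A> ?R) \<phi>"
        using pure_state_on_cong[OF subalg, of ?R \<phi>' \<phi>] \<phi>'(4) by blast
      finally show ?thesis using \<phi>'(6) Teq by simp
    qed
    then show ?thesis using part1 all by blast
  qed
  have part3: "(gns_triple (\<A> ?I) (\<phi>s 1) H \<pi> \<Omega> \<longrightarrow> gns_triple (\<A> ?I) (\<phi>s 1 \<circ> \<Theta>) H' \<pi>' \<Omega>' \<longrightarrow>
          \<not> disjoint_representations (\<A> ?I) H \<pi> H' \<pi>') \<and>
        (pure_state_on (\<A> ?T) \<phi> \<longleftrightarrow> (\<forall>i\<in>labels N. pure_state_on (\<A> (I i)) (\<phi>s i)))"
    if even: "even_on a ?T \<phi>"
  proof (intro conjI impI)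
    have evenI: "even_on a ?I \<phi>"
      using even subalg_mono[of ?I ?T] one by (fastforce simp: even_on_def)
    show "pure_state_on (\<A> ?T) \<phi> \<longleftrightarrow> (\<forall>i\<in>labels N. pure_state_on (\<A> (I i)) (\<phi>s i))"
      unfolding all Teq by (rule even_pair_pure_iff[OF d st2 prod evenI evenR])
    assume g1: "gns_triple (\<A> ?I) (\<phi>s 1) H \<pi> \<Omega>" and g2: "gns_triple (\<A> ?I) (\<phi>s 1 \<circ> \<Theta>) H' \<pi>' \<Omega>'"
    \<comment> \<open>Evenness makes the two states equal on the first subalgebra, so the whole GNS
      spaces are equivalent subrepresentations.\<close>
    have "\<phi>s 1 x = (\<phi>s 1 \<circ> \<Theta>) x" if "x \<in> \<A> ?I" for x
      using evenI that eq_s[OF one that] eq_s[OF one parity_mem[OF that]] by (simp add: even_on_def)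
    then have ue: "unitarily_equivalent (\<A> ?I) H \<pi> H' \<pi>'" by (rule gns_unique[OF subalg g1 g2])
    interpret h: gns "\<A> ?I" "\<phi>s 1" H \<pi> \<Omega> using subalg g1 by unfold_locales
    interpret k: gns "\<A> ?I" "\<phi>s 1 \<circ> \<Theta>" H' \<pi>' \<Omega>' using subalg g2 by unfold_locales
    have s1: "\<phi>s 1 1 = 1" using assms(4)[OF one] by (simp add: state_on_def)
    \<comment> \<open>Non-disjointness asks for nonzero subrepresentations; normalisation of the
      state provides them.\<close>
    have "\<Omega> \<noteq> 0" using h.f_eq[OF mem_one] s1 by auto
    moreover have "\<Omega>' \<noteq> 0" using k.f_eq[OF mem_one] s1 by (auto simp: parity_one)
    ultimately have "H \<noteq> {0}" "H' \<noteq> {0}" using h.\<Omega> k.\<Omega> by auto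
    moreover have "subrepresentation (\<A> ?I) H \<pi> H" "subrepresentation (\<A> ?I) H' \<pi>' H'"
      using h.H k.H h.mem k.mem by (auto simp: subrepresentation_def closed_csubspace_iff)
    ultimately show "\<not> disjoint_representations (\<A> ?I) H \<pi> H' \<pi>'"
      using ue unfolding disjoint_representations_def by blast
  qed
  show ?thesis using part1 part2 part3 pure_s[OF one] by blast
qed

end
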